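(* Let $\mathscr{H}$ be an infinite dimensional separable complex Hilbert space and let $X$ be a locally compact Hausdorff space. If the automorphism group $\operatorname{Aut}(C_0(X))$ of $C_0(X)$ is algebraically reflexive, then the automorphism group $\operatorname{Aut}(C_0(X,\mathscr{B}(\mathscr{H})))$ of $C_0(X,\mathscr{B}(\mathscr{H}))$ is algebraically reflexive.
   Context: $\mathscr{B}(\mathscr{X})$ is the algebra of all bounded linear operators on a Banach space $\mathscr{X}$. $C_0(X)$ is the $C^*$-algebra of all continuous complex valued functions on $X$ vanishing at infinity, and $C_0(X,\mathscr{B}(\mathscr{H}))$ is the $C^*$-algebra of all norm-continuous functions $X\to\mathscr{B}(\mathscr{H})$ vanishing at infinity, with pointwise operations and sup norm. For a Banach algebra $\mathcal{A}$, $\operatorname{Aut}(\mathcal{A})$ is the group of automorphisms of $\mathcal{A}$, i.e. multiplicative linear bijections $\mathcal{A}\to\mathcal{A}$ (not required to preserve any involution). For a Banach space $\mathscr{X}$ and a subset $\mathscr{E}\subset\mathscr{B}(\mathscr{X})$, let $\operatorname{ref}_{al}\mathscr{E}=\{T\in\mathscr{B}(\mathscr{X}): \text{for every } x\in\mathscr{X} \text{ there is } E\in\mathscr{E} \text{ with } Tx=Ex\}$; $\mathscr{E}$ is called algebraically reflexive if $\operatorname{ref}_{al}\mathscr{E}=\mathscr{E}$. *)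

theory Defs
  imports "HOL-Analysis.Analysis"
begin

section \<open>Complex normed spaces, complex normed algebras and Hilbert spaces\<close>

text \<open>
  The distribution only has real vector spaces as type classes. The classes below add a scalar
  multiplication by complex numbers whose restriction to the reals is the given real one.
\<close>

class scaleC =
  fixes scaleC :: "complex \<Rightarrow> 'a \<Rightarrow> 'a" (infixr "*\<^sub>C" 75)

class complex_vector = real_vector + scaleC +
  assumes scaleC_add_right: "c *\<^sub>C (x + y) = c *\<^sub>C x + c *\<^sub>C y"
    and scaleC_add_left: "(c + d) *\<^sub>C x = c *\<^sub>C x + d *\<^sub>C x"
    and scaleC_scaleC: "c *\<^sub>C d *\<^sub>C x = (c * d) *\<^sub>C x"
    and scaleC_one: "1 *\<^sub>C x = x"
    and scaleC_of_real: "complex_of_real r *\<^sub>C x = r *\<^sub>R x"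

global_interpretation complex_vector: vector_space "scaleC :: complex \<Rightarrow> 'a \<Rightarrow> 'a::complex_vector"
  defines cspan = complex_vector.span
  by standard (simp_all add: scaleC_add_right scaleC_add_left scaleC_scaleC scaleC_one)

class complex_normed_vector = complex_vector + real_normed_vector +
  assumes norm_scaleC: "norm (c *\<^sub>C x) = cmod c * norm x"

class complex_normed_algebra = complex_normed_vector + real_normed_algebra +
  assumes mult_scaleC_left: "(c *\<^sub>C x) * y = c *\<^sub>C (x * y)"
    and mult_scaleC_right: "x * (c *\<^sub>C y) = c *\<^sub>C (x * y)"

text \<open>
  The inner product is linear in the first argument; \<open>cinner_self\<close> expresses both
  its positive definiteness and that it induces the norm.
\<close>

class chilbert_space = complex_normed_vector + banach +
  fixes cinner :: "'a \<Rightarrow> 'a \<Rightarrow> complex"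
  assumes cinner_add_left: "cinner (x + y) z = cinner x z + cinner y z"
    and cinner_scaleC_left: "cinner (c *\<^sub>C x) y = c * cinner x y"
    and cinner_commute: "cinner x y = cnj (cinner y x)"
    and cinner_self: "cinner x x = complex_of_real ((norm x)\<^sup>2)"

instantiation complex :: complex_normed_algebra
begin

definition scaleC_complex :: "complex \<Rightarrow> complex \<Rightarrow> complex" where
  "scaleC_complex c x = c * x"

instance
  by standard (simp_all add: scaleC_complex_def algebra_simps norm_mult scaleR_conv_of_real)

end

lemma bounded_linear_scaleC: "bounded_linear (\<lambda>x::'a::complex_normed_vector. c *\<^sub>C x)"
proof (rule bounded_linear_intro[where K = "cmod c"])
  show "c *\<^sub>C (r *\<^sub>R x) = r *\<^sub>R (c *\<^sub>C x)" for r and x :: 'a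
    by (simp add: scaleC_of_real[symmetric] scaleC_scaleC mult.commute)
qed (simp_all add: scaleC_add_right norm_scaleC mult.commute)

definition clinear :: "('a::complex_vector \<Rightarrow> 'b::complex_vector) \<Rightarrow> bool" where
  "clinear f \<longleftrightarrow> (\<forall>x y. f (x + y) = f x + f y) \<and> (\<forall>c x. f (c *\<^sub>C x) = c *\<^sub>C f x)"

definition bounded_clinear ::
    "('a::complex_normed_vector \<Rightarrow> 'b::complex_normed_vector) \<Rightarrow> bool" where
  "bounded_clinear f \<longleftrightarrow> clinear f \<and> (\<exists>K. \<forall>x. norm (f x) \<le> norm x * K)"

lemma bounded_clinear_iff:
  "bounded_clinear f \<longleftrightarrow> bounded_linear f \<and> (\<forall>c x. f (c *\<^sub>C x) = c *\<^sub>C f x)"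
proof
  assume f: "bounded_clinear f"
  then obtain K where "\<And>x. norm (f x) \<le> norm x * K"
    by (auto simp: bounded_clinear_def)
  with f have "bounded_linear f"
    by (intro bounded_linear_intro)
      (auto simp: bounded_clinear_def clinear_def scaleC_of_real[symmetric])
  with f show "bounded_linear f \<and> (\<forall>c x. f (c *\<^sub>C x) = c *\<^sub>C f x)"
    by (auto simp: bounded_clinear_def clinear_def)
next
  assume f: "bounded_linear f \<and> (\<forall>c x. f (c *\<^sub>C x) = c *\<^sub>C f x)"
  then have "\<exists>K. \<forall>x. norm (f x) \<le> norm x * K"
    using bounded_linear.bounded by blast
  with f show "bounded_clinear f"
    by (auto simp: bounded_clinear_def clinear_def linear_simps)
qed


section \<open>The algebra of bounded complex linear operators\<close>

text \<open>
  The library type of bounded real linear maps already carries the operator norm, so the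
  complex linear operators are cut out of it; multiplication is composition.
\<close>

typedef (overloaded) ('a::complex_normed_vector) cblinop =
  "{A :: 'a \<Rightarrow>\<^sub>L 'a. bounded_clinear (blinfun_apply A)}"
  morphisms blinfun_of_cblinop cblinop_of_blinfun
  by (rule exI[of _ 0]) (auto simp: bounded_clinear_def clinear_def
      complex_vector.scale_zero_right intro: exI[of _ 0])

setup_lifting type_definition_cblinop

definition cblinop_apply :: "'a::complex_normed_vector cblinop \<Rightarrow> 'a \<Rightarrow> 'a" where
  "cblinop_apply A = blinfun_apply (blinfun_of_cblinop A)"

lemma bounded_clinear_cblinop_apply: "bounded_clinear (cblinop_apply A)"
  using blinfun_of_cblinop[of A] by (simp add: cblinop_apply_def)

lemma cblinop_exists:
  assumes "bounded_clinear f"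
  obtains A where "cblinop_apply A = f"
proof -
  from assms have "blinfun_apply (Blinfun f) = f"
    by (simp add: bounded_clinear_iff bounded_linear_Blinfun_apply)
  with assms that[of "cblinop_of_blinfun (Blinfun f)"] show thesis
    by (simp add: cblinop_apply_def cblinop_of_blinfun_inverse)
qed

instantiation cblinop :: (complex_normed_vector) real_vector
begin

lift_definition zero_cblinop :: "'a cblinop" is 0
  by (auto simp: bounded_clinear_iff complex_vector.scale_zero_right blinfun.bounded_linear_right)

lift_definition plus_cblinop :: "'a cblinop \<Rightarrow> 'a cblinop \<Rightarrow> 'a cblinop" is "(+)"
  by (auto simp: bounded_clinear_iff scaleC_add_right blinfun.bounded_linear_right blinfun.add_left)

lift_definition minus_cblinop :: "'a cblinop \<Rightarrow> 'a cblinop \<Rightarrow> 'a cblinop" is "(-)"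
  by (auto simp: bounded_clinear_iff complex_vector.scale_right_diff_distrib
      blinfun.bounded_linear_right blinfun.diff_left)

lift_definition uminus_cblinop :: "'a cblinop \<Rightarrow> 'a cblinop" is uminus
  by (auto simp: bounded_clinear_iff complex_vector.scale_minus_right
      blinfun.bounded_linear_right blinfun.minus_left)

lift_definition scaleR_cblinop :: "real \<Rightarrow> 'a cblinop \<Rightarrow> 'a cblinop" is "(*\<^sub>R)"
  by (auto simp: bounded_clinear_iff blinfun.bounded_linear_right blinfun.scaleR_left
      scaleC_scaleC scaleC_of_real[symmetric] mult.commute)

instance
  by standard (transfer, simp add: algebra_simps)+

end

instantiation cblinop :: (complex_normed_vector) real_normed_vector
begin

lift_definition norm_cblinop :: "'a cblinop \<Rightarrow> real" is norm .

definition dist_cblinop :: "'a cblinop \<Rightarrow> 'a cblinop \<Rightarrow> real" where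
  "dist_cblinop A B = norm (A - B)"

definition sgn_cblinop :: "'a cblinop \<Rightarrow> 'a cblinop" where
  "sgn_cblinop A = A /\<^sub>R norm A"

definition uniformity_cblinop :: "('a cblinop \<times> 'a cblinop) filter" where
  "uniformity_cblinop = (INF e\<in>{0 <..}. principal {(A, B). dist A B < e})"

definition open_cblinop :: "'a cblinop set \<Rightarrow> bool" where
  "open_cblinop S = (\<forall>A\<in>S. \<forall>\<^sub>F (A', B) in uniformity. A' = A \<longrightarrow> B \<in> S)"

instance
proof
  fix A B :: "'a cblinop" and r :: real
  show "norm A = 0 \<longleftrightarrow> A = 0" "norm (A + B) \<le> norm A + norm B" "norm (r *\<^sub>R A) = \<bar>r\<bar> * norm A"
    by (transfer, simp add: norm_triangle_ineq)+
qed (rule dist_cblinop_def sgn_cblinop_def uniformity_cblinop_def open_cblinop_def)+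

end

instantiation cblinop :: (complex_normed_vector) complex_normed_vector
begin

lift_definition scaleC_cblinop :: "complex \<Rightarrow> 'a cblinop \<Rightarrow> 'a cblinop"
  is "\<lambda>c (A :: 'a \<Rightarrow>\<^sub>L 'a). Blinfun (\<lambda>x. c *\<^sub>C blinfun_apply A x)"
  by (auto simp: bounded_clinear_iff blinfun.bounded_linear_right scaleC_scaleC mult.commute
      bounded_linear_Blinfun_apply
      bounded_linear_compose[OF bounded_linear_scaleC blinfun.bounded_linear_right])

lemma blinfun_of_cblinop_scaleC:
  "blinfun_apply (blinfun_of_cblinop (c *\<^sub>C A)) x = c *\<^sub>C blinfun_apply (blinfun_of_cblinop A) x"
  by (simp add: scaleC_cblinop.rep_eq bounded_linear_Blinfun_apply
      bounded_linear_compose[OF bounded_linear_scaleC blinfun.bounded_linear_right])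

lemma cblinop_rep_eqI:
  "(\<And>x. blinfun_apply (blinfun_of_cblinop A) x = blinfun_apply (blinfun_of_cblinop B) x) \<Longrightarrow> A = B"
  by (metis blinfun_eqI blinfun_of_cblinop_inject)

instance
proof
  fix A B :: "'a cblinop" and r :: real and c d :: complex
  show "c *\<^sub>C (A + B) = c *\<^sub>C A + c *\<^sub>C B" "(c + d) *\<^sub>C A = c *\<^sub>C A + d *\<^sub>C A"
    "c *\<^sub>C d *\<^sub>C A = (c * d) *\<^sub>C A" "1 *\<^sub>C A = A" "complex_of_real r *\<^sub>C A = r *\<^sub>R A"
    by (rule cblinop_rep_eqI, simp add: plus_cblinop.rep_eq scaleR_cblinop.rep_eq
        blinfun_of_cblinop_scaleC blinfun.add_left blinfun.scaleR_left
        scaleC_add_right scaleC_add_left scaleC_scaleC scaleC_one scaleC_of_real)+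
  have le: "norm (c *\<^sub>C A) \<le> cmod c * norm A" for c and A :: "'a cblinop"
    unfolding norm_cblinop.rep_eq
    by (rule norm_blinfun_bound)
      (simp_all add: blinfun_of_cblinop_scaleC norm_scaleC mult.assoc mult_left_mono norm_blinfun)
  show "norm (c *\<^sub>C A) = cmod c * norm A"
  proof (cases "c = 0")
    case True
    then show ?thesis
      using le[of c A] by simp
  next
    case False
    have "inverse c *\<^sub>C c *\<^sub>C A = A"
      using False
      by (intro cblinop_rep_eqI) (simp add: blinfun_of_cblinop_scaleC scaleC_scaleC scaleC_one)
    then have "norm A \<le> norm (c *\<^sub>C A) / cmod c"
      using le[of "inverse c" "c *\<^sub>C A"] by (simp add: norm_inverse divide_inverse mult.commute)
    with False have "cmod c * norm A \<le> norm (c *\<^sub>C A)"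
      by (simp add: field_simps)
    with le[of c A] show ?thesis
      by simp
  qed
qed

end

instantiation cblinop :: (complex_normed_vector) complex_normed_algebra
begin

lift_definition times_cblinop :: "'a cblinop \<Rightarrow> 'a cblinop \<Rightarrow> 'a cblinop" is "(o\<^sub>L)"
  by (auto simp: bounded_clinear_iff blinfun.bounded_linear_right)

instance
proof
  fix A B C :: "'a cblinop" and r :: real and c :: complex
  show "A * B * C = A * (B * C)" "(A + B) * C = A * C + B * C" "A * (B + C) = A * B + A * C"
    "(r *\<^sub>R A) * B = r *\<^sub>R (A * B)" "A * (r *\<^sub>R B) = r *\<^sub>R (A * B)"
    by (rule cblinop_rep_eqI, simp add: times_cblinop.rep_eq plus_cblinop.rep_eq
        scaleR_cblinop.rep_eq blinfun.add_left blinfun.add_right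
        blinfun.scaleR_left blinfun.scaleR_right)+
  show "norm (A * B) \<le> norm A * norm B"
    by transfer (rule norm_blinfun_compose)
  show "(c *\<^sub>C A) * B = c *\<^sub>C (A * B)" "A * (c *\<^sub>C B) = c *\<^sub>C (A * B)"
    using blinfun_of_cblinop[of A]
    by (auto intro!: cblinop_rep_eqI
        simp: times_cblinop.rep_eq blinfun_of_cblinop_scaleC bounded_clinear_iff)
qed

end

lemma cblinop_eqI: "(\<And>x. cblinop_apply A x = cblinop_apply B x) \<Longrightarrow> A = B"
  unfolding cblinop_apply_def by (metis blinfun_eqI blinfun_of_cblinop_inject)

lemma cblinop_apply_plus [simp]: "cblinop_apply (A + B) x = cblinop_apply A x + cblinop_apply B x"
  by (simp add: cblinop_apply_def plus_cblinop.rep_eq blinfun.add_left)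

lemma cblinop_apply_times [simp]: "cblinop_apply (A * B) x = cblinop_apply A (cblinop_apply B x)"
  by (simp add: cblinop_apply_def times_cblinop.rep_eq)

lemma cblinop_apply_scaleC [simp]: "cblinop_apply (c *\<^sub>C A) x = c *\<^sub>C cblinop_apply A x"
  by (simp add: cblinop_apply_def blinfun_of_cblinop_scaleC)

lemma norm_cblinop_onorm: "norm A = onorm (cblinop_apply A)"
  by (simp add: cblinop_apply_def norm_cblinop.rep_eq norm_blinfun.rep_eq)

instance cblinop :: ("{complex_normed_vector, banach}") banach
proof
  fix X :: "nat \<Rightarrow> 'a cblinop"
  assume X: "Cauchy X"
  have "Cauchy (\<lambda>n. blinfun_of_cblinop (X n))"
    using X by (simp add: Cauchy_def dist_norm norm_cblinop.rep_eq minus_cblinop.rep_eq)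
  then obtain L where L: "(\<lambda>n. blinfun_of_cblinop (X n)) \<longlonglongrightarrow> L"
    using Cauchy_convergent_iff convergent_def by blast
  have lim: "(\<lambda>n. blinfun_apply (blinfun_of_cblinop (X n)) x) \<longlonglongrightarrow> blinfun_apply L x" for x
    using L by (rule blinfun.tendsto) simp
  have "blinfun_apply L (c *\<^sub>C x) = c *\<^sub>C blinfun_apply L x" for c x
  proof (rule LIMSEQ_unique[OF lim])
    have "blinfun_apply (blinfun_of_cblinop (X n)) (c *\<^sub>C x)
        = c *\<^sub>C blinfun_apply (blinfun_of_cblinop (X n)) x" for n
      using blinfun_of_cblinop[of "X n"] by (simp add: bounded_clinear_iff)
    then show "(\<lambda>n. blinfun_apply (blinfun_of_cblinop (X n)) (c *\<^sub>C x))
        \<longlonglongrightarrow> c *\<^sub>C blinfun_apply L x"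
      using bounded_linear.tendsto[OF bounded_linear_scaleC lim] by simp
  qed
  then have "bounded_clinear (blinfun_apply L)"
    by (simp add: bounded_clinear_iff blinfun.bounded_linear_right)
  then have "blinfun_of_cblinop (cblinop_of_blinfun L) = L"
    by (simp add: cblinop_of_blinfun_inverse)
  with L have "X \<longlonglongrightarrow> cblinop_of_blinfun L"
    by (simp add: LIMSEQ_def dist_norm norm_cblinop.rep_eq minus_cblinop.rep_eq)
  then show "convergent X"
    by (rule convergentI)
qed


section \<open>Continuous functions vanishing at infinity\<close>

definition vanishes_at_infinity :: "('x::topological_space \<Rightarrow> 'v::real_normed_vector) \<Rightarrow> bool" where
  "vanishes_at_infinity f \<longleftrightarrow> (\<forall>e>0. \<exists>K. compact K \<and> (\<forall>x. x \<notin> K \<longrightarrow> norm (f x) < e))"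

typedef (overloaded) ('x::topological_space, 'v::real_normed_vector) c0 =
  "{f :: 'x \<Rightarrow> 'v. continuous_on UNIV f \<and> vanishes_at_infinity f}"
  morphisms c0_apply c0_of_fun
  by (rule exI[of _ "\<lambda>_. 0"]) (auto simp: vanishes_at_infinity_def)

setup_lifting type_definition_c0

lemma continuous_on_c0_apply: "continuous_on UNIV (c0_apply f)"
  and vanishes_c0_apply: "vanishes_at_infinity (c0_apply f)"
  using c0_apply[of f] by auto

lemma c0_eqI: "(\<And>x. c0_apply f x = c0_apply g x) \<Longrightarrow> f = g"
  by (metis c0_apply_inject ext)

lemma c0_bounded:
  fixes f :: "('x::topological_space, 'v::real_normed_vector) c0"
  shows "bounded (range (c0_apply f))"
proof -
  obtain K where K: "compact K" "\<And>x. x \<notin> K \<Longrightarrow> norm (c0_apply f x) < 1"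
    using vanishes_c0_apply[of f] unfolding vanishes_at_infinity_def by (metis zero_less_one)
  have "bounded (c0_apply f ` K)"
    using K(1) continuous_on_c0_apply by (metis compact_continuous_image compact_imp_bounded
        continuous_on_subset subset_UNIV)
  moreover have "bounded (ball (0::'v) 1)"
    by simp
  ultimately have "bounded (c0_apply f ` K \<union> ball 0 1)"
    by simp
  then show ?thesis
    by (rule bounded_subset) (use K(2) in force)
qed

lemma vanishes_at_infinity_dominated:
  assumes "vanishes_at_infinity f" and "\<And>x. norm (g x) \<le> M * norm (f x)"
  shows "vanishes_at_infinity g"
  unfolding vanishes_at_infinity_def
proof (intro allI impI)
  fix e :: real
  assume e: "e > 0"
  let ?M = "\<bar>M\<bar> + 1"
  obtain K where K: "compact K" "\<And>x. x \<notin> K \<Longrightarrow> norm (f x) < e / ?M"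
    using assms(1) e unfolding vanishes_at_infinity_def
    by (meson add_nonneg_pos abs_ge_zero divide_pos_pos zero_less_one)
  have "norm (g x) < e" if "x \<notin> K" for x
  proof -
    have "norm (g x) \<le> ?M * norm (f x)"
      using assms(2)[of x] by (rule order_trans) (auto intro!: mult_right_mono)
    also have "\<dots> < e"
      using K(2)[OF that] by (simp add: field_simps)
    finally show ?thesis .
  qed
  with K(1) show "\<exists>K. compact K \<and> (\<forall>x. x \<notin> K \<longrightarrow> norm (g x) < e)"
    by blast
qed

lemma vanishes_at_infinity_add:
  assumes "vanishes_at_infinity f" "vanishes_at_infinity g"
  shows "vanishes_at_infinity (\<lambda>x. f x + g x)"
  unfolding vanishes_at_infinity_def
proof (intro allI impI)
  fix e :: real
  assume "e > 0"
  then have e: "e / 2 > 0" by simp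
  obtain K L where "compact K" "\<And>x. x \<notin> K \<Longrightarrow> norm (f x) < e / 2"
    "compact L" "\<And>x. x \<notin> L \<Longrightarrow> norm (g x) < e / 2"
    using assms e unfolding vanishes_at_infinity_def by metis
  then have "compact (K \<union> L) \<and> (\<forall>x. x \<notin> K \<union> L \<longrightarrow> norm (f x + g x) < e)"
    by (auto intro: norm_add_less[of _ "e / 2" _ "e / 2", simplified])
  then show "\<exists>K. compact K \<and> (\<forall>x. x \<notin> K \<longrightarrow> norm (f x + g x) < e)"
    by blast
qed

instantiation c0 :: (topological_space, real_normed_vector) real_vector
begin

lift_definition zero_c0 :: "('a, 'b) c0" is "\<lambda>_. 0"
  by (auto simp: vanishes_at_infinity_def)

lift_definition plus_c0 :: "('a, 'b) c0 \<Rightarrow> ('a, 'b) c0 \<Rightarrow> ('a, 'b) c0" is "\<lambda>f g x. f x + g x"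
  by (auto intro: continuous_intros vanishes_at_infinity_add)

lift_definition uminus_c0 :: "('a, 'b) c0 \<Rightarrow> ('a, 'b) c0" is "\<lambda>f x. - f x"
  by (auto intro: continuous_intros vanishes_at_infinity_dominated[where M = 1])

lift_definition minus_c0 :: "('a, 'b) c0 \<Rightarrow> ('a, 'b) c0 \<Rightarrow> ('a, 'b) c0" is "\<lambda>f g x. f x - g x"
proof -
  fix f g :: "'a \<Rightarrow> 'b"
  assume fg: "continuous_on UNIV f \<and> vanishes_at_infinity f"
    "continuous_on UNIV g \<and> vanishes_at_infinity g"
  then have "vanishes_at_infinity (\<lambda>x. - g x)"
    by (auto intro: vanishes_at_infinity_dominated[where M = 1])
  with fg have "vanishes_at_infinity (\<lambda>x. f x - g x)"
    using vanishes_at_infinity_add[of f "\<lambda>x. - g x"] by simp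
  with fg show "continuous_on UNIV (\<lambda>x. f x - g x) \<and> vanishes_at_infinity (\<lambda>x. f x - g x)"
    by (auto intro: continuous_intros)
qed

lift_definition scaleR_c0 :: "real \<Rightarrow> ('a, 'b) c0 \<Rightarrow> ('a, 'b) c0" is "\<lambda>r f x. r *\<^sub>R f x"
  by (auto intro!: continuous_intros intro: vanishes_at_infinity_dominated)

instance
  by standard (transfer, simp add: fun_eq_iff algebra_simps)+

end

instantiation c0 :: (topological_space, real_normed_vector) real_normed_vector
begin

definition norm_c0 :: "('a, 'b) c0 \<Rightarrow> real" where
  "norm_c0 f = (SUP x. norm (c0_apply f x))"

definition dist_c0 :: "('a, 'b) c0 \<Rightarrow> ('a, 'b) c0 \<Rightarrow> real" where
  "dist_c0 f g = norm (f - g)"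

definition sgn_c0 :: "('a, 'b) c0 \<Rightarrow> ('a, 'b) c0" where
  "sgn_c0 f = f /\<^sub>R norm f"

definition uniformity_c0 :: "(('a, 'b) c0 \<times> ('a, 'b) c0) filter" where
  "uniformity_c0 = (INF e\<in>{0 <..}. principal {(f, g). dist f g < e})"

definition open_c0 :: "('a, 'b) c0 set \<Rightarrow> bool" where
  "open_c0 S = (\<forall>f\<in>S. \<forall>\<^sub>F (f', g) in uniformity. f' = f \<longrightarrow> g \<in> S)"

lemma norm_c0_apply_le: "norm (c0_apply f x) \<le> norm f"
  unfolding norm_c0_def
  by (rule cSUP_upper) (auto simp: bounded_norm_comp c0_bounded intro: bounded_imp_bdd_above)

lemma norm_c0_le: "(\<And>x. norm (c0_apply f x) \<le> b) \<Longrightarrow> norm f \<le> b"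
  unfolding norm_c0_def by (rule cSUP_least) auto

instance
proof
  fix f g :: "('a, 'b) c0" and r :: real
  show "norm f = 0 \<longleftrightarrow> f = 0"
  proof
    assume "norm f = 0"
    then have "norm (c0_apply f x) \<le> 0" for x
      using norm_c0_apply_le[of f x] by simp
    then show "f = 0"
      by (intro c0_eqI) (simp add: zero_c0.rep_eq)
  qed (simp add: norm_c0_def zero_c0.rep_eq)
  show "norm (f + g) \<le> norm f + norm g"
    by (rule norm_c0_le) (simp add: plus_c0.rep_eq norm_triangle_le add_mono norm_c0_apply_le)
  have le: "norm (r *\<^sub>R f) \<le> \<bar>r\<bar> * norm f" for r and f :: "('a, 'b) c0"
    by (rule norm_c0_le) (simp add: scaleR_c0.rep_eq mult_left_mono norm_c0_apply_le)
  show "norm (r *\<^sub>R f) = \<bar>r\<bar> * norm f"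
  proof (cases "r = 0")
    case True
    then show ?thesis
      by (simp add: norm_c0_def zero_c0.rep_eq)
  next
    case False
    have "inverse r *\<^sub>R r *\<^sub>R f = f"
      using False by (intro c0_eqI) (simp add: scaleR_c0.rep_eq)
    then have "\<bar>r\<bar> * norm f \<le> norm (r *\<^sub>R f)"
      using le[of "inverse r" "r *\<^sub>R f"] False by (simp add: field_simps)
    with le[of r f] show ?thesis
      by simp
  qed
qed (rule dist_c0_def sgn_c0_def uniformity_c0_def open_c0_def)+

end

instance c0 :: (topological_space, banach) banach
proof
  fix X :: "nat \<Rightarrow> ('a, 'b) c0"
  assume X: "Cauchy X"
  have "\<forall>e>0. \<exists>N. \<forall>m n x. N \<le> m \<and> N \<le> n \<and> True \<longrightarrow> dist (c0_apply (X m) x) (c0_apply (X n) x) < e"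
  proof (intro allI impI)
    fix e :: real
    assume "e > 0"
    then obtain N where N: "\<And>m n. N \<le> m \<Longrightarrow> N \<le> n \<Longrightarrow> dist (X m) (X n) < e"
      using X unfolding Cauchy_def by metis
    show "\<exists>N. \<forall>m n x. N \<le> m \<and> N \<le> n \<and> True \<longrightarrow> dist (c0_apply (X m) x) (c0_apply (X n) x) < e"
    proof (intro exI[of _ N] allI impI)
      fix m n x
      assume "N \<le> m \<and> N \<le> n \<and> True"
      with N have "norm (X m - X n) < e"
        by (simp add: dist_norm)
      with norm_c0_apply_le[of "X m - X n" x]
      show "dist (c0_apply (X m) x) (c0_apply (X n) x) < e"
        by (simp add: dist_norm minus_c0.rep_eq)
    qed
  qed
  then obtain l where l: "\<And>e. e > 0 \<Longrightarrow> \<exists>N. \<forall>n x. N \<le> n \<longrightarrow> dist (c0_apply (X n) x) (l x) < e"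
    using uniformly_convergent_eq_cauchy[of "\<lambda>_. True" "\<lambda>n. c0_apply (X n)"] by auto
  have "uniform_limit UNIV (\<lambda>n. c0_apply (X n)) l sequentially"
    unfolding uniform_limit_sequentially_iff using l by auto
  then have cont: "continuous_on UNIV l"
    by (rule uniform_limit_theorem[rotated]) (auto simp: continuous_on_c0_apply)
  have "vanishes_at_infinity l"
    unfolding vanishes_at_infinity_def
  proof (intro allI impI)
    fix e :: real
    assume "e > 0"
    then have e: "e / 2 > 0" by simp
    obtain N where N: "\<And>x. dist (c0_apply (X N) x) (l x) < e / 2"
      using l[OF e] by blast
    obtain K where K: "compact K" "\<And>x. x \<notin> K \<Longrightarrow> norm (c0_apply (X N) x) < e / 2"
      using vanishes_c0_apply[of "X N"] e unfolding vanishes_at_infinity_def by metis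
    have "norm (l x) < e" if "x \<notin> K" for x
      using N[of x] K(2)[OF that] norm_triangle_ineq2[of "l x" "c0_apply (X N) x"]
      by (simp add: dist_norm norm_minus_commute)
    with K(1) show "\<exists>K. compact K \<and> (\<forall>x. x \<notin> K \<longrightarrow> norm (l x) < e)"
      by blast
  qed
  with cont have L: "c0_apply (c0_of_fun l) = l"
    by (simp add: c0_of_fun_inverse)
  have "X \<longlonglongrightarrow> c0_of_fun l"
  proof (rule LIMSEQ_I)
    fix e :: real
    assume "e > 0"
    then have e: "e / 2 > 0" by simp
    obtain N where N: "\<And>n x. N \<le> n \<Longrightarrow> dist (c0_apply (X n) x) (l x) < e / 2"
      using l[OF e] by blast
    have "norm (X n - c0_of_fun l) < e" if "N \<le> n" for n
    proof -
      have "norm (X n - c0_of_fun l) \<le> e / 2"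
        by (rule norm_c0_le) (use N[OF that] in \<open>simp add: minus_c0.rep_eq L dist_norm less_imp_le\<close>)
      with e show ?thesis by simp
    qed
    then show "\<exists>N. \<forall>n\<ge>N. norm (X n - c0_of_fun l) < e"
      by blast
  qed
  then show "convergent X"
    by (rule convergentI)
qed

instantiation c0 :: (topological_space, complex_normed_vector) complex_normed_vector
begin

lift_definition scaleC_c0 :: "complex \<Rightarrow> ('a, 'b) c0 \<Rightarrow> ('a, 'b) c0" is "\<lambda>c f x. c *\<^sub>C f x"
  by (auto intro!: bounded_linear.continuous_on[OF bounded_linear_scaleC]
      intro: vanishes_at_infinity_dominated simp: norm_scaleC)

instance
proof
  fix f g :: "('a, 'b) c0" and c d :: complex and r :: real
  show "c *\<^sub>C (f + g) = c *\<^sub>C f + c *\<^sub>C g" "(c + d) *\<^sub>C f = c *\<^sub>C f + d *\<^sub>C f"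
    "c *\<^sub>C d *\<^sub>C f = (c * d) *\<^sub>C f" "1 *\<^sub>C f = f" "complex_of_real r *\<^sub>C f = r *\<^sub>R f"
    by (transfer, simp add: scaleC_add_right scaleC_add_left scaleC_scaleC scaleC_one
        scaleC_of_real)+
  have le: "norm (c *\<^sub>C f) \<le> cmod c * norm f" for c and f :: "('a, 'b) c0"
    by (rule norm_c0_le) (simp add: scaleC_c0.rep_eq norm_scaleC mult_left_mono norm_c0_apply_le)
  show "norm (c *\<^sub>C f) = cmod c * norm f"
  proof (cases "c = 0")
    case True
    then show ?thesis
      using le[of c f] by simp
  next
    case False
    have "inverse c *\<^sub>C c *\<^sub>C f = f"
      using False by (intro c0_eqI) (simp add: scaleC_c0.rep_eq scaleC_scaleC scaleC_one)
    then have "norm f \<le> norm (c *\<^sub>C f) / cmod c"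
      using le[of "inverse c" "c *\<^sub>C f"] by (simp add: norm_inverse divide_inverse mult.commute)
    with False have "cmod c * norm f \<le> norm (c *\<^sub>C f)"
      by (simp add: field_simps)
    with le[of c f] show ?thesis
      by simp
  qed
qed

end

instantiation c0 :: (topological_space, real_normed_algebra) real_normed_algebra
begin

lift_definition times_c0 :: "('a, 'b) c0 \<Rightarrow> ('a, 'b) c0 \<Rightarrow> ('a, 'b) c0" is "\<lambda>f g x. f x * g x"
proof -
  fix f g :: "'a \<Rightarrow> 'b"
  assume fg: "continuous_on UNIV f \<and> vanishes_at_infinity f"
    "continuous_on UNIV g \<and> vanishes_at_infinity g"
  then have "c0_apply (c0_of_fun f) = f"
    by (simp add: c0_of_fun_inverse)
  with norm_c0_apply_le[of "c0_of_fun f"] have "norm (f x) \<le> norm (c0_of_fun f)" for x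
    by simp
  then have "norm (f x * g x) \<le> norm (c0_of_fun f) * norm (g x)" for x
    by (meson mult_right_mono norm_ge_zero norm_mult_ineq order_trans)
  with fg show "continuous_on UNIV (\<lambda>x. f x * g x) \<and> vanishes_at_infinity (\<lambda>x. f x * g x)"
    by (auto intro: continuous_intros vanishes_at_infinity_dominated)
qed

instance
proof
  fix f g h :: "('a, 'b) c0" and r :: real
  show "f * g * h = f * (g * h)" "(f + g) * h = f * h + g * h" "f * (g + h) = f * g + f * h"
    "(r *\<^sub>R f) * g = r *\<^sub>R (f * g)" "f * (r *\<^sub>R g) = r *\<^sub>R (f * g)"
    by (transfer, simp add: algebra_simps)+
  show "norm (f * g) \<le> norm f * norm g"
  proof (rule norm_c0_le)
    fix x
    have "norm (c0_apply f x * c0_apply g x) \<le> norm (c0_apply f x) * norm (c0_apply g x)"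
      by (rule norm_mult_ineq)
    also have "\<dots> \<le> norm f * norm g"
      by (intro mult_mono norm_c0_apply_le) auto
    finally show "norm (c0_apply (f * g) x) \<le> norm f * norm g"
      by (simp add: times_c0.rep_eq)
  qed
qed

end

instance c0 :: (topological_space, complex_normed_algebra) complex_normed_algebra
  by standard (transfer, simp add: mult_scaleC_left mult_scaleC_right)+


section \<open>Automorphism groups and algebraic reflexivity\<close>

text \<open>Continuity is not part of the definition of an automorphism.\<close>

definition Aut :: "('a::{complex_normed_algebra, banach} \<Rightarrow> 'a) set" where
  "Aut = {\<phi>. clinear \<phi> \<and> (\<forall>a b. \<phi> (a * b) = \<phi> a * \<phi> b) \<and> bij \<phi>}"

definition ref_al :: "('v::{complex_normed_vector, banach} \<Rightarrow> 'v) set \<Rightarrow> ('v \<Rightarrow> 'v) set" where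
  "ref_al \<E> = {T. bounded_clinear T \<and> (\<forall>x. \<exists>E\<in>\<E>. T x = E x)}"

definition algebraically_reflexive :: "('v::{complex_normed_vector, banach} \<Rightarrow> 'v) set \<Rightarrow> bool" where
  "algebraically_reflexive \<E> \<longleftrightarrow> ref_al \<E> = \<E>"

end

(* An automorphism Theta of C0(X, B(H)) acts on the centre C0(X) as composition with a map phi of X,
   and Theta F x = tau (F (phi x)) for an automorphism tau of B(H) depending on x; it is bounded by
   the closed graph theorem, since R F R' is a scalar function times a fixed element for R, R' of
   rank one.
   A map Phi in the reflexive closure acts on C0(X) as an element of the reflexive closure of
   Aut(C0(X)), hence as an automorphism. Adding large scalar functions shows that Phi F x depends on
   F (phi x) only, so Phi F x = Psi (F (phi x)), where the bounded unital map Psi on B(H) agrees at each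
   operator with a multiple of an automorphism. Such a Psi preserves idempotents, hence is
   multiplicative or antimultiplicative on operators of rank one. The second case is excluded by an
   injective operator of the form P A with P a projection onto the complement of a vector g outside the
   range of A. In the first case the images of the rank one operators define an invertible T, and
   Psi B = T B T' with T' inverse to T; the norms of T and T' are bounded by that of Phi, which makes
   Phi surjective. *)

theory Submission
  imports Defs
begin

text \<open>Every complex matrix is similar to its transpose, so in finite dimension transposition
  agrees at each operator with an automorphism. Antimultiplicative maps can thus be excluded only by
  an argument proper to infinite dimension: an injective operator whose transpose, so to speak, is
  not injective. Injectivity is the main invariant, since failing it means being a left zero
  divisor, which automorphisms preserve in both directions. A map in the reflexive closure supplies,
  for one function \<open>F\<close>, an automorphism depending on \<open>F\<close>, and the point at
  which that automorphism reads \<open>F\<close> depends on \<open>F\<close> too. Testing on a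
  cut-off times an operator identifies the value only up to an unknown, possibly zero, scalar: hence
  multiples of automorphisms. Reflexivity of the scalar automorphism group fixes the point, but only
  for scalar functions. The conjugating operator at a point is determined only up to a scalar, and
  nothing makes its choice continuous in the point. Surjectivity therefore rests on bounds uniform
  in the point, which is why both norms are tracked.\<close>

section \<open>Functional analysis\<close>

text \<open>Baire category on the closures of the sets where \<open>f\<close> is bounded by
  \<open>n\<close>: one of them contains a ball, and differences of points of that set approximate
  all small vectors.\<close>

lemma scaled_approximation:
  fixes f :: "'a::banach \<Rightarrow> 'b::real_normed_vector"
  assumes f: "linear f"
  obtains C where "C > 0" "\<And>x e. e > 0 \<Longrightarrow> \<exists>s. norm (x - s) \<le> e \<and> norm (f s) \<le> C * norm x"
proof -
  define S where "S n = {x. norm (f x) \<le> real n}" for n :: nat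
  have cover: "(\<Union>n. closure (S n)) = UNIV"
  proof -
    have "x \<in> closure (S (nat \<lceil>norm (f x)\<rceil>))" for x
      by (rule closure_subset[THEN subsetD]) (simp add: S_def of_nat_ceiling)
    then show ?thesis by blast
  qed
  obtain n where "interior (closure (S n)) \<noteq> {}"
  proof (rule ccontr)
    assume "\<not> thesis"
    then have "interior (closure (S n)) = {}" for n
      using that by blast
    then have "euclidean interior_of \<Union> (range (\<lambda>n. closure (S n))) = {}"
      using Met_TC.metric_Baire_category_alt[where ?'a = 'a, of "range (\<lambda>n. closure (S n))"]
      by (auto simp: complete_UNIV)
    with cover show False by simp
  qed
  then obtain a r where r: "r > 0" "ball a r \<subseteq> closure (S n)"
    by (metis all_not_in_conv mem_interior)
  have scale: "\<exists>s. norm (x - s) \<le> e \<and> norm (f s) \<le> 2 * real n" if x: "norm x < r" and e: "e > 0" for x e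
  proof -
    have "a + x \<in> closure (S n)" "a \<in> closure (S n)"
      using r x by (auto simp: subset_iff dist_norm)
    then obtain u v where "u \<in> S n" "dist u (a + x) < e / 2" "v \<in> S n" "dist v a < e / 2"
      using e by (meson closure_approachable half_gt_zero)
    moreover have "f (u - v) = f u - f v"
      using f by (simp add: linear_diff)
    moreover have "norm (x - (u - v)) \<le> dist u (a + x) + dist v a"
      using norm_triangle_ineq4[of "u - (a + x)" "v - a"]
      by (simp add: dist_norm norm_minus_commute algebra_simps)
    moreover have "norm (f u - f v) \<le> norm (f u) + norm (f v)"
      by (rule norm_triangle_ineq4)
    ultimately show ?thesis
      by (intro exI[of _ "u - v"]) (auto simp: S_def)
  qed
  \<comment> \<open>One factor 2 comes from taking a difference of two points of \<open>S n\<close>,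
    the other from scaling \<open>x\<close> to norm \<open>r / 2\<close>; \<open>Suc n\<close> keeps
    \<open>C\<close> positive when \<open>n = 0\<close>.\<close>
  define C where "C = 4 * real (Suc n) / r"
  show ?thesis
  proof (rule that)
    show "C > 0"
      using r by (simp add: C_def)
    fix x :: 'a and e :: real
    assume e: "e > 0"
    show "\<exists>s. norm (x - s) \<le> e \<and> norm (f s) \<le> C * norm x"
    proof (cases "x = 0")
      case True
      then show ?thesis
        using e f by (intro exI[of _ 0]) (simp add: linear_0)
    next
      case False
      define t where "t = r / (2 * norm x)"
      have t: "t > 0"
        using r False by (simp add: t_def)
      have "norm (t *\<^sub>R x) < r"
        using r False by (simp add: t_def)
      then obtain s where s: "norm (t *\<^sub>R x - s) \<le> t * e" "norm (f s) \<le> 2 * real n"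
        using scale[of "t *\<^sub>R x" "t * e"] e t by auto
      have "x - s /\<^sub>R t = (t *\<^sub>R x - s) /\<^sub>R t"
        using t by (simp add: algebra_simps)
      then have "norm (x - s /\<^sub>R t) = norm (t *\<^sub>R x - s) / t"
        using t by (simp add: divide_inverse_commute)
      also have "\<dots> \<le> e"
        using s(1) t by (simp add: field_simps)
      finally have "norm (x - s /\<^sub>R t) \<le> e" .
      moreover have "norm (f (s /\<^sub>R t)) = norm (f s) / t"
        using f t by (simp add: linear_scale divide_inverse_commute)
      moreover have "norm (f s) / t \<le> 2 * real (Suc n) / t"
        using s(2) t by (intro divide_right_mono) auto
      moreover have "2 * real (Suc n) / t = C * norm x"
        using False r by (simp add: C_def t_def field_simps)
      ultimately show ?thesis
        by (intro exI[of _ "s /\<^sub>R t"]) auto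
    qed
  qed
qed

text \<open>Iterating the approximation on the remainders writes \<open>x\<close> as a series whose
  images converge absolutely; closedness, which by linearity can be stated at 0, identifies their
  sum with \<open>f x\<close>.\<close>

theorem closed_graph:
  fixes f :: "'a::banach \<Rightarrow> 'b::banach"
  assumes f: "linear f"
    and closed: "\<And>X m. X \<longlonglongrightarrow> 0 \<Longrightarrow> (\<lambda>n. f (X n)) \<longlonglongrightarrow> m \<Longrightarrow> m = 0"
  shows "bounded_linear f"
proof -
  obtain C where C: "C > 0" "\<And>x e. e > 0 \<Longrightarrow> \<exists>s. norm (x - s) \<le> e \<and> norm (f s) \<le> C * norm x"
    using scaled_approximation[OF f] by blast
  have "norm (f x) \<le> norm x * (2 * C)" for x
  proof (cases "x = 0")
    case True
    then show ?thesis using f by (simp add: linear_0)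
  next
    case False
    have "\<exists>s. norm (y - s) \<le> norm x * (1/2) ^ Suc n \<and> norm (f s) \<le> C * norm y" for n :: nat and y
      by (rule C(2)) (use False in simp)
    then have "\<forall>n y. \<exists>s. norm (y - s) \<le> norm x * (1/2) ^ Suc n \<and> norm (f s) \<le> C * norm y"
      by blast
    then obtain s where "\<forall>n y. norm (y - s n y) \<le> norm x * (1/2) ^ Suc n \<and> norm (f (s n y)) \<le> C * norm y"
      unfolding choice_iff by blast
    then have s: "norm (y - s n y) \<le> norm x * (1/2) ^ Suc n" "norm (f (s n y)) \<le> C * norm y" for n y
      by blast+
    \<comment> \<open>The remainder after \<open>n\<close> approximations. Halving the permitted
      error at each stage bounds the sum of the images by \<open>C * norm x * 2\<close>.\<close>
    define R where "R = rec_nat x (\<lambda>n y. y - s n y)"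
    have R0: "R 0 = x" and RS: "R (Suc n) = R n - s n (R n)" for n
      by (simp_all add: R_def)
    have R: "norm (R n) \<le> norm x * (1/2) ^ n" for n
      by (cases n) (use s(1) in \<open>auto simp: R0 RS\<close>)
    have Rlim: "R \<longlonglongrightarrow> 0"
    proof (rule tendsto_norm_zero_cancel, rule tendsto_sandwich[where f = "\<lambda>_. 0"])
      show "(\<lambda>n. norm x * (1/2) ^ n) \<longlonglongrightarrow> 0"
        by (rule tendsto_mult_right_zero) (simp add: LIMSEQ_power_zero)
    qed (use R in auto)
    have part: "(\<Sum>i<n. f (s i (R i))) = f x - f (R n)" for n
      by (induction n) (simp_all add: R0 RS linear_diff[OF f])
    have bound: "norm (f (s n (R n))) \<le> (C * norm x) * (1/2) ^ n" for n
      using order_trans[OF s(2) mult_left_mono[OF R]] C(1) by (simp add: mult.assoc)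
    have geo: "(\<lambda>n. (C * norm x) * (1/2) ^ n) sums ((C * norm x) * 2)"
      using geometric_sums[of "1/2 :: real"] by (intro sums_mult) simp
    have sn: "summable (\<lambda>n. norm (f (s n (R n))))"
      by (rule summable_comparison_test'[OF sums_summable[OF geo], of 0]) (use bound in auto)
    define y where "y = (\<Sum>n. f (s n (R n)))"
    have "(\<lambda>n. f x - f (R n)) \<longlonglongrightarrow> y"
      using summable_LIMSEQ[OF summable_norm_cancel[OF sn]] by (simp add: part y_def)
    then have "(\<lambda>n. f x - (f x - f (R n))) \<longlonglongrightarrow> f x - y"
      by (intro tendsto_intros)
    then have "(\<lambda>n. f (R n)) \<longlonglongrightarrow> f x - y"
      by simp
    then have "f x - y = 0"
      by (rule closed[OF Rlim])
    moreover have "norm y \<le> C * norm x * 2"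
      unfolding y_def
      by (rule order_trans[OF summable_norm[OF sn]])
        (use suminf_le[OF bound sn sums_summable[OF geo]] sums_unique[OF geo] in simp)
    ultimately show ?thesis
      by (simp add: mult_ac)
  qed
  then show ?thesis
    using f by (intro bounded_linear_intro[of f "2 * C"]) (auto simp: linear_add linear_scale)
qed

lemma clinear_diff: "clinear f \<Longrightarrow> f (x - y) = f x - f y"
  unfolding clinear_def by (metis add_diff_cancel diff_add_cancel)

lemma clinear_zero: "clinear f \<Longrightarrow> f 0 = 0"
  using clinear_diff[of f 0 0] by simp

lemma clinear_add: "clinear f \<Longrightarrow> f (x + y) = f x + f y"
  and clinear_scaleC: "clinear f \<Longrightarrow> f (c *\<^sub>C x) = c *\<^sub>C f x"
  by (auto simp: clinear_def)

lemma clinear_linear: "clinear f \<Longrightarrow> linear f"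
  by (rule linearI) (auto simp: clinear_def simp flip: scaleC_of_real)

lemma scaleC_complex [simp]: "c *\<^sub>C (x :: complex) = c * x"
  by (simp add: scaleC_complex_def)

lemma bounded_clinear_clinear: "bounded_clinear f \<Longrightarrow> clinear f"
  by (simp add: bounded_clinear_def)

lemma bounded_clinear_bounded_linear: "bounded_clinear f \<Longrightarrow> bounded_linear f"
  by (simp add: bounded_clinear_iff)

lemma bounded_clinearI:
  "clinear f \<Longrightarrow> (\<And>x. norm (f x) \<le> norm x * K) \<Longrightarrow> bounded_clinear f"
  by (auto simp: bounded_clinear_def)

section \<open>Hilbert spaces\<close>

lemma cinner_add_right: "cinner x (y + z) = cinner x y + cinner x (z :: 'h::chilbert_space)"
  by (metis cinner_commute cinner_add_left complex_cnj_add)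

lemma cinner_scaleC_right: "cinner x (c *\<^sub>C y) = cnj c * cinner x (y :: 'h::chilbert_space)"
  by (metis cinner_commute cinner_scaleC_left complex_cnj_mult)

lemma clinear_cinner: "clinear (\<lambda>x. cinner x (y :: 'h::chilbert_space))"
  by (simp add: clinear_def cinner_add_left cinner_scaleC_left)

lemma cinner_zero_left [simp]: "cinner 0 (y :: 'h::chilbert_space) = 0"
  using clinear_zero[OF clinear_cinner] .

lemma cinner_zero_right [simp]: "cinner (y :: 'h::chilbert_space) 0 = 0"
  by (metis cinner_commute cinner_zero_left complex_cnj_zero)

lemma cinner_diff_left: "cinner (x - y) (z :: 'h::chilbert_space) = cinner x z - cinner y z"
  using clinear_diff[OF clinear_cinner] .

lemma cinner_diff_right: "cinner z (x - y :: 'h::chilbert_space) = cinner z x - cinner z y"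
  by (metis cinner_add_right add_diff_cancel diff_add_cancel)

lemmas cinner_algebra = cinner_add_left cinner_add_right cinner_diff_left cinner_diff_right
  cinner_scaleC_left cinner_scaleC_right

lemma cinner_self_eq_0 [simp]: "cinner x x = 0 \<longleftrightarrow> x = (0 :: 'h::chilbert_space)"
  by (simp add: cinner_self)

lemma cinner_eq_0_commute: "cinner x y = 0 \<longleftrightarrow> cinner y (x :: 'h::chilbert_space) = 0"
  by (metis cinner_commute complex_cnj_zero)

lemma cinner_mult_commute: "cinner x y * cinner y x = complex_of_real ((cmod (cinner x (y :: 'h::chilbert_space)))\<^sup>2)"
  by (metis cinner_commute complex_norm_square)

text \<open>Pythagoras for the part of \<open>x\<close> orthogonal to \<open>y\<close>; it yields
  both the Cauchy-Schwarz inequality and the orthogonality of nearest points.\<close>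

lemma norm_diff_projection:
  fixes x y :: "'h::chilbert_space"
  assumes "y \<noteq> 0"
  shows "(norm (x - (cinner x y / cinner y y) *\<^sub>C y))\<^sup>2 = (norm x)\<^sup>2 - (cmod (cinner x y))\<^sup>2 / (norm y)\<^sup>2"
proof -
  have yy: "cinner y y \<noteq> 0"
    using assms by simp
  have "cnj (cinner y y) = cinner y y"
    by (metis cinner_commute)
  then have "complex_of_real ((norm (x - (cinner x y / cinner y y) *\<^sub>C y))\<^sup>2)
    = cinner x x - cinner x y * cinner y x / cinner y y"
    unfolding cinner_self[symmetric]
    using yy by (simp add: cinner_algebra cinner_commute[of y x, symmetric] field_simps)
  also have "\<dots> = complex_of_real ((norm x)\<^sup>2 - (cmod (cinner x y))\<^sup>2 / (norm y)\<^sup>2)"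
    by (simp add: cinner_mult_commute cinner_self)
  finally show ?thesis
    using of_real_eq_iff by blast
qed

lemma cinner_Cauchy_Schwarz: "cmod (cinner x y) \<le> norm x * norm (y :: 'h::chilbert_space)"
proof (cases "y = 0")
  case False
  have "0 \<le> (norm x)\<^sup>2 - (cmod (cinner x y))\<^sup>2 / (norm y)\<^sup>2"
    using norm_diff_projection[OF False, of x] by (metis zero_le_power2)
  then have "(cmod (cinner x y))\<^sup>2 \<le> (norm x * norm y)\<^sup>2"
    using False by (simp add: field_simps power_mult_distrib)
  then show ?thesis
    by (rule power2_le_imp_le) simp
qed simp

lemma bounded_clinear_cinner: "bounded_clinear (\<lambda>x. cinner x (y :: 'h::chilbert_space))"
  by (rule bounded_clinearI[OF clinear_cinner]) (rule cinner_Cauchy_Schwarz)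

lemma bounded_linear_cinner_left: "bounded_linear (\<lambda>x. cinner x (y :: 'h::chilbert_space))"
  by (rule bounded_clinear_bounded_linear[OF bounded_clinear_cinner])

lemma bounded_linear_cinner_right: "bounded_linear (\<lambda>y. cinner (x :: 'h::chilbert_space) y)"
proof (rule bounded_linear_intro)
  show "norm (cinner x y) \<le> norm y * norm x" for y
    using cinner_Cauchy_Schwarz[of x y] by (simp add: mult.commute)
qed (simp_all add: cinner_add_right cinner_scaleC_right scaleR_conv_of_real flip: scaleC_of_real)

lemma parallelogram:
  "(norm (x - y))\<^sup>2 + (norm (x + y))\<^sup>2 = 2 * (norm x)\<^sup>2 + 2 * (norm (y :: 'h::chilbert_space))\<^sup>2"
proof -
  have "complex_of_real ((norm (x - y))\<^sup>2 + (norm (x + y))\<^sup>2)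
    = complex_of_real (2 * (norm x)\<^sup>2 + 2 * (norm y)\<^sup>2)"
    by (simp add: of_real_add of_real_mult cinner_algebra flip: cinner_self of_real_power)
  then show ?thesis
    using of_real_eq_iff by blast
qed

text \<open>A minimizing sequence is Cauchy by the parallelogram law, because midpoints of its
  members stay in \<open>M\<close> and so have distance at least \<open>d\<close> from
  \<open>z\<close>.\<close>

lemma nearest_point_exists:
  fixes M :: "'h::chilbert_space set"
  assumes closed: "closed M" and M: "0 \<in> M" "\<And>x y. x \<in> M \<Longrightarrow> y \<in> M \<Longrightarrow> x + y \<in> M"
    "\<And>c x. x \<in> M \<Longrightarrow> c *\<^sub>C x \<in> M"
  obtains m where "m \<in> M" "\<And>x. x \<in> M \<Longrightarrow> norm (z - m) \<le> norm (z - x)"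
proof -
  define d where "d = infdist z M"
  have ne: "M \<noteq> {}" using M(1) by blast
  have d: "d \<le> norm (z - x)" if "x \<in> M" for x
    using infdist_le[OF that, of z] by (simp add: d_def dist_norm)
  have d0: "d \<ge> 0"
    by (simp add: d_def infdist_nonneg)
  have "\<exists>m\<in>M. (norm (z - m))\<^sup>2 < d\<^sup>2 + inverse (real (Suc n))" for n
  proof (rule ccontr)
    assume "\<not> ?thesis"
    then have "sqrt (d\<^sup>2 + inverse (real (Suc n))) \<le> norm (z - m)" if "m \<in> M" for m
      using that by (auto intro!: real_le_lsqrt simp: not_less)
    then have "sqrt (d\<^sup>2 + inverse (real (Suc n))) \<le> d"
      unfolding d_def infdist_notempty[OF ne] using ne
      by (intro cINF_greatest) (auto simp: dist_norm d_def infdist_notempty[OF ne])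
    moreover have "sqrt (d\<^sup>2) < sqrt (d\<^sup>2 + inverse (real (Suc n)))"
      by (rule real_sqrt_less_mono) simp
    ultimately show False
      using d0 by simp
  qed
  then obtain m where m: "\<And>n. m n \<in> M" "\<And>n. (norm (z - m n))\<^sup>2 < d\<^sup>2 + inverse (real (Suc n))"
    by metis
  have dist: "(norm (m k - m n))\<^sup>2 \<le> 2 * inverse (real (Suc k)) + 2 * inverse (real (Suc n))" for k n
  proof -
    have half: "(1/2) *\<^sub>R (m k + m n) \<in> M"
      using M(2)[OF m(1) m(1), THEN M(3), of "complex_of_real (1/2)"] by (simp only: scaleC_of_real)
    have "(z - m k) + (z - m n) = 2 *\<^sub>R (z - (1/2) *\<^sub>R (m k + m n))"
      by (simp add: algebra_simps scaleR_2)
    then have "norm ((z - m k) + (z - m n)) = 2 * norm (z - (1/2) *\<^sub>R (m k + m n))"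
      by simp
    then have "norm ((z - m k) + (z - m n)) \<ge> 2 * d"
      using d[OF half] by linarith
    then have "(norm ((z - m k) + (z - m n)))\<^sup>2 \<ge> (2 * d)\<^sup>2"
      using d0 by (intro power_mono) auto
    moreover have "norm (m k - m n) = norm ((z - m k) - (z - m n))"
      by (simp add: norm_minus_commute)
    ultimately show ?thesis
      using parallelogram[of "z - m k" "z - m n"] m(2)[of k] m(2)[of n]
      by (simp add: power_mult_distrib del: of_nat_Suc)
  qed
  have "Cauchy m"
    unfolding Cauchy_def
  proof (intro allI impI)
    fix e :: real
    assume e: "e > 0"
    then have "e\<^sup>2 / 4 > 0" by simp
    then obtain N where N: "inverse (real (Suc N)) < e\<^sup>2 / 4"
      using reals_Archimedean by blast
    have "dist (m k) (m n) < e" if "k \<ge> N" "n \<ge> N" for k n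
    proof -
      have "inverse (real (Suc k)) \<le> inverse (real (Suc N))" "inverse (real (Suc n)) \<le> inverse (real (Suc N))"
        using that by (auto intro!: le_imp_inverse_le)
      then have "(norm (m k - m n))\<^sup>2 < e\<^sup>2"
        using dist[of k n] N by linarith
      then show ?thesis
        using e by (simp add: dist_norm power_less_imp_less_base)
    qed
    then show "\<exists>N. \<forall>k\<ge>N. \<forall>n\<ge>N. dist (m k) (m n) < e" by blast
  qed
  then obtain l where l: "m \<longlonglongrightarrow> l"
    using Cauchy_convergent_iff convergent_def by blast
  show thesis
  proof (rule that)
    show "l \<in> M"
      using closed l m(1) closed_sequentially by blast
    fix x assume x: "x \<in> M"
    have "(\<lambda>n. (norm (z - m n))\<^sup>2) \<longlonglongrightarrow> (norm (z - l))\<^sup>2"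
      by (intro tendsto_intros l)
    moreover have "(\<lambda>n. d\<^sup>2 + inverse (real (Suc n))) \<longlonglongrightarrow> d\<^sup>2 + 0"
      by (intro tendsto_intros LIMSEQ_inverse_real_of_nat)
    ultimately have "(norm (z - l))\<^sup>2 \<le> d\<^sup>2 + 0"
      by (rule LIMSEQ_le) (use m(2) in \<open>auto intro: less_imp_le\<close>)
    then have "norm (z - l) \<le> d"
      using d0 by (auto intro: power2_le_imp_le)
    with d[OF x] show "norm (z - l) \<le> norm (z - x)" by linarith
  qed
qed

text \<open>If \<open>z - m\<close>, for \<open>m\<close> nearest to \<open>z\<close>, had a
  component along some \<open>x\<close> in \<open>M\<close>, moving \<open>m\<close> along
  \<open>x\<close> would bring it closer to \<open>z\<close>.\<close>

lemma orthogonal_vector_exists: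
  fixes M :: "'h::chilbert_space set"
  assumes closed: "closed M" and M: "0 \<in> M" "\<And>x y. x \<in> M \<Longrightarrow> y \<in> M \<Longrightarrow> x + y \<in> M"
    "\<And>c x. x \<in> M \<Longrightarrow> c *\<^sub>C x \<in> M" and "M \<noteq> UNIV"
  shows "\<exists>g. g \<noteq> 0 \<and> (\<forall>x\<in>M. cinner x g = 0)"
proof -
  obtain z where z: "z \<notin> M"
    using assms(5) by blast
  obtain m where m: "m \<in> M" "\<And>x. x \<in> M \<Longrightarrow> norm (z - m) \<le> norm (z - x)"
    using nearest_point_exists[OF closed M] by metis
  show ?thesis
  proof (intro exI[of _ "z - m"] conjI ballI)
    show "z - m \<noteq> 0"
      using z m(1) by auto
    fix x assume x: "x \<in> M"
    show "cinner x (z - m) = 0"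
    proof (cases "x = 0")
      case False
      let ?c = "cinner (z - m) x / cinner x x"
      have "norm (z - m) \<le> norm (z - m - ?c *\<^sub>C x)"
        using m(2)[OF M(2)[OF m(1) M(3)[OF x, of ?c]]] by (simp add: algebra_simps)
      then have "(norm (z - m))\<^sup>2 \<le> (norm (z - m - ?c *\<^sub>C x))\<^sup>2"
        by (simp add: power_mono)
      then have "(cmod (cinner (z - m) x))\<^sup>2 / (norm x)\<^sup>2 \<le> 0"
        using norm_diff_projection[OF False, of "z - m"] by simp
      then have "cinner (z - m) x = 0"
        using False by (simp add: divide_le_0_iff)
      then show ?thesis
        by (simp add: cinner_eq_0_commute)
    qed simp
  qed
qed

text \<open>An algebraic substitute for projecting onto a finite-dimensional space, with no
  closedness to check. \<open>G\<close> grows only if some \<open>u\<close> orthogonal to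
  \<open>F\<close> is not orthogonal to the new \<open>h\<close>; a multiple of \<open>u\<close>
  then corrects the product with \<open>h\<close> and leaves the others alone.\<close>

lemma finite_orthogonal_decomposition:
  assumes "finite (F :: 'h::chilbert_space set)"
  obtains G where "finite G" "\<And>z. \<exists>p\<in>cspan G. \<forall>f\<in>F. cinner (z - p) f = 0"
proof -
  have "\<exists>G. finite G \<and> (\<forall>z. \<exists>p\<in>cspan G. \<forall>f\<in>F. cinner (z - p) f = 0)"
    using assms
  proof (induction F)
    case empty
    then show ?case
      by (intro exI[of _ "{}"]) (auto intro: complex_vector.span_zero)
  next
    case (insert h F)
    then obtain G where G: "finite G" "\<And>z. \<exists>p\<in>cspan G. \<forall>f\<in>F. cinner (z - p) f = 0"
      by blast
    show ?case
    proof (cases "\<forall>u. (\<forall>f\<in>F. cinner u f = 0) \<longrightarrow> cinner u h = 0")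
      case True
      with G show ?thesis
        by (intro exI[of _ G]) (metis insert_iff)
    next
      case False
      then obtain u where u: "\<forall>f\<in>F. cinner u f = 0" "cinner u h \<noteq> 0" by blast
      have "\<exists>p\<in>cspan (Set.insert u G). \<forall>f\<in>Set.insert h F. cinner (z - p) f = 0" for z
      proof -
        obtain p where p: "p \<in> cspan G" "\<forall>f\<in>F. cinner (z - p) f = 0"
          using G(2) by blast
        let ?q = "p + (cinner (z - p) h / cinner u h) *\<^sub>C u"
        have "p \<in> cspan (Set.insert u G)"
          using p(1) complex_vector.span_mono[of G "Set.insert u G"] by blast
        then have "?q \<in> cspan (Set.insert u G)"
          by (rule complex_vector.span_add)
            (auto intro: complex_vector.span_scale complex_vector.span_base)
        moreover have "\<forall>f\<in>Set.insert h F. cinner (z - ?q) f = 0"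
          using p(2) u by (simp add: cinner_algebra)
        ultimately show ?thesis by blast
      qed
      with G(1) show ?thesis
        by (intro exI[of _ "Set.insert u G"] conjI allI) simp_all
    qed
  qed
  with that show thesis by blast
qed

lemma orthogonal_to_finite_exists:
  fixes F :: "'h::chilbert_space set"
  assumes inf: "\<not> (\<exists>B :: 'h set. finite B \<and> cspan B = UNIV)" and "finite F"
  shows "\<exists>z. norm z = 1 \<and> (\<forall>f\<in>F. cinner z f = 0)"
proof -
  obtain G where G: "finite G" "\<And>z. \<exists>p\<in>cspan G. \<forall>f\<in>F. cinner (z - p) f = 0"
    using finite_orthogonal_decomposition[OF assms(2)] by metis
  have "cspan G \<noteq> UNIV"
    using inf G(1) by blast
  then obtain z where "z \<notin> cspan G" by blast
  moreover obtain p where p: "p \<in> cspan G" "\<forall>f\<in>F. cinner (z - p) f = 0"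
    using G(2) by blast
  ultimately have ne: "z - p \<noteq> 0" by auto
  define w where "w = complex_of_real (inverse (norm (z - p))) *\<^sub>C (z - p)"
  have "norm w = 1"
    using ne by (simp add: w_def norm_scaleC del: of_real_inverse)
  moreover have w: "cinner w f = 0" if "f \<in> F" for f
    using p(2) that by (simp add: w_def cinner_scaleC_left)
  ultimately show ?thesis by blast
qed

lemma total_sequence_exists:
  assumes "separable_space (euclidean :: 'h::chilbert_space topology)"
  shows "\<exists>e :: nat \<Rightarrow> 'h. (\<forall>n. norm (e n) \<le> (1/2) ^ n) \<and> (\<forall>z. (\<forall>n. cinner z (e n) = 0) \<longrightarrow> z = 0)"
proof -
  obtain D :: "'h set" where D: "countable D" "closure D = UNIV"
    using assms by (auto simp: separable_space_def)
  have "D \<noteq> {}"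
    using D(2) by auto
  then obtain d :: "nat \<Rightarrow> 'h" where d: "range d = D"
    using D(1) uncountable_def by blast
  \<comment> \<open>The weights make the sequence summable; \<open>1 + norm (d n)\<close> avoids
    division by zero, and as no weight vanishes, orthogonality to the rescaled vectors is still
    orthogonality to a dense set.\<close>
  define a where "a n = (1/2) ^ n / (1 + norm (d n))" for n
  have a: "a n > 0" for n
    by (auto simp: a_def intro!: divide_pos_pos add_pos_nonneg)
  show ?thesis
  proof (intro exI[of _ "\<lambda>n. complex_of_real (a n) *\<^sub>C d n"] conjI allI impI)
    fix n
    have "norm (complex_of_real (a n) *\<^sub>C d n) = (1/2) ^ n * (norm (d n) / (1 + norm (d n)))"
      using a[of n] unfolding norm_scaleC norm_of_real by (simp add: a_def)
    also have "\<dots> \<le> (1/2) ^ n * 1"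
      by (rule mult_left_mono) (auto simp: divide_le_eq add_pos_nonneg)
    finally show "norm (complex_of_real (a n) *\<^sub>C d n) \<le> (1/2) ^ n" by simp
  next
    fix z :: 'h
    assume "\<forall>n. cinner z (complex_of_real (a n) *\<^sub>C d n) = 0"
    then have "cinner z (d n) = 0" for n
      using a[of n] by (metis cinner_scaleC_right complex_cnj_complex_of_real less_irrefl
          mult_eq_0_iff of_real_eq_0_iff)
    then have sub: "D \<subseteq> {y. cinner z y = 0}"
      using d by auto
    have "closed {y. cinner z y = 0}"
      by (intro closed_Collect_eq continuous_intros
          linear_continuous_on[OF bounded_linear_cinner_right])
    then have "closure D \<subseteq> {y. cinner z y = 0}"
      using sub closure_minimal by blast
    then have "z \<in> {y. cinner z y = 0}"
      unfolding D(2) by blast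
    then show "z = 0" by simp
  qed
qed


section \<open>Operators on a Hilbert space and automorphisms of their algebra\<close>

notation cblinop_apply (infixr "\<cdot>" 68)

text \<open>Meaningful for bounded complex linear \<open>f\<close>, which are known to come from
  some operator.\<close>

definition cblinop_of :: "('a::complex_normed_vector \<Rightarrow> 'a) \<Rightarrow> 'a cblinop" where
  "cblinop_of f = (SOME A. cblinop_apply A = f)"

lemma cblinop_of_apply:
  assumes "bounded_clinear f"
  shows "cblinop_of f \<cdot> x = f x"
proof -
  obtain A where "cblinop_apply A = f"
    using cblinop_exists[OF assms] .
  then have "cblinop_apply (SOME A. cblinop_apply A = f) = f"
    by (rule someI)
  then show ?thesis
    unfolding cblinop_of_def by simp
qed

lemma clinear_cblinop_apply: "clinear (cblinop_apply A)"
  using bounded_clinear_cblinop_apply by (rule bounded_clinear_clinear)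

lemma cblinop_apply_add_right: "A \<cdot> (x + y) = (A \<cdot> x) + (A \<cdot> y)"
  and cblinop_apply_scaleC_right: "A \<cdot> (c *\<^sub>C x) = c *\<^sub>C (A \<cdot> x)"
  and cblinop_apply_diff_right: "A \<cdot> (x - y) = (A \<cdot> x) - (A \<cdot> y)"
  and cblinop_apply_zero_right [simp]: "A \<cdot> 0 = 0"
  using clinear_cblinop_apply[of A] by (auto simp: clinear_add clinear_scaleC clinear_diff clinear_zero)

lemma cblinop_apply_zero [simp]: "0 \<cdot> x = 0"
  using cblinop_apply_plus[of 0 0 x] by simp

lemma cblinop_apply_diff [simp]: "(A - B) \<cdot> x = (A \<cdot> x) - (B \<cdot> x)"
  using cblinop_apply_plus[of "A - B" B x] by simp

lemma norm_cblinop_apply_le: "norm (A \<cdot> x) \<le> norm A * norm x"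
  unfolding norm_cblinop_onorm
  by (rule onorm[OF bounded_clinear_bounded_linear[OF bounded_clinear_cblinop_apply]])

lemma norm_cblinop_le: "0 \<le> b \<Longrightarrow> (\<And>x. norm (A \<cdot> x) \<le> b * norm x) \<Longrightarrow> norm A \<le> b"
  unfolding norm_cblinop_onorm by (rule onorm_bound)

lemma bounded_linear_cblinop_apply: "bounded_linear (cblinop_apply A)"
  by (rule bounded_clinear_bounded_linear[OF bounded_clinear_cblinop_apply])

lemma bounded_linear_cblinop_eval: "bounded_linear (\<lambda>A. A \<cdot> x)"
proof (rule bounded_clinear_bounded_linear, rule bounded_clinearI)
  show "norm (A \<cdot> x) \<le> norm A * norm x" for A by (rule norm_cblinop_apply_le)
qed (simp add: clinear_def)

definition idop :: "'a::complex_normed_vector cblinop" where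
  "idop = cblinop_of (\<lambda>x. x)"

lemma idop_apply [simp]: "idop \<cdot> x = x"
  unfolding idop_def
  by (rule cblinop_of_apply) (auto simp: bounded_clinear_def clinear_def intro: exI[of _ 1])

lemma idop_mult [simp]: "idop * A = A" "A * idop = A"
  by (auto intro: cblinop_eqI)

text \<open>The operator |x><y| of bra-ket notation, linear in \<open>x\<close> and conjugate linear
  in \<open>y\<close>.\<close>

definition rk :: "'h::chilbert_space \<Rightarrow> 'h \<Rightarrow> 'h cblinop" where
  "rk x y = cblinop_of (\<lambda>z. cinner z y *\<^sub>C x)"

lemma rk_apply [simp]: "rk x y \<cdot> z = cinner z y *\<^sub>C x"
  unfolding rk_def
proof (rule cblinop_of_apply, rule bounded_clinearI)
  show "norm (cinner z y *\<^sub>C x) \<le> norm z * (norm y * norm x)" for z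
    using mult_right_mono[OF cinner_Cauchy_Schwarz norm_ge_zero] by (simp add: norm_scaleC mult.assoc)
qed (simp add: clinear_def cinner_algebra scaleC_add_left scaleC_scaleC)

lemma norm_rk_le: "norm (rk x y) \<le> norm x * norm y"
proof (rule norm_cblinop_le)
  show "norm (rk x y \<cdot> z) \<le> norm x * norm y * norm z" for z
    using mult_right_mono[OF cinner_Cauchy_Schwarz norm_ge_zero, of z y x]
    by (simp add: norm_scaleC mult_ac)
qed simp

lemma rk_add_left: "rk (x + x') y = rk x y + rk x' y"
  and rk_add_right: "rk x (y + y') = rk x y + rk x y'"
  and rk_scaleC_left: "rk (c *\<^sub>C x) y = c *\<^sub>C rk x y"
  and rk_scaleC_right: "rk x (c *\<^sub>C y) = cnj c *\<^sub>C rk x y"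
  by (auto intro!: cblinop_eqI simp: scaleC_add_right scaleC_add_left cinner_algebra scaleC_scaleC mult.commute)

lemma mult_rk: "A * rk x y = rk (A \<cdot> x) y"
  by (rule cblinop_eqI) (simp add: cblinop_apply_scaleC_right)

lemma rk_mult_rk: "rk x y * rk u v = cinner u y *\<^sub>C rk x v"
  by (simp add: mult_rk rk_scaleC_left)

lemma rk_eq_0: "rk x y = 0 \<longleftrightarrow> x = 0 \<or> y = 0"
proof
  assume "rk x y = 0"
  then have "rk x y \<cdot> y = 0" by simp
  then show "x = 0 \<or> y = 0" by auto
qed (auto intro: cblinop_eqI)

lemma cblinop_neq_0D: "A \<noteq> 0 \<Longrightarrow> \<exists>x. A \<cdot> x \<noteq> 0"
  by (metis cblinop_apply_zero cblinop_eqI)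

text \<open>\<open>B(H)\<close> is a prime ring: a rank one \<open>M\<close> carries a nonzero value
  of \<open>B\<close> to a vector that \<open>A\<close> does not kill.\<close>

lemma cblinop_prime:
  assumes "A \<noteq> 0" "(B :: 'h::chilbert_space cblinop) \<noteq> 0"
  obtains M where "A * M * B \<noteq> 0"
proof -
  obtain x y where x: "A \<cdot> x \<noteq> 0" and y: "B \<cdot> y \<noteq> 0"
    using assms cblinop_neq_0D by blast
  have "(A * rk x (B \<cdot> y) * B) \<cdot> y \<noteq> 0"
    using x y by (simp add: cblinop_apply_scaleC_right)
  with that show thesis
    by (metis cblinop_apply_zero)
qed

definition noninjective :: "'a::complex_normed_vector cblinop \<Rightarrow> bool" where
  "noninjective A \<longleftrightarrow> (\<exists>z. z \<noteq> 0 \<and> A \<cdot> z = 0)"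

lemma noninjectiveI: "A \<cdot> z = 0 \<Longrightarrow> z \<noteq> 0 \<Longrightarrow> noninjective A"
  by (auto simp: noninjective_def)

text \<open>Expresses a property of vectors through products alone, hence in a form that
  automorphisms respect.\<close>

lemma noninjective_iff_zero_divisor:
  "noninjective (A :: 'h::chilbert_space cblinop) \<longleftrightarrow> (\<exists>B. B \<noteq> 0 \<and> A * B = 0)"
proof
  assume "noninjective A"
  then obtain z where "z \<noteq> 0" "A \<cdot> z = 0"
    by (auto simp: noninjective_def)
  then have "rk z z \<noteq> 0" "A * rk z z = 0"
    by (auto simp: rk_eq_0 mult_rk)
  then show "\<exists>B. B \<noteq> 0 \<and> A * B = 0" by blast
next
  assume "\<exists>B. B \<noteq> 0 \<and> A * B = 0"
  then obtain B where "B \<noteq> 0" "A * B = 0" by blast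
  then obtain z where "B \<cdot> z \<noteq> 0" "(A * B) \<cdot> z = 0"
    using cblinop_neq_0D by (metis cblinop_apply_zero)
  then show "noninjective A"
    by (auto intro: noninjectiveI)
qed

text \<open>An algebraic form of \<open>rank A \<le> 1\<close>, visibly preserved by automorphisms.\<close>

definition rank_le1 :: "'a::complex_normed_vector cblinop \<Rightarrow> bool" where
  "rank_le1 A \<longleftrightarrow> (\<forall>N. \<exists>c. A * N * A = c *\<^sub>C A)"

lemma rank_le1_rk: "rank_le1 (rk x y)"
  unfolding rank_le1_def
proof
  fix N
  have "rk x y * N * rk x y = cinner (N \<cdot> x) y *\<^sub>C rk x y"
    by (simp add: mult_rk rk_scaleC_left)
  then show "\<exists>c. rk x y * N * rk x y = c *\<^sub>C rk x y" ..
qed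

lemma rank_le1_scaleC: "rank_le1 A \<Longrightarrow> rank_le1 (c *\<^sub>C A)"
  unfolding rank_le1_def
proof
  fix N assume "\<forall>N. \<exists>c. A * N * A = c *\<^sub>C A"
  then obtain d where "A * N * A = d *\<^sub>C A" by blast
  then have "c *\<^sub>C A * N * c *\<^sub>C A = (c * d) *\<^sub>C c *\<^sub>C A"
    by (simp add: mult_scaleC_left mult_scaleC_right scaleC_scaleC mult_ac)
  then show "\<exists>d. c *\<^sub>C A * N * c *\<^sub>C A = d *\<^sub>C c *\<^sub>C A" ..
qed

text \<open>Testing the rank condition on \<open>rk u (Q \<cdot> z)\<close> makes
  \<open>cinner (Q \<cdot> z) (Q \<cdot> z) *\<^sub>C u\<close> a multiple of
  \<open>Q \<cdot> z\<close>.\<close>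

lemma rank_le1_idempotent_range:
  fixes Q :: "'h::chilbert_space cblinop"
  assumes "rank_le1 Q" "Q \<cdot> u = u" "u \<noteq> 0"
  obtains c where "Q \<cdot> z = c *\<^sub>C u"
proof -
  obtain c where "Q * rk u (Q \<cdot> z) * Q = c *\<^sub>C Q"
    using assms(1) rank_le1_def by blast
  then have "(Q * rk u (Q \<cdot> z) * Q) \<cdot> z = (c *\<^sub>C Q) \<cdot> z" by simp
  then have *: "cinner (Q \<cdot> z) (Q \<cdot> z) *\<^sub>C u = c *\<^sub>C (Q \<cdot> z)"
    by (simp add: cblinop_apply_scaleC_right assms(2))
  show thesis
  proof (cases "Q \<cdot> z = 0")
    case True
    then show ?thesis using that[of 0] by simp
  next
    case False
    with * assms(3) have "c \<noteq> 0" by auto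
    with * have "Q \<cdot> z = (inverse c * cinner (Q \<cdot> z) (Q \<cdot> z)) *\<^sub>C u"
      by (simp add: scaleC_scaleC[symmetric])
    then show ?thesis by (rule that)
  qed
qed

text \<open>In the Peirce decomposition by \<open>Q\<close> the hypothesis makes \<open>N\<close>
  off-diagonal, so \<open>Q * N * Q = 0\<close>. Rank at most one then gives
  \<open>N * Q * M * (Q * N) = 0\<close> for all \<open>M\<close>, and primeness leaves only one of
  the two corners.\<close>

lemma rank_le1_corner:
  fixes N Q :: "'h::chilbert_space cblinop"
  assumes N: "rank_le1 N" and Q: "Q * Q = Q" and NQ: "Q * N + N * Q = N"
  shows "Q * N = 0 \<or> N * Q = 0"
proof (rule ccontr)
  assume "\<not> ?thesis"
  then have ne: "N * Q \<noteq> 0" "Q * N \<noteq> 0" by auto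
  have QQ: "Q * (Q * A) = Q * A" for A
    by (simp add: mult.assoc[symmetric] Q)
  have "Q * N + Q * (N * Q) = Q * N"
    using arg_cong[OF NQ, of "\<lambda>A. Q * A"] by (simp add: distrib_left QQ)
  then have QNQ: "Q * (N * Q) = 0" by simp
  have "N * Q * M * (Q * N) = 0" for M
  proof -
    obtain c where c: "N * (Q * M * Q) * N = c *\<^sub>C N"
      using N rank_le1_def by blast
    have "Q * (N * (Q * M * Q) * N) = Q * (N * Q) * (M * (Q * N))"
      by (simp add: mult.assoc)
    then have "c *\<^sub>C (Q * N) = 0"
      using c QNQ by (simp add: mult_scaleC_right)
    with ne have "c = 0" by simp
    with c show ?thesis by (simp add: mult.assoc)
  qed
  with cblinop_prime[OF ne] show False by metis
qed

section \<open>Algebra automorphisms and the properties they preserve\<close>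

lemma Aut_clinear: "\<tau> \<in> Aut \<Longrightarrow> clinear \<tau>"
  and Aut_mult: "\<tau> \<in> Aut \<Longrightarrow> \<tau> (a * b) = \<tau> a * \<tau> b"
  and Aut_bij: "\<tau> \<in> Aut \<Longrightarrow> bij \<tau>"
  by (auto simp: Aut_def)

lemma AutI: "clinear \<tau> \<Longrightarrow> (\<And>a b. \<tau> (a * b) = \<tau> a * \<tau> b) \<Longrightarrow> bij \<tau> \<Longrightarrow> \<tau> \<in> Aut"
  by (auto simp: Aut_def)

lemma Aut_eq_0_iff: "\<tau> \<in> Aut \<Longrightarrow> \<tau> a = 0 \<longleftrightarrow> a = 0"
  by (metis Aut_bij Aut_clinear bij_def clinear_zero injD)

lemma Aut_surjE: "\<tau> \<in> Aut \<Longrightarrow> (\<And>a. b = \<tau> a \<Longrightarrow> thesis) \<Longrightarrow> thesis"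
  by (metis Aut_bij bij_pointE)

lemma Aut_inv: 
  assumes "\<tau> \<in> Aut" shows "inv \<tau> \<in> Aut"
proof (rule AutI)
  have f: "\<tau> (inv \<tau> x) = x" "inv \<tau> (\<tau> x) = x" for x
    using Aut_bij[OF assms] by (auto simp: bij_def surj_f_inv_f inv_f_f)
  have eq: "inv \<tau> y = x" if "y = \<tau> x" for x y
    using that f by simp
  show "clinear (inv \<tau>)"
    unfolding clinear_def
    by (auto intro!: eq simp: clinear_add[OF Aut_clinear[OF assms]] clinear_scaleC[OF Aut_clinear[OF assms]] f)
  show "inv \<tau> (a * b) = inv \<tau> a * inv \<tau> b" for a b
    by (auto intro!: eq simp: Aut_mult[OF assms] f)
  show "bij (inv \<tau>)"
    by (rule bij_imp_bij_inv[OF Aut_bij[OF assms]])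
qed

text \<open>By surjectivity \<open>idop\<close> is itself an image, and \<open>\<tau> idop\<close>
  is a left unit for images.\<close>

lemma Aut_idop:
  assumes "\<tau> \<in> Aut" shows "\<tau> idop = (idop :: 'h::{complex_normed_vector, banach} cblinop)"
proof -
  obtain a where a: "idop = \<tau> a"
    using Aut_surjE[OF assms] .
  have "\<tau> idop * \<tau> a = \<tau> a"
    using Aut_mult[OF assms, of idop a] by simp
  then show ?thesis
    unfolding a[symmetric] by simp
qed

lemma Aut_noninjective_iff:
  fixes \<tau> :: "'h::chilbert_space cblinop \<Rightarrow> 'h cblinop"
  assumes "\<tau> \<in> Aut"
  shows "noninjective (\<tau> A) \<longleftrightarrow> noninjective A"
proof -
  have "noninjective (\<tau> A)" if "\<tau> \<in> Aut" "noninjective A" for \<tau> :: "'h cblinop \<Rightarrow> 'h cblinop" and A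
    using that unfolding noninjective_iff_zero_divisor
    by (metis Aut_mult Aut_eq_0_iff)
  from this[OF assms] this[OF Aut_inv[OF assms], of "\<tau> A"] show ?thesis
    using Aut_bij[OF assms] by (auto simp: bij_def inv_f_f)
qed

lemma Aut_rank_le1:
  assumes "\<tau> \<in> Aut" "rank_le1 A"
  shows "rank_le1 (\<tau> A)"
  unfolding rank_le1_def
proof
  fix N
  obtain M where M: "N = \<tau> M"
    using Aut_surjE[OF assms(1)] .
  obtain c where "A * M * A = c *\<^sub>C A"
    using assms(2) rank_le1_def by blast
  then have "\<tau> A * N * \<tau> A = c *\<^sub>C \<tau> A"
    by (metis M Aut_mult[OF assms(1)] clinear_scaleC[OF Aut_clinear[OF assms(1)]])
  then show "\<exists>c. \<tau> A * N * \<tau> A = c *\<^sub>C \<tau> A" ..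
qed

text \<open>The product is a parameter, so that the lemma covers the opposite algebra as well.\<close>

lemma corner_relations:
  fixes b :: "'h::chilbert_space \<Rightarrow> 'h \<Rightarrow> 'a::complex_vector" and t :: "'a \<Rightarrow> 'a \<Rightarrow> 'a" (infixl "\<otimes>" 70)
  assumes assoc: "\<And>A B C. A \<otimes> B \<otimes> C = A \<otimes> (B \<otimes> C)"
    and t_add: "\<And>A B C. (A + B) \<otimes> C = A \<otimes> C + B \<otimes> C" "\<And>A B C. A \<otimes> (B + C) = A \<otimes> B + A \<otimes> C"
    and t_scale: "\<And>c A B. (c *\<^sub>C A) \<otimes> B = c *\<^sub>C (A \<otimes> B)" "\<And>c A B. A \<otimes> (c *\<^sub>C B) = c *\<^sub>C (A \<otimes> B)"
    and b_add: "\<And>x x' y. b (x + x') y = b x y + b x' y" "\<And>x y y'. b x (y + y') = b x y + b x y'"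
    and b_scale: "\<And>c x y. b (c *\<^sub>C x) y = c *\<^sub>C b x y" "\<And>c x y. b x (c *\<^sub>C y) = cnj c *\<^sub>C b x y"
    and e: "norm e = 1" and Q0: "b e e \<noteq> 0" and QQ: "b e e \<otimes> b e e = b e e"
    and QN: "\<And>x. cinner x e = 0 \<Longrightarrow> b e e \<otimes> b x e = 0" "\<And>x. cinner x e = 0 \<Longrightarrow> b x e \<otimes> b e e = b x e"
    and QM: "\<And>y. cinner y e = 0 \<Longrightarrow> b e y \<otimes> b e e + b e e \<otimes> b e y = b e y"
      "\<And>y. cinner y e = 0 \<Longrightarrow> b e y \<otimes> b e e = 0 \<or> b e e \<otimes> b e y = 0"
    and NM: "\<And>x y. cinner x e = 0 \<Longrightarrow> cinner y e = 0 \<Longrightarrow>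
      b x e \<otimes> b e y + b e y \<otimes> b x e = b x y + cinner x y *\<^sub>C b e e"
    and QR: "\<And>x y. cinner x e = 0 \<Longrightarrow> cinner y e = 0 \<Longrightarrow> b e e \<otimes> b x y = 0"
  shows "b x e \<otimes> b e y = b x y" "b e y \<otimes> b x e = cinner x y *\<^sub>C b e e"
proof -
  define Q where "Q = b e e"
  have zero: "0 \<otimes> A = 0" "A \<otimes> 0 = 0" for A
    using t_add(1)[of 0 0 A] t_add(2)[of A 0 0] by simp_all
  have QN': "Q \<otimes> (b x e \<otimes> A) = 0" if "cinner x e = 0" for x A
    using QN(1)[OF that] by (simp add: Q_def assoc[symmetric] zero)
  \<comment> \<open>Multiplying \<open>NM\<close> by \<open>Q\<close> from the left isolates the
    wanted product, since \<open>Q\<close> annihilates \<open>b x e\<close> and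
    \<open>b x y\<close>.\<close>
  have eq: "Q \<otimes> (b e y \<otimes> b x e) = cinner x y *\<^sub>C Q" if "cinner x e = 0" "cinner y e = 0" for x y
    using arg_cong[OF NM[OF that, folded Q_def], of "\<lambda>A. Q \<otimes> A"]
      QR[OF that, folded Q_def] QN'[OF that(1), of "b e y"]
    by (simp add: t_add t_scale QQ[folded Q_def])
  have MQ: "b e y \<otimes> Q = 0" "Q \<otimes> b e y = b e y" if y: "cinner y e = 0" for y
  proof -
    show MQ: "b e y \<otimes> Q = 0"
    proof (cases "y = 0")
      case True
      then have "b e y = 0"
        using b_scale(2)[of e 0 0] by simp
      then show ?thesis by (simp add: zero)
    next
      case False
      \<comment> \<open>Otherwise \<open>eq\<close> with \<open>x = y\<close> would make
        \<open>cinner y y *\<^sub>C Q\<close> vanish; this selects the alternative in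
        \<open>QM\<close>.\<close>
      have "Q \<otimes> b e y \<noteq> 0"
      proof
        assume "Q \<otimes> b e y = 0"
        then have "Q \<otimes> (b e y \<otimes> b y e) = 0"
          by (simp add: assoc[symmetric] zero)
        with eq[OF y y] have "cinner y y *\<^sub>C Q = 0" by simp
        with False Q0 show False
          by (simp add: Q_def)
      qed
      with QM(2)[OF y] show ?thesis by (simp add: Q_def)
    qed
    show "Q \<otimes> b e y = b e y"
      using QM(1)[OF y, folded Q_def] unfolding MQ by simp
  qed
  have MN: "b e y \<otimes> b x e = cinner x y *\<^sub>C Q" if "cinner x e = 0" "cinner y e = 0" for x y
    using eq[OF that] MQ(2)[OF that(2)] by (metis assoc)
  have NMR: "b x e \<otimes> b e y = b x y" if "cinner x e = 0" "cinner y e = 0" for x y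
    using NM[OF that] MN[OF that] by (simp add: Q_def)
  have ee: "cinner e e = 1"
    using e by (simp add: cinner_self)
  \<comment> \<open>General arguments split along \<open>e\<close>, and the products of the
    components are the relations already obtained.\<close>
  define x0 y0 where "x0 = x - cinner x e *\<^sub>C e" and "y0 = y - cinner y e *\<^sub>C e"
  have x0: "cinner x0 e = 0" and y0: "cinner y0 e = 0"
    by (simp_all add: x0_def y0_def cinner_algebra ee)
  have y0': "cinner e y0 = 0"
    using y0 cinner_eq_0_commute by blast
  have x: "x = cinner x e *\<^sub>C e + x0" and y: "y = cinner y e *\<^sub>C e + y0"
    by (simp_all add: x0_def y0_def)
  have xy: "cinner x y = cinner x e * cnj (cinner y e) + cinner x0 y0"
    using x0 y0 by (subst x, subst y) (simp add: cinner_algebra ee y0')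
  have bx: "b x e = cinner x e *\<^sub>C Q + b x0 e" and "by": "b e y = cnj (cinner y e) *\<^sub>C Q + b e y0"
    by (subst x, simp add: b_add b_scale Q_def) (subst y, simp add: b_add b_scale Q_def)
  have bxy: "b x y = cinner x e *\<^sub>C cnj (cinner y e) *\<^sub>C Q + cinner x e *\<^sub>C b e y0
    + cnj (cinner y e) *\<^sub>C b x0 e + b x0 y0"
    by (subst x, subst y) (simp add: b_add b_scale Q_def scaleC_add_right scaleC_scaleC mult.commute)
  note facts = QN[OF x0, folded Q_def] MQ[OF y0] MN[OF x0 y0] NMR[OF x0 y0] QQ[folded Q_def]
  show "b x e \<otimes> b e y = b x y"
    unfolding bx "by" bxy
    by (simp add: t_add t_scale facts scaleC_add_right scaleC_scaleC algebra_simps)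
  show "b e y \<otimes> b x e = cinner x y *\<^sub>C b e e"
    unfolding bx "by" xy Q_def[symmetric]
    by (simp add: t_add t_scale facts scaleC_add_left scaleC_scaleC mult.commute)
qed


section \<open>An injective operator of dense range that is not surjective\<close>

text \<open>\<open>A\<close> is small on unit vectors orthogonal to the first \<open>N\<close> of
  the \<open>d n\<close>. If it were surjective, the closed graph theorem would bound its inverse,
  which fails for large \<open>N\<close>.\<close>

lemma nonsurjective_sum_of_projections:
  fixes d :: "nat \<Rightarrow> 'h::chilbert_space"
  assumes inf: "\<not> (\<exists>B :: 'h set. finite B \<and> cspan B = UNIV)"
    and d: "\<And>n. norm (d n) \<le> (1/2) ^ n" and A: "(\<lambda>n. rk (d n) (d n)) sums A"
    and inj: "\<And>z. A \<cdot> z = 0 \<Longrightarrow> z = 0"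
  obtains g where "norm g = 1" "g \<notin> range (cblinop_apply A)"
proof -
  have "\<not> surj (cblinop_apply A)"
  proof
    assume surj: "surj (cblinop_apply A)"
    define f where "f = inv (cblinop_apply A)"
    have Af: "A \<cdot> f z = z" for z
      using surj by (simp add: f_def surj_f_inv_f)
    have inj': "x = y" if "A \<cdot> x = A \<cdot> y" for x y
      using inj[of "x - y"] that by (simp add: cblinop_apply_diff_right)
    have fA: "f (A \<cdot> z) = z" for z
      by (rule inj') (simp add: Af)
    have "f (x + y) = f x + f y" "f (c *\<^sub>C x) = c *\<^sub>C f x" for x y c
      by (rule inj', simp add: Af cblinop_apply_add_right cblinop_apply_scaleC_right)+
    then have "linear f"
      by (intro clinear_linear) (simp add: clinear_def)
    moreover have "m = 0" if X: "X \<longlonglongrightarrow> 0" and m: "(\<lambda>n. f (X n)) \<longlonglongrightarrow> m" for X m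
    proof -
      have "(\<lambda>n. A \<cdot> f (X n)) \<longlonglongrightarrow> A \<cdot> m"
        by (rule bounded_linear.tendsto[OF bounded_linear_cblinop_apply m])
      then have "X \<longlonglongrightarrow> A \<cdot> m"
        by (simp add: Af)
      then have "A \<cdot> m = 0"
        using X by (rule LIMSEQ_unique)
      then show ?thesis by (rule inj)
    qed
    ultimately have "bounded_linear f"
      by (rule closed_graph)
    then obtain C where C: "C > 0" "\<And>x. norm (f x) \<le> norm x * C"
      using bounded_linear.pos_bounded by blast
    \<comment> \<open>The tail of the series at \<open>z\<close> has norm at most
      \<open>(1/4) ^ N * (4/3)\<close>, rounded up to \<open>2 * (1/4) ^ N\<close>; \<open>N\<close>
      is taken so large that \<open>C\<close> times this is below \<open>norm z = 1\<close>.\<close>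
    have "(\<lambda>N. 2 * C * (1/4) ^ N) \<longlonglongrightarrow> 2 * C * 0"
      by (intro tendsto_intros LIMSEQ_power_zero) simp
    then have "\<forall>\<^sub>F N in sequentially. 2 * C * (1/4) ^ N < 1"
      by (rule order_tendstoD) simp
    then obtain N where N: "2 * C * (1/4) ^ N < 1"
      by (auto simp: eventually_sequentially)
    obtain z where z: "norm z = 1" "\<forall>y\<in>d ` {..<N}. cinner z y = 0"
      using orthogonal_to_finite_exists[OF inf, of "d ` {..<N}"] by blast
    have "(\<lambda>n. rk (d n) (d n) \<cdot> z) sums (A \<cdot> z)"
      by (rule bounded_linear.sums[OF bounded_linear_cblinop_eval A])
    then have Az: "(\<lambda>n. rk (d (n + N)) (d (n + N)) \<cdot> z) sums (A \<cdot> z)"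
      by (subst sums_zero_iff_shift) (use z(2) in auto)
    have bd: "norm (rk (d n) (d n) \<cdot> z) \<le> (1/4) ^ n" for n
    proof -
      have "norm (rk (d n) (d n) \<cdot> z) \<le> norm (rk (d n) (d n)) * norm z"
        by (rule norm_cblinop_apply_le)
      also have "\<dots> \<le> norm (d n) * norm (d n)"
        using norm_rk_le[of "d n" "d n"] z(1) by simp
      also have "\<dots> \<le> (1/2) ^ n * (1/2) ^ n"
        by (intro mult_mono d) auto
      finally show ?thesis
        by (simp add: power_mult_distrib[symmetric])
    qed
    have geo: "(\<lambda>n. (1/4) ^ N * (1/4) ^ n :: real) sums ((1/4) ^ N * (4/3))"
      using geometric_sums[of "1/4 :: real"] by (intro sums_mult) simp
    have bdN: "norm (rk (d (n + N)) (d (n + N)) \<cdot> z) \<le> (1/4) ^ N * (1/4) ^ n" for n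
      using bd[of "n + N"] by (simp add: power_add mult.commute)
    have "norm (\<Sum>n. rk (d (n + N)) (d (n + N)) \<cdot> z) \<le> (\<Sum>n. (1/4) ^ N * (1/4) ^ n)"
      by (rule norm_suminf_le) (rule bdN, rule sums_summable[OF geo])
    then have "norm (A \<cdot> z) \<le> (1/4) ^ N * (4/3)"
      using sums_unique[OF Az] sums_unique[OF geo] by simp
    also have "\<dots> \<le> 2 * (1/4) ^ N"
      by simp
    finally have "norm (A \<cdot> z) * C \<le> 2 * (1/4) ^ N * C"
      using C(1) by simp
    with N C(2)[of "A \<cdot> z"] show False
      by (simp add: fA z(1) mult_ac)
  qed
  then obtain h where h: "h \<notin> range (cblinop_apply A)" by blast
  then have "h \<noteq> 0"
    by (metis cblinop_apply_zero_right rangeI)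
  define g where "g = complex_of_real (inverse (norm h)) *\<^sub>C h"
  have "norm g = 1"
    using \<open>h \<noteq> 0\<close> by (simp add: g_def norm_scaleC del: of_real_inverse)
  moreover have "g \<notin> range (cblinop_apply A)"
  proof
    assume "g \<in> range (cblinop_apply A)"
    then obtain w where "A \<cdot> w = g" by auto
    then have "A \<cdot> (complex_of_real (norm h) *\<^sub>C w) = h"
      using \<open>h \<noteq> 0\<close>
      by (simp add: g_def cblinop_apply_scaleC_right scaleC_scaleC scaleC_one flip: of_real_mult del: of_real_inverse)
    with h show False by (metis rangeI)
  qed
  ultimately show thesis by (rule that)
qed

text \<open>\<open>cinner (A \<cdot> z) z\<close> is the sum of the squares of
  \<open>cmod (cinner z (d n))\<close>, so totality of \<open>d\<close> makes \<open>A\<close>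
  strictly positive. Injectivity and dense range, the latter in the form that
  \<open>F * A = 0\<close> forces \<open>F = 0\<close>, both follow.\<close>

lemma injective_nonsurjective_operator:
  assumes inf: "\<not> (\<exists>B :: 'h::chilbert_space set. finite B \<and> cspan B = UNIV)"
    and sep: "separable_space (euclidean :: 'h topology)"
  obtains d :: "nat \<Rightarrow> 'h::chilbert_space" and A g where "(\<lambda>n. rk (d n) (d n)) sums A" "\<And>z. A \<cdot> z = 0 \<Longrightarrow> z = 0"
    "\<And>F. F * A = 0 \<Longrightarrow> F = 0" "norm g = 1" "g \<notin> range (cblinop_apply A)"
proof -
  obtain d :: "nat \<Rightarrow> 'h" where "(\<forall>n. norm (d n) \<le> (1/2) ^ n) \<and> (\<forall>z. (\<forall>n. cinner z (d n) = 0) \<longrightarrow> z = 0)"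
    using total_sequence_exists[OF sep] ..
  then have d: "\<And>n. norm (d n) \<le> (1/2) ^ n" "\<And>z. (\<And>n. cinner z (d n) = 0) \<Longrightarrow> z = 0"
    by simp_all
  have "norm (rk (d n) (d n)) \<le> (1/2) ^ n" for n
  proof -
    have "norm (d n) \<le> 1"
      using d(1)[of n] power_le_one[of "1/2 :: real" n] by simp
    then    have "norm (rk (d n) (d n)) \<le> (1/2) ^ n * 1"
      using d(1)[of n] by (intro order_trans[OF norm_rk_le] mult_mono) auto
    then show ?thesis by simp
  qed
  then have "summable (\<lambda>n. rk (d n) (d n))"
    by (rule summable_comparison_test'[where g = "\<lambda>n. (1/2) ^ n" and N = 0, rotated]) auto
  then obtain A where A: "(\<lambda>n. rk (d n) (d n)) sums A"
    by (auto simp: summable_def)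
  have pos: "z = 0" if "cinner (A \<cdot> z) z = 0" for z
  proof -
    have "(\<lambda>n. Re (cinner (rk (d n) (d n) \<cdot> z) z)) sums Re (cinner (A \<cdot> z) z)"
      by (intro bounded_linear.sums[OF bounded_linear_Re] bounded_linear.sums[OF bounded_linear_cinner_left]
          bounded_linear.sums[OF bounded_linear_cblinop_eval] A)
    moreover have "Re (cinner (rk (d n) (d n) \<cdot> z) z) = (cmod (cinner z (d n)))\<^sup>2" for n
      by (simp add: cinner_scaleC_left cinner_mult_commute del: of_real_power)
    ultimately have sums: "(\<lambda>n. (cmod (cinner z (d n)))\<^sup>2) sums 0"
      by (simp only: that) simp
    have "\<forall>n. (cmod (cinner z (d n)))\<^sup>2 = 0"
      using suminf_eq_zero_iff[OF sums_summable[OF sums]] sums_unique[OF sums] by simp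
    then have "cinner z (d n) = 0" for n by simp
    then show ?thesis by (rule d(2))
  qed
  have inj: "z = 0" if "A \<cdot> z = 0" for z
    using pos that by simp
  have dense: "F = 0" if F: "F * A = 0" for F
  proof -
    have "{x. F \<cdot> x = 0} = UNIV"
    proof (rule ccontr)
      assume "{x. F \<cdot> x = 0} \<noteq> UNIV"
      moreover have "closed {x. F \<cdot> x = 0}"
        by (intro closed_Collect_eq continuous_intros linear_continuous_on[OF bounded_linear_cblinop_apply])
      ultimately have "\<exists>g. g \<noteq> 0 \<and> (\<forall>x\<in>{x. F \<cdot> x = 0}. cinner x g = 0)"
        by (intro orthogonal_vector_exists) (auto simp: cblinop_apply_add_right cblinop_apply_scaleC_right)
      then obtain g where g: "g \<noteq> 0" "\<And>x. F \<cdot> x = 0 \<Longrightarrow> cinner x g = 0"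
        by blast
      \<comment> \<open>The kernel of \<open>F\<close> contains the range of \<open>A\<close>, in
        particular \<open>A \<cdot> g\<close>, while \<open>g\<close> is orthogonal to that
        kernel.\<close>
      have "F \<cdot> (A \<cdot> g) = 0"
        using F by (metis cblinop_apply_times cblinop_apply_zero)
      then have "cinner (A \<cdot> g) g = 0"
        using g(2) by simp
      with pos g(1) show False by simp
    qed
    then have "F \<cdot> x = 0" for x
      by blast
    then show ?thesis
      by (intro cblinop_eqI) simp
  qed
  obtain g where g: "norm g = 1" "g \<notin> range (cblinop_apply A)"
    using nonsurjective_sum_of_projections[OF inf d(1) A inj] .
  show thesis
    by (rule that[OF A inj dense g])
qed

section \<open>Unital maps that are locally multiples of automorphisms\<close>

text \<open>\<open>\<Psi>\<close> will be the action on the fibre over one point, tested on a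
  cut-off times \<open>A\<close>. The scalar in \<open>loc\<close> is the value of the cut-off at an
  unknown point and may be zero.\<close>

locale local_automorphism =
  fixes \<Psi> :: "'h::chilbert_space cblinop \<Rightarrow> 'h cblinop" and K :: real and e :: 'h
  assumes inf: "\<not> (\<exists>B :: 'h set. finite B \<and> cspan B = UNIV)"
    and sep: "separable_space (euclidean :: 'h topology)"
    and clin: "clinear \<Psi>" and bound: "norm (\<Psi> A) \<le> K * norm A"
    and unital: "\<Psi> idop = idop"
    and loc: "\<exists>c. \<exists>\<tau>\<in>Aut. \<Psi> A = c *\<^sub>C \<tau> A"
    and e: "norm e = 1"
begin

abbreviation b :: "'h \<Rightarrow> 'h \<Rightarrow> 'h cblinop" where
  "b x y \<equiv> \<Psi> (rk x y)"

lemma b_add: "b (x + x') y = b x y + b x' y" "b x (y + y') = b x y + b x y'"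
  and b_scale: "b (c *\<^sub>C x) y = c *\<^sub>C b x y" "b x (c *\<^sub>C y) = cnj c *\<^sub>C b x y"
  by (simp_all add: rk_add_left rk_add_right rk_scaleC_left rk_scaleC_right
      clinear_add[OF clin] clinear_scaleC[OF clin])

lemma b_zero: "b 0 y = 0" "b x 0 = 0"
  using b_scale(1)[of 0 0 y] b_scale(2)[of x 0 0] by simp_all

lemma ee: "cinner e e = 1"
  using e by (simp add: cinner_self)

lemma e_nonzero: "e \<noteq> 0"
  using e by auto

text \<open>The images of \<open>P\<close> and \<open>idop - P\<close> are multiples of idempotents
  and add up to \<open>idop\<close>. Squaring \<open>a *\<^sub>C Q1 = idop - c *\<^sub>C Q2\<close>
  makes \<open>idop\<close> a multiple of \<open>Q2\<close> unless \<open>a = 1\<close>, and an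
  idempotent with that property is \<open>idop\<close> itself.\<close>

lemma \<Psi>_idempotent:
  assumes P: "P * P = P" "P \<noteq> 0" "P \<noteq> idop"
  shows "\<Psi> P * \<Psi> P = \<Psi> P" "\<Psi> P \<noteq> 0"
proof -
  obtain a \<tau> where \<tau>: "\<tau> \<in> Aut" "\<Psi> P = a *\<^sub>C \<tau> P"
    using loc by blast
  obtain c \<sigma> where \<sigma>: "\<sigma> \<in> Aut" "\<Psi> (idop - P) = c *\<^sub>C \<sigma> (idop - P)"
    using loc by blast
  define Q1 Q2 where "Q1 = \<tau> P" and "Q2 = \<sigma> (idop - P)"
  have Q1: "Q1 * Q1 = Q1" "Q1 \<noteq> 0"
    using P by (auto simp: Q1_def Aut_mult[OF \<tau>(1), symmetric] Aut_eq_0_iff[OF \<tau>(1)])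
  have "(idop - P) * (idop - P) = idop - P"
    by (simp add: algebra_simps P)
  then have Q2: "Q2 * Q2 = Q2"
    by (simp add: Q2_def Aut_mult[OF \<sigma>(1), symmetric])
  have "idop - Q2 = \<sigma> P"
    using clinear_diff[OF Aut_clinear[OF \<sigma>(1)], of idop P] by (simp add: Q2_def Aut_idop[OF \<sigma>(1)])
  then have Q2': "Q2 \<noteq> idop"
    using P(2) Aut_eq_0_iff[OF \<sigma>(1), of P] by auto
  have "\<Psi> (idop - P) = idop - \<Psi> P"
    by (simp add: clinear_diff[OF clin] unital)
  then have aQ1: "a *\<^sub>C Q1 = idop - c *\<^sub>C Q2"
    using \<tau>(2) \<sigma>(2) by (simp add: Q1_def Q2_def)
  have "a = 1"
  proof (rule ccontr)
    assume a: "a \<noteq> 1"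
    have "(a *\<^sub>C Q1) * (a *\<^sub>C Q1) = a *\<^sub>C (a *\<^sub>C Q1)"
      by (simp add: mult_scaleC_left mult_scaleC_right Q1)
    then have "(idop - c *\<^sub>C Q2) * (idop - c *\<^sub>C Q2) = a *\<^sub>C (idop - c *\<^sub>C Q2)"
      by (simp only: aQ1)
    then have "idop - c *\<^sub>C Q2 - (c *\<^sub>C Q2 - (c * c) *\<^sub>C Q2) = a *\<^sub>C idop - (a * c) *\<^sub>C Q2"
      by (simp add: left_diff_distrib right_diff_distrib mult_scaleC_left mult_scaleC_right Q2
          scaleC_scaleC complex_vector.scale_right_diff_distrib)
    moreover have "(c * 2) *\<^sub>C Q2 = c *\<^sub>C Q2 + c *\<^sub>C Q2"
      using scaleC_add_left[of c c Q2] by (simp add: mult.commute)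
    ultimately have "(1 - a) *\<^sub>C idop = (c + c - c * c - a * c) *\<^sub>C Q2"
      by (simp add: complex_vector.scale_left_diff_distrib scaleC_add_left scaleC_one algebra_simps)
    then have "inverse (1 - a) *\<^sub>C (1 - a) *\<^sub>C idop = inverse (1 - a) *\<^sub>C (c + c - c * c - a * c) *\<^sub>C Q2"
      by (rule arg_cong)
    then have d: "idop = (inverse (1 - a) * (c + c - c * c - a * c)) *\<^sub>C Q2"
      using a by (simp add: scaleC_scaleC scaleC_one)
    have "Q2 = idop * Q2" by simp
    also have "\<dots> = (inverse (1 - a) * (c + c - c * c - a * c)) *\<^sub>C Q2 * Q2"
      by (subst d) (rule refl)
    also have "\<dots> = idop"
      unfolding mult_scaleC_left Q2 by (rule d[symmetric])
    finally show False
      using Q2' by simp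
  qed
  then have "\<Psi> P = Q1"
    using \<tau>(2) by (simp add: Q1_def scaleC_one)
  with Q1 show "\<Psi> P * \<Psi> P = \<Psi> P" "\<Psi> P \<noteq> 0"
    by simp_all
qed

lemma b_idempotent:
  assumes "cinner x y = 1"
  shows "b x y * b x y = b x y" "b x y \<noteq> 0"
proof -
  obtain z where z: "norm z = 1" "\<forall>f\<in>{y}. cinner z f = 0"
    using orthogonal_to_finite_exists[OF inf, of "{y}"] by blast
  have "rk x y \<noteq> idop"
  proof
    assume "rk x y = idop"
    then have "rk x y \<cdot> z = idop \<cdot> z" by (rule arg_cong)
    with z show False by simp
  qed
  moreover have "rk x y \<noteq> 0"
    using assms by (auto simp: rk_eq_0)
  moreover have "rk x y * rk x y = rk x y"
    by (simp add: rk_mult_rk assms scaleC_one)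
  ultimately show "b x y * b x y = b x y" "b x y \<noteq> 0"
    by (simp_all add: \<Psi>_idempotent)
qed

text \<open>If \<open>cinner x y\<close> is nonzero, rescaling \<open>x\<close> gives an idempotent.
  If it vanishes, the squares known at \<open>x + y\<close>, \<open>x - y\<close> and
  \<open>y\<close> combine so that the mixed terms cancel and twice the square of
  \<open>b x y\<close> is zero.\<close>

lemma b_square: "b x y * b x y = cinner x y *\<^sub>C b x y"
proof -
  have nz: "b x y * b x y = cinner x y *\<^sub>C b x y" if "cinner x y \<noteq> 0" for x y
  proof -
    define x' where "x' = inverse (cinner x y) *\<^sub>C x"
    have x: "x = cinner x y *\<^sub>C x'" and "cinner x' y = 1"
      using that by (simp_all add: x'_def scaleC_scaleC scaleC_one cinner_scaleC_left)
    then have "b x' y * b x' y = b x' y"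
      using b_idempotent by blast
    then have "(cinner x y *\<^sub>C b x' y) * (cinner x y *\<^sub>C b x' y) = cinner x y *\<^sub>C cinner x y *\<^sub>C b x' y"
      by (simp add: mult_scaleC_left mult_scaleC_right)
    then show ?thesis
      unfolding b_scale(1)[symmetric] x[symmetric] .
  qed
  show ?thesis
  proof (cases "cinner x y = 0 \<and> y \<noteq> 0")
    case True
    define c where "c = cinner y y"
    have c: "c \<noteq> 0" "cinner (x + y) y = c" "cinner (x + (-1) *\<^sub>C y) y = - c"
      using True by (simp_all add: c_def cinner_algebra)
    have "b (x + y) y * b (x + y) y = c *\<^sub>C b (x + y) y"
      using nz[of "x + y" y] c by simp
    moreover have "b (x + (-1) *\<^sub>C y) y * b (x + (-1) *\<^sub>C y) y = (- c) *\<^sub>C b (x + (-1) *\<^sub>C y) y"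
      using nz[of "x + (-1) *\<^sub>C y" y] c by simp
    moreover have "b y y * b y y = c *\<^sub>C b y y"
      using nz[of y y] c by (simp add: c_def)
    ultimately have "b x y * b x y + (b x y * b y y + b y y * b x y) = c *\<^sub>C b x y"
      and "b x y * b y y + b y y * b x y = c *\<^sub>C b x y + b x y * b x y"
      unfolding b_add b_scale
      by (simp_all add: algebra_simps mult_scaleC_left mult_scaleC_right scaleC_add_right scaleC_one
          complex_vector.scale_minus_left)
    then have "2 *\<^sub>R (b x y * b x y) = 0"
      by (simp add: scaleR_2)
    then show ?thesis
      using True by simp
  next
    case False
    then show ?thesis
      using nz[of x y] by (cases "y = 0") (simp_all add: b_zero)
  qed
qed

section \<open>Linearized forms of the square identity and orthogonality relations\<close>

lemma polarize_left:
  "b x y * b x' y + b x' y * b x y = cinner x y *\<^sub>C b x' y + cinner x' y *\<^sub>C b x y"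
  using b_square[of "x + x'" y] b_square[of x y] b_square[of x' y]
  by (simp add: b_add cinner_add_left scaleC_add_left scaleC_add_right distrib_left distrib_right add_ac)

lemma polarize_right:
  "b x y * b x y' + b x y' * b x y = cinner x y *\<^sub>C b x y' + cinner x y' *\<^sub>C b x y"
  using b_square[of x "y + y'"] b_square[of x y] b_square[of x y']
  by (simp add: b_add cinner_add_right scaleC_add_left scaleC_add_right distrib_left distrib_right add_ac)

lemma polarize:
  "b x y * b x' y' + b x y' * b x' y + b x' y * b x y' + b x' y' * b x y
    = cinner x y *\<^sub>C b x' y' + cinner x y' *\<^sub>C b x' y + cinner x' y *\<^sub>C b x y' + cinner x' y' *\<^sub>C b x y"
  (is "?L = ?R")
proof -
  have "?L = (b x (y + y') * b x' (y + y') + b x' (y + y') * b x (y + y'))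
    - (b x y * b x' y + b x' y * b x y) - (b x y' * b x' y' + b x' y' * b x y')"
    by (simp add: b_add algebra_simps)
  also have "\<dots> = ?R"
    unfolding polarize_left by (simp add: b_add cinner_add_right scaleC_add_left scaleC_add_right)
  finally show ?thesis .
qed

lemma Q_idempotent: "b e e * b e e = b e e" "b e e \<noteq> 0"
  using b_idempotent[OF ee] .

text \<open>If \<open>cinner x y = 1\<close>, then \<open>rk e e + rk x y\<close> is idempotent and
  so is its image. Hence the two images anticommute, and anticommuting with an idempotent forces
  both products to vanish. Rescaling, and writing \<open>x\<close> as \<open>(x + y) - y\<close>,
  covers the rest.\<close>

lemma Q_orthogonal:
  assumes x: "cinner x e = 0" and y: "cinner y e = 0"
  shows "b e e * b x y = 0 \<and> b x y * b e e = 0"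
proof -
  have one: "b e e * b x y = 0 \<and> b x y * b e e = 0"
    if x: "cinner x e = 0" and y: "cinner y e = 0" and xy: "cinner x y = 1" for x y
  proof -
    have y': "cinner e y = 0"
      using y cinner_eq_0_commute by blast
    define S where "S = rk e e + rk x y"
    have "S * S = S"
      by (simp add: S_def distrib_left distrib_right rk_mult_rk ee x y' xy scaleC_one)
    moreover have "S \<noteq> 0"
    proof
      assume "S = 0"
      then have "S \<cdot> e = 0" by simp
      then show False
        using e_nonzero by (simp add: S_def ee y' scaleC_one)
    qed
    moreover have "S \<noteq> idop"
    proof
      assume "S = idop"
      obtain z where z: "norm z = 1" "\<forall>f\<in>{e, y}. cinner z f = 0"
        using orthogonal_to_finite_exists[OF inf, of "{e, y}"] by blast
      have "S \<cdot> z = z"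
        by (simp add: \<open>S = idop\<close>)
      with z show False
        by (simp add: S_def)
    qed
    ultimately have "\<Psi> S * \<Psi> S = \<Psi> S"
      by (rule \<Psi>_idempotent)
    then have anti: "b e e * b x y + b x y * b e e = 0"
      using Q_idempotent(1) b_idempotent(1)[OF xy]
      by (simp add: S_def clinear_add[OF clin] distrib_left distrib_right add.commute)
    have Q: "b e e * (b e e * A) = b e e * A" for A
      using Q_idempotent(1) by (simp add: mult.assoc[symmetric])
    have "b e e * b x y + b e e * (b x y * b e e) = 0"
      using arg_cong[OF anti, of "\<lambda>A. b e e * A"] by (simp add: distrib_left Q)
    moreover have "b e e * (b x y * b e e) + b x y * b e e = 0"
      using arg_cong[OF anti, of "\<lambda>A. A * b e e"] by (simp add: distrib_right mult.assoc Q_idempotent(1))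
    ultimately have eq: "b e e * b x y = b x y * b e e"
      by (metis add.commute add_left_cancel)
    with anti have "2 *\<^sub>R (b e e * b x y) = 0"
      by (simp add: scaleR_2)
    with eq show ?thesis by simp
  qed
  have nz: "b e e * b x y = 0 \<and> b x y * b e e = 0"
    if x: "cinner x e = 0" and y: "cinner y e = 0" and xy: "cinner x y \<noteq> 0" for x y
  proof -
    define x' where "x' = inverse (cinner x y) *\<^sub>C x"
    have x': "x = cinner x y *\<^sub>C x'" and "cinner x' y = 1" "cinner x' e = 0"
      using xy x by (simp_all add: x'_def scaleC_scaleC scaleC_one cinner_scaleC_left)
    then have "b e e * b x' y = 0 \<and> b x' y * b e e = 0"
      using one y by blast
    then have "b e e * (cinner x y *\<^sub>C b x' y) = 0 \<and> (cinner x y *\<^sub>C b x' y) * b e e = 0"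
      by (simp add: mult_scaleC_left mult_scaleC_right)
    then show ?thesis
      unfolding b_scale(1)[symmetric] x'[symmetric] .
  qed
  show ?thesis
  proof (cases "cinner x y = 0 \<and> y \<noteq> 0")
    case True
    have "b e e * b (x + y) y = 0 \<and> b (x + y) y * b e e = 0" "b e e * b y y = 0 \<and> b y y * b e e = 0"
      using True x y nz[of "x + y" y] nz[of y y] by (simp_all add: cinner_add_left)
    then show ?thesis
      by (simp add: b_add distrib_left distrib_right)
  next
    case False
    then show ?thesis
      using nz[OF x y] by (cases "y = 0") (simp_all add: b_zero)
  qed
qed

lemma b_rank_le1: "rank_le1 (b x y)"
proof -
  obtain c \<tau> where "\<tau> \<in> Aut" "b x y = c *\<^sub>C \<tau> (rk x y)"
    using loc by blast
  then show ?thesis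
    by (simp add: rank_le1_scaleC Aut_rank_le1 rank_le1_rk)
qed

lemma QN_anticommute: "cinner x e = 0 \<Longrightarrow> b e e * b x e + b x e * b e e = b x e"
  using polarize_left[of e e x] by (simp add: ee scaleC_one)

lemma QM_anticommute: "cinner y e = 0 \<Longrightarrow> b e e * b e y + b e y * b e e = b e y"
  using polarize_right[of e e y] by (simp add: ee scaleC_one cinner_eq_0_commute[of e y])

lemma NM_anticommute:
  assumes "cinner x e = 0" "cinner y e = 0"
  shows "b x e * b e y + b e y * b x e = b x y + cinner x y *\<^sub>C b e e"
  using polarize[of e e x y] Q_orthogonal[OF assms] assms
  by (simp add: ee scaleC_one cinner_eq_0_commute[of e y] add.commute)

text \<open>For each \<open>x\<close> orthogonal to \<open>e\<close> one of two linear conditions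
  holds; a vector space is not the union of two proper subspaces, so one condition holds for all
  such \<open>x\<close>. It decides whether \<open>corner_relations\<close> applies to the product
  or to its opposite.\<close>

lemma dichotomy:
  "(\<forall>x y. b x e * b e y = b x y \<and> b e y * b x e = cinner x y *\<^sub>C b e e) \<or>
   (\<forall>x y. b e y * b x e = b x y \<and> b x e * b e y = cinner x y *\<^sub>C b e e)"
proof -
  have disj: "b e e * b x e = 0 \<or> b x e * b e e = 0" if "cinner x e = 0" for x
    by (rule rank_le1_corner[OF b_rank_le1 Q_idempotent(1) QN_anticommute[OF that]])
  have disjM: "b e e * b e y = 0 \<or> b e y * b e e = 0" if "cinner y e = 0" for y
    by (rule rank_le1_corner[OF b_rank_le1 Q_idempotent(1) QM_anticommute[OF that]])
  have "(\<forall>x. cinner x e = 0 \<longrightarrow> b e e * b x e = 0) \<or> (\<forall>x. cinner x e = 0 \<longrightarrow> b x e * b e e = 0)"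
  proof (rule ccontr)
    assume "\<not> ?thesis"
    then obtain x y where x: "cinner x e = 0" "b e e * b x e \<noteq> 0" and y: "cinner y e = 0" "b y e * b e e \<noteq> 0"
      by blast
    then have "b x e * b e e = 0" "b e e * b y e = 0"
      using disj by blast+
    with x y disj[of "x + y"] show False
      by (simp add: b_add distrib_left distrib_right cinner_add_left)
  qed
  then show ?thesis
  proof
    assume QN: "\<forall>x. cinner x e = 0 \<longrightarrow> b e e * b x e = 0"
    have NQ: "b x e * b e e = b x e" if "cinner x e = 0" for x
      using QN_anticommute[OF that] QN that by simp
    have swap: "b e y * b e e = 0 \<or> b e e * b e y = 0" "b e y * b e e + b e e * b e y = b e y"
      if "cinner y e = 0" for y
      using disjM[OF that] QM_anticommute[OF that] by (auto simp: add.commute)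
    have "b x e * b e y = b x y" "b e y * b x e = cinner x y *\<^sub>C b e e" for x y
      by (rule corner_relations[where t = "(*)" and b = b and e = e];
          (rule mult.assoc distrib_left distrib_right mult_scaleC_left mult_scaleC_right b_add b_scale e Q_idempotent
            | rule QN[rule_format] NQ swap NM_anticommute Q_orthogonal[THEN conjunct1]; assumption))+
    then show ?thesis by blast
  next
    assume NQ: "\<forall>x. cinner x e = 0 \<longrightarrow> b x e * b e e = 0"
    have QN: "b e e * b x e = b x e" if "cinner x e = 0" for x
      using QN_anticommute[OF that] NQ that by simp
    have swap: "b e y * b x e + b x e * b e y = b x y + cinner x y *\<^sub>C b e e"
      if "cinner x e = 0" "cinner y e = 0" for x y
      using NM_anticommute[OF that] by (simp add: add.commute)
    have "b e y * b x e = b x y" "b x e * b e y = cinner x y *\<^sub>C b e e" for x y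
      by (rule corner_relations[where t = "\<lambda>A B. B * A" and b = b and e = e];
          (rule mult.assoc[symmetric] distrib_left distrib_right mult_scaleC_left mult_scaleC_right b_add b_scale e Q_idempotent
            | rule NQ[rule_format] QN disjM QM_anticommute swap Q_orthogonal[THEN conjunct2]; assumption))+
    then show ?thesis by blast
  qed
qed

section \<open>Norm bounds, and the effect of \<open>\<Psi>\<close> on noninjective
  operators\<close>

lemma K_ge_1: "K \<ge> 1"
proof -
  have "(idop :: 'h cblinop) \<noteq> 0"
    using e_nonzero by (metis idop_apply cblinop_apply_zero)
  then have "norm (idop :: 'h cblinop) > 0" by simp
  moreover have "norm (idop :: 'h cblinop) \<le> K * norm (idop :: 'h cblinop)"
    using bound[of idop] by (simp add: unital)
  ultimately show ?thesis by simp
qed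

lemma norm_b_le: "norm (b x y) \<le> K * (norm x * norm y)"
  using bound[of "rk x y"] mult_left_mono[OF norm_rk_le[of x y], of K] K_ge_1 by linarith

lemma bounded_linear_\<Psi>: "bounded_linear \<Psi>"
  using bound by (intro bounded_clinear_bounded_linear bounded_clinearI[OF clin, of K]) (simp add: mult.commute)

lemma bounded_linear_b_right: "bounded_linear (\<lambda>y. b x y)"
proof (rule bounded_linear_intro)
  show "norm (b x y) \<le> norm y * (K * norm x)" for y
    using norm_b_le[of x y] by (simp add: mult_ac)
qed (simp_all add: b_add b_scale flip: scaleC_of_real)

text \<open>Only this direction survives the unknown scalar in \<open>loc\<close>, which may be
  zero.\<close>

lemma \<Psi>_noninjective:
  assumes "noninjective A" shows "noninjective (\<Psi> A)"
proof -
  obtain c \<tau> where \<tau>: "\<tau> \<in> Aut" "\<Psi> A = c *\<^sub>C \<tau> A"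
    using loc by blast
  then have "noninjective (\<tau> A)"
    using assms Aut_noninjective_iff by blast
  then obtain z where "z \<noteq> 0" "\<tau> A \<cdot> z = 0"
    by (auto simp: noninjective_def)
  with \<tau>(2) show ?thesis
    by (intro noninjectiveI[of _ z]) simp_all
qed

text \<open>Such a \<open>\<Psi>\<close> acts like a transpose: on the elements \<open>b e z\<close>
  the image of \<open>P * A\<close> acts as \<open>A\<close> after \<open>P\<close>, which kills
  \<open>g\<close>. But \<open>P * A\<close> is injective, because \<open>P\<close> kills only
  multiples of \<open>g\<close> and \<open>g\<close> is not in the range of \<open>A\<close>. So the
  image of \<open>P * A\<close> must be zero, and injectivity of \<open>A\<close> would give
  \<open>P = 0\<close>.\<close>

lemma not_antimultiplicative:
  assumes "\<forall>x y. b e y * b x e = b x y \<and> b x e * b e y = cinner x y *\<^sub>C b e e"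
  shows False
proof -
  obtain d :: "nat \<Rightarrow> 'h" and A g where A: "(\<lambda>n. rk (d n) (d n)) sums A" "\<And>z. A \<cdot> z = 0 \<Longrightarrow> z = 0"
    and g: "norm g = 1" "g \<notin> range (cblinop_apply A)"
    using injective_nonsurjective_operator[OF inf sep] by metis
  have MN: "b x y = b e y * b x e" and NM: "b x e * b e y = cinner x y *\<^sub>C b e e" for x y
    using assms by auto
  have MQ: "b e y * b e e = b e y" for y
    using MN[of e y] by simp
  have M_nonzero: "b e y \<noteq> 0" if "y \<noteq> 0" for y
    using NM[of y y] that Q_idempotent(2) by auto
  have gg: "cinner g g = 1"
    using g(1) by (simp add: cinner_self)
  define P where "P = idop - rk g g"
  have Pg: "P \<cdot> g = 0"
    by (simp add: P_def gg scaleC_one)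
  have adj: "cinner (P \<cdot> x) z = cinner x (P \<cdot> z)" for x z
    using cinner_commute[of z g] by (simp add: P_def cinner_algebra mult.commute)
  \<comment> \<open>The relations concern rank one operators only; they are applied to each summand
    of \<open>A\<close> and carried through the series by continuity of
    \<open>\<Psi>\<close>.\<close>
  have series: "\<Psi> (P * A) * b e z = b e (A \<cdot> (P \<cdot> z))" for z
  proof (rule sums_unique2)
    show "(\<lambda>n. \<Psi> (P * rk (d n) (d n)) * b e z) sums (\<Psi> (P * A) * b e z)"
      by (intro bounded_linear.sums[OF bounded_linear_mult_left] bounded_linear.sums[OF bounded_linear_\<Psi>]
          bounded_linear.sums[OF bounded_linear_mult_right] A)
    have "(\<lambda>n. b e (rk (d n) (d n) \<cdot> (P \<cdot> z))) sums b e (A \<cdot> (P \<cdot> z))"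
      by (intro bounded_linear.sums[OF bounded_linear_b_right] bounded_linear.sums[OF bounded_linear_cblinop_eval] A)
    moreover have "b e (rk (d n) (d n) \<cdot> (P \<cdot> z)) = \<Psi> (P * rk (d n) (d n)) * b e z" for n
    proof -
      have "\<Psi> (P * rk (d n) (d n)) * b e z = b e (d n) * (b (P \<cdot> d n) e * b e z)"
        unfolding mult_rk MN[of "P \<cdot> d n" "d n"] by (simp only: mult.assoc)
      also have "\<dots> = cinner (P \<cdot> d n) z *\<^sub>C b e (d n)"
        by (simp only: NM mult_scaleC_right MQ)
      also have "\<dots> = b e (rk (d n) (d n) \<cdot> (P \<cdot> z))"
        by (simp add: b_scale adj cinner_commute[of "d n"])
      finally show ?thesis ..
    qed
    ultimately show "(\<lambda>n. \<Psi> (P * rk (d n) (d n)) * b e z) sums b e (A \<cdot> (P \<cdot> z))"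
      by simp
  qed
  have PA: "\<not> noninjective (P * A)"
  proof
    assume "noninjective (P * A)"
    then obtain z where z: "z \<noteq> 0" "P \<cdot> (A \<cdot> z) = 0"
      by (auto simp: noninjective_def)
    define c where "c = cinner (A \<cdot> z) g"
    have Az: "A \<cdot> z = c *\<^sub>C g"
      using z(2) by (simp add: P_def c_def)
    with A(2) z(1) have "c \<noteq> 0" by auto
    then have "g = A \<cdot> (inverse c *\<^sub>C z)"
      by (simp add: cblinop_apply_scaleC_right Az scaleC_scaleC scaleC_one)
    with g(2) show False by blast
  qed
  obtain c \<tau> where \<tau>: "\<tau> \<in> Aut" "\<Psi> (P * A) = c *\<^sub>C \<tau> (P * A)"
    using loc by blast
  have "\<Psi> (P * A) * b e g = 0"
    by (simp add: series Pg b_zero)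
  moreover have "b e g \<noteq> 0"
    using g(1) by (intro M_nonzero) auto
  ultimately have "noninjective (\<Psi> (P * A))"
    using noninjective_iff_zero_divisor by blast
  then have "c = 0"
    using \<tau> PA Aut_noninjective_iff[OF \<tau>(1), of "P * A"] by (auto simp: noninjective_def)
  then have "b e (A \<cdot> (P \<cdot> z)) = 0" for z
    using series[of z] \<tau>(2) by simp
  then have "P \<cdot> z = 0" for z
    using M_nonzero A(2) by blast
  moreover obtain z where z: "norm z = 1" "\<forall>f\<in>{g}. cinner z f = 0"
    using orthogonal_to_finite_exists[OF inf, of "{g}"] by blast
  moreover have "P \<cdot> z = z"
    using z by (simp add: P_def)
  ultimately show False by simp
qed

lemma \<Psi>_shift: "\<Psi> (A + c *\<^sub>C idop) = \<Psi> A + c *\<^sub>C idop"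
  by (simp add: clinear_add[OF clin] clinear_scaleC[OF clin] unital)

text \<open>If \<open>\<Psi> A\<close> is injective and \<open>cinner x y = 1\<close>, then \<open>A - rk (A \<cdot> x) y\<close> annihilates \<open>x\<close>, so that
  \<open>\<Psi>\<close> of it annihilates some \<open>T w\<close>. By injectivity \<open>w\<close> does not depend on \<open>y\<close>, which
  forces \<open>w = x\<close>.\<close>

lemma intertwining:
  assumes T: "bij (cblinop_apply T)" and b: "\<And>x y z. b x y \<cdot> (T \<cdot> z) = cinner z y *\<^sub>C (T \<cdot> x)"
  shows "\<Psi> A * T = T * A"
proof -
  have T_eq: "T \<cdot> x = T \<cdot> y \<longleftrightarrow> x = y" for x y
    using T by (auto simp: bij_def inj_def)
  have T0: "T \<cdot> x = 0 \<longleftrightarrow> x = 0" for x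
    using T_eq[of x 0] by simp
  have inj_case: "\<Psi> A \<cdot> (T \<cdot> x) = T \<cdot> (A \<cdot> x)" if A: "\<not> noninjective (\<Psi> A)" for A x
  proof (cases "x = 0")
    case False
    have A0: "u = v" if "\<Psi> A \<cdot> u = \<Psi> A \<cdot> v" for u v
      using A noninjectiveI[of "\<Psi> A" "u - v"] that by (auto simp: cblinop_apply_diff_right)
    have ex: "\<exists>w. \<Psi> A \<cdot> (T \<cdot> w) = T \<cdot> (A \<cdot> x) \<and> cinner w y = 1" if y: "cinner x y = 1" for y
    proof -
      have "(A - rk (A \<cdot> x) y) \<cdot> x = 0"
        by (simp add: y scaleC_one)
      then have "noninjective (\<Psi> (A - rk (A \<cdot> x) y))"
        using False by (intro \<Psi>_noninjective noninjectiveI)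
      then obtain v where v: "v \<noteq> 0" "\<Psi> (A - rk (A \<cdot> x) y) \<cdot> v = 0"
        by (auto simp: noninjective_def)
      obtain w where w: "v = T \<cdot> w"
        using T by (metis bij_pointE)
      have eq: "\<Psi> A \<cdot> (T \<cdot> w) = cinner w y *\<^sub>C (T \<cdot> (A \<cdot> x))"
        using v(2) by (simp add: clinear_diff[OF clin] w b)
      have "cinner w y \<noteq> 0"
      proof
        assume "cinner w y = 0"
        then have "\<Psi> A \<cdot> v = \<Psi> A \<cdot> 0"
          using eq w by simp
        with A0 v(1) show False by blast
      qed
      then have "\<Psi> A \<cdot> (T \<cdot> (inverse (cinner w y) *\<^sub>C w)) = T \<cdot> (A \<cdot> x)"
        and "cinner (inverse (cinner w y) *\<^sub>C w) y = 1"
        by (simp_all add: cblinop_apply_scaleC_right eq scaleC_scaleC scaleC_one cinner_scaleC_left)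
      then show ?thesis by blast
    qed
    \<comment> \<open>The multiple of \<open>x\<close> with \<open>cinner x y0 = 1\<close>. As
      \<open>w - x\<close> turns out orthogonal to \<open>x\<close>, adding it to \<open>y0\<close>
      gives another admissible \<open>y\<close>; comparing the two yields
      \<open>w - x = 0\<close>.\<close>
    define y0 where "y0 = inverse (cinner x x) *\<^sub>C x"
    have cx: "cinner x x \<noteq> 0" "cnj (cinner x x) = cinner x x"
      using False by (simp_all add: cinner_commute[symmetric])
    have y0: "cinner z y0 = inverse (cinner x x) * cinner z x" for z
      by (simp add: y0_def cinner_scaleC_right cx)
    obtain w where w: "\<Psi> A \<cdot> (T \<cdot> w) = T \<cdot> (A \<cdot> x)" "cinner w y0 = 1"
      using ex[of y0] cx by (auto simp: y0)
    have all: "cinner w y = 1" if y: "cinner x y = 1" for y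
    proof -
      obtain w' where w': "\<Psi> A \<cdot> (T \<cdot> w') = T \<cdot> (A \<cdot> x)" "cinner w' y = 1"
        using ex[OF y] by blast
      have "T \<cdot> w' = T \<cdot> w"
        by (rule A0) (simp add: w(1) w'(1))
      with w'(2) show ?thesis by (simp add: T_eq)
    qed
    define v where "v = w - x"
    have "cinner w x = cinner x x"
      using w(2) cx by (simp add: y0 field_simps)
    then have vx: "cinner v x = 0"
      by (simp add: v_def cinner_diff_left)
    then have xv: "cinner x v = 0"
      using cinner_eq_0_commute by blast
    have "cinner w (y0 + v) = 1"
      by (rule all) (simp add: cinner_add_right y0 False xv left_inverse)
    then have "cinner w v = 0"
      using w(2) by (simp add: cinner_add_right)
    then have "cinner v v = 0"
      using xv by (subst v_def) (simp add: cinner_diff_left)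
    then have "w = x"
      by (simp add: v_def)
    with w(1) show ?thesis by simp
  qed simp
  show ?thesis
  proof (rule cblinop_eqI)
    fix x
    \<comment> \<open>A scalar above \<open>norm (\<Psi> A)\<close> makes the shifted image
      injective, and the shift changes both sides by the same multiple of \<open>T\<close>.\<close>
    define c where "c = complex_of_real (norm (\<Psi> A) + 1)"
    have "\<not> noninjective (\<Psi> (A + c *\<^sub>C idop))"
    proof
      assume "noninjective (\<Psi> (A + c *\<^sub>C idop))"
      then obtain z where z: "z \<noteq> 0" "(\<Psi> A \<cdot> z) + c *\<^sub>C z = 0"
        by (auto simp: noninjective_def \<Psi>_shift)
      then have "norm (\<Psi> A \<cdot> z) = norm (c *\<^sub>C z)"
        by (metis add_eq_0_iff norm_minus_cancel)
      also have "\<dots> = (norm (\<Psi> A) + 1) * norm z"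
        unfolding norm_scaleC c_def norm_of_real by simp
      finally show False
        using norm_cblinop_apply_le[of "\<Psi> A" z] z(1) by (simp add: algebra_simps)
    qed
    from inj_case[OF this, of x] show "(\<Psi> A * T) \<cdot> x = (T * A) \<cdot> x"
      by (simp add: \<Psi>_shift cblinop_apply_add_right cblinop_apply_scaleC_right)
  qed
qed

text \<open>\<open>b x e\<close> acts like a matrix column, so \<open>T\<close> sends
  \<open>x\<close> to its value at a unit vector \<open>u\<close> fixed by \<open>b e e\<close>.
  Applying \<open>b e x\<close> to \<open>T \<cdot> x\<close> recovers \<open>norm x\<close> and
  bounds \<open>T\<close> from below. The range is then closed, and it is everything: a vector
  orthogonal to it would give an operator annihilating \<open>\<Psi> A\<close> for some
  \<open>A\<close> of dense range.\<close>

lemma spatial: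
  obtains T T' where "T * T' = idop" "T' * T = idop" "norm T \<le> K" "norm T' \<le> K"
    "\<And>A. \<Psi> A = T * A * T'"
proof -
  have NM: "b x e * b e y = b x y" and MN: "b e y * b x e = cinner x y *\<^sub>C b e e" for x y
    using dichotomy not_antimultiplicative by blast+
  have NQ: "b x e * b e e = b x e" for x
    by (rule NM)
  obtain v where v: "b e e \<cdot> v \<noteq> 0"
    using Q_idempotent(2) cblinop_neq_0D by blast
  define u where "u = complex_of_real (inverse (norm (b e e \<cdot> v))) *\<^sub>C (b e e \<cdot> v)"
  have "norm u = 1"
    using v by (simp add: u_def norm_scaleC del: of_real_inverse)
  then have u0: "u \<noteq> 0" by auto
  have "b e e \<cdot> (b e e \<cdot> v) = b e e \<cdot> v"
    using Q_idempotent(1) by (metis cblinop_apply_times)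
  then have Qu: "b e e \<cdot> u = u"
    by (simp add: u_def cblinop_apply_scaleC_right)
  define T where "T = cblinop_of (\<lambda>x. b x e \<cdot> u)"
  have norm_T_le: "norm (b x e \<cdot> u) \<le> norm x * K" for x
    using norm_cblinop_apply_le[of "b x e" u] norm_b_le[of x e] by (simp add: e \<open>norm u = 1\<close> mult.commute)
  have T: "T \<cdot> x = b x e \<cdot> u" for x
    unfolding T_def
    by (rule cblinop_of_apply, rule bounded_clinearI[OF _ norm_T_le]) (simp add: clinear_def b_add b_scale)
  have MT: "b e y \<cdot> (T \<cdot> x) = cinner x y *\<^sub>C u" for x y
  proof -
    have "b e y \<cdot> (T \<cdot> x) = (b e y * b x e) \<cdot> u"
      by (simp add: T)
    then show ?thesis
      by (simp only: MN cblinop_apply_scaleC Qu)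
  qed
  have bT: "b x y \<cdot> (T \<cdot> z) = cinner z y *\<^sub>C (T \<cdot> x)" for x y z
  proof -
    have "b x y \<cdot> (T \<cdot> z) = b x e \<cdot> (b e y \<cdot> (T \<cdot> z))"
      by (simp only: NM[of x y, symmetric] cblinop_apply_times)
    then show ?thesis
      by (simp only: MT cblinop_apply_scaleC_right) (simp only: T)
  qed
  have below: "norm x \<le> K * norm (T \<cdot> x)" for x
  proof (cases "x = 0")
    case False
    have "norm x * norm x = norm (b e x \<cdot> (T \<cdot> x))"
      by (simp add: MT cinner_self norm_scaleC \<open>norm u = 1\<close> norm_power power2_eq_square norm_mult)
    also have "\<dots> \<le> norm (b e x) * norm (T \<cdot> x)"
      by (rule norm_cblinop_apply_le)
    also have "\<dots> \<le> K * norm x * norm (T \<cdot> x)"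
      using norm_b_le[of e x] by (intro mult_right_mono) (simp_all add: e)
    finally show ?thesis
      using False by simp
  qed (use K_ge_1 in simp)
  have inj: "inj (cblinop_apply T)"
  proof (rule injI)
    fix x y assume "T \<cdot> x = T \<cdot> y"
    then show "x = y"
      using below[of "x - y"] by (simp add: cblinop_apply_diff_right)
  qed
  have closed: "closed (range (cblinop_apply T))"
  proof (rule complete_imp_closed, rule complete_isometric_image[of "inverse K"])
    show "\<forall>x\<in>UNIV. inverse K * norm x \<le> norm (T \<cdot> x)"
      using below K_ge_1 by (simp add: field_simps)
  qed (use K_ge_1 in \<open>auto simp: bounded_linear_cblinop_apply complete_UNIV\<close>)
  have sub: "0 \<in> range (cblinop_apply T)"
    "\<And>x y. x \<in> range (cblinop_apply T) \<Longrightarrow> y \<in> range (cblinop_apply T) \<Longrightarrow> x + y \<in> range (cblinop_apply T)"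
    "\<And>c x. x \<in> range (cblinop_apply T) \<Longrightarrow> c *\<^sub>C x \<in> range (cblinop_apply T)"
    by (rule range_eqI[of _ _ 0])
      (auto simp flip: cblinop_apply_add_right cblinop_apply_scaleC_right)
  \<comment> \<open>\<open>b x y\<close> factors through \<open>b e e\<close>, all of whose values
    are multiples of \<open>u\<close>.\<close>
  have b_range: "b x y \<cdot> z \<in> range (cblinop_apply T)" for x y z
  proof -
    obtain c where c: "b e e \<cdot> (b e y \<cdot> z) = c *\<^sub>C u"
      using rank_le1_idempotent_range[OF b_rank_le1 Qu u0] .
    have "b x y \<cdot> z = (b x e * b e e * b e y) \<cdot> z"
      by (simp only: NM NQ)
    also have "\<dots> = T \<cdot> (c *\<^sub>C x)"
      by (simp add: c cblinop_apply_scaleC_right T)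
    finally show ?thesis by simp
  qed
  have "range (cblinop_apply T) = UNIV"
  proof (rule ccontr)
    assume "range (cblinop_apply T) \<noteq> UNIV"
    then obtain g where g: "g \<noteq> 0" "\<And>x. x \<in> range (cblinop_apply T) \<Longrightarrow> cinner x g = 0"
      using orthogonal_vector_exists[OF closed sub] by blast
    obtain d :: "nat \<Rightarrow> 'h" and A where A: "(\<lambda>n. rk (d n) (d n)) sums A" "\<And>z. A \<cdot> z = 0 \<Longrightarrow> z = 0"
      "\<And>F. F * A = 0 \<Longrightarrow> F = 0"
      using injective_nonsurjective_operator[OF inf sep] by metis
    have "(\<lambda>n. rk g g * b (d n) (d n)) sums (rk g g * \<Psi> A)"
      by (intro bounded_linear.sums[OF bounded_linear_mult_right] bounded_linear.sums[OF bounded_linear_\<Psi>] A)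
    moreover have "rk g g * b (d n) (d n) = 0" for n
      by (rule cblinop_eqI) (simp add: g(2) b_range)
    ultimately have gA: "rk g g * \<Psi> A = 0"
      by (simp add: sums_iff)
    obtain c \<tau> where \<tau>: "\<tau> \<in> Aut" "\<Psi> A = c *\<^sub>C \<tau> A"
      using loc by blast
    \<comment> \<open>This excludes \<open>c = 0\<close>, so that \<open>gA\<close> can be pulled
      back through \<open>\<tau>\<close>.\<close>
    have "\<Psi> A \<noteq> 0"
    proof
      assume "\<Psi> A = 0"
      have "(\<lambda>n. b (d n) (d n) \<cdot> (T \<cdot> e)) sums (\<Psi> A \<cdot> (T \<cdot> e))"
        by (intro bounded_linear.sums[OF bounded_linear_cblinop_eval] bounded_linear.sums[OF bounded_linear_\<Psi>] A)
      moreover have "(\<lambda>n. T \<cdot> (rk (d n) (d n) \<cdot> e)) sums (T \<cdot> (A \<cdot> e))"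
        by (intro bounded_linear.sums[OF bounded_linear_cblinop_apply] bounded_linear.sums[OF bounded_linear_cblinop_eval] A)
      moreover have "T \<cdot> (rk (d n) (d n) \<cdot> e) = b (d n) (d n) \<cdot> (T \<cdot> e)" for n
        by (simp add: bT cblinop_apply_scaleC_right)
      ultimately have "T \<cdot> (A \<cdot> e) = T \<cdot> 0"
        using sums_unique2 by (fastforce simp: \<open>\<Psi> A = 0\<close>)
      then have "A \<cdot> e = 0"
        using inj by (simp only: inj_eq)
      with A(2) e_nonzero show False by blast
    qed
    then have "c \<noteq> 0"
      using \<tau>(2) by auto
    with gA \<tau>(2) have "rk g g * \<tau> A = 0"
      by (simp add: mult_scaleC_right)
    moreover obtain F where F: "rk g g = \<tau> F"
      using Aut_surjE[OF \<tau>(1)] .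
    ultimately have "F * A = 0"
      by (simp add: Aut_mult[OF \<tau>(1), symmetric] Aut_eq_0_iff[OF \<tau>(1)])
    then have "rk g g = 0"
      by (simp add: A(3) F Aut_eq_0_iff[OF \<tau>(1)])
    with g(1) show False
      by (simp add: rk_eq_0)
  qed
  then have bij: "bij (cblinop_apply T)"
    using inj by (simp add: bij_def)
  define f where "f = inv (cblinop_apply T)"
  have Tf: "T \<cdot> f z = z" and fT: "f (T \<cdot> z) = z" for z
    using bij by (simp_all add: f_def bij_def surj_f_inv_f inv_f_f)
  have f_eq: "f x = y" if "x = T \<cdot> y" for x y
    using that fT by simp
  have norm_f: "norm (f x) \<le> norm x * K" for x
    using below[of "f x"] by (simp add: Tf mult.commute)
  define T' where "T' = cblinop_of f"
  have T': "T' \<cdot> x = f x" for x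
    unfolding T'_def
  proof (rule cblinop_of_apply, rule bounded_clinearI[OF _ norm_f])
    have "f (x + y) = f x + f y" "f (c *\<^sub>C x) = c *\<^sub>C f x" for x y c
      by (rule f_eq, simp add: Tf cblinop_apply_add_right cblinop_apply_scaleC_right)+
    then show "clinear f"
      by (simp add: clinear_def)
  qed
  show thesis
  proof (rule that)
    show TT': "T * T' = idop" "T' * T = idop"
      by (auto intro!: cblinop_eqI simp: T' Tf fT)
    show "norm T \<le> K"
      using K_ge_1 norm_T_le by (intro norm_cblinop_le) (simp_all add: T mult.commute)
    show "norm T' \<le> K"
      using K_ge_1 norm_f by (intro norm_cblinop_le) (simp_all add: T' mult.commute)
    show "\<Psi> A = T * A * T'" for A
    proof -
      have "\<Psi> A = \<Psi> A * T * T'"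
        by (simp add: mult.assoc TT')
      then show ?thesis
        by (simp only: intertwining[OF bij bT])
    qed
  qed
qed

end


section \<open>Functions vanishing at infinity\<close>

lemmas c0_rep_eqs = plus_c0.rep_eq minus_c0.rep_eq times_c0.rep_eq scaleC_c0.rep_eq zero_c0.rep_eq

lemma c0_apply_c0_of_fun:
  "continuous_on UNIV f \<Longrightarrow> vanishes_at_infinity f \<Longrightarrow> c0_apply (c0_of_fun f) = f"
  by (simp add: c0_of_fun_inverse)

lemma bounded_linear_c0_eval: "bounded_linear (\<lambda>F. c0_apply F x)"
proof (rule bounded_linear_intro)
  show "norm (c0_apply F x) \<le> norm F * 1" for F
    using norm_c0_apply_le[of F x] by simp
qed (simp_all add: plus_c0.rep_eq scaleR_c0.rep_eq)

lemma c0_apply_sum: "c0_apply (sum f S) x = (\<Sum>i\<in>S. c0_apply (f i) x)"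
  by (induction S rule: infinite_finite_induct) (simp_all add: c0_rep_eqs)

text \<open>Meaningful for bounded linear \<open>l\<close>, where the composite is again continuous
  and vanishes at infinity.\<close>

definition c0_map :: "('v::real_normed_vector \<Rightarrow> 'w::real_normed_vector) \<Rightarrow> ('x::topological_space, 'v) c0 \<Rightarrow> ('x, 'w) c0"
  where "c0_map l F = c0_of_fun (\<lambda>x. l (c0_apply F x))"

lemma c0_map_apply:
  assumes "bounded_linear l"
  shows "c0_apply (c0_map l F) x = l (c0_apply F x)"
proof -
  have "continuous_on UNIV (\<lambda>x. l (c0_apply F x))"
    by (rule bounded_linear.continuous_on[OF assms continuous_on_c0_apply])
  moreover have "vanishes_at_infinity (\<lambda>x. l (c0_apply F x))"
  proof (rule vanishes_at_infinity_dominated[OF vanishes_c0_apply])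
    show "norm (l (c0_apply F x)) \<le> onorm l * norm (c0_apply F x)" for x
      by (rule onorm[OF assms])
  qed
  ultimately show ?thesis
    by (simp add: c0_map_def c0_apply_c0_of_fun)
qed

text \<open>An elementary tensor in the usual picture of \<open>C0(X, V)\<close> as a completed
  tensor product. With \<open>idop\<close> as second factor it embeds the scalar functions as
  central elements.\<close>

definition tensor :: "('x::topological_space, complex) c0 \<Rightarrow> 'v::complex_normed_vector \<Rightarrow> ('x, 'v) c0"
  where "tensor f A = c0_map (\<lambda>c. c *\<^sub>C A) f"

lemma tensor_apply: "c0_apply (tensor f A) x = c0_apply f x *\<^sub>C A"
  unfolding tensor_def
proof (rule c0_map_apply, rule bounded_clinear_bounded_linear, rule bounded_clinearI)
  show "norm (c *\<^sub>C A) \<le> norm c * norm A" for c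
    by (simp add: norm_scaleC)
qed (simp add: clinear_def scaleC_add_left scaleC_scaleC)

lemma norm_tensor_le: "norm (tensor f A) \<le> norm f * norm A"
  by (rule norm_c0_le) (simp add: tensor_apply norm_scaleC mult_right_mono norm_c0_apply_le)

lemma tensor_linear:
  "tensor (f + g) A = tensor f A + tensor g A" "tensor (c *\<^sub>C f) A = c *\<^sub>C tensor f A"
  "tensor f (A + B) = tensor f A + tensor f B" "tensor f (c *\<^sub>C A) = c *\<^sub>C tensor f A"
  by (auto intro!: c0_eqI simp: tensor_apply c0_rep_eqs scaleC_add_left scaleC_add_right scaleC_scaleC mult.commute)

lemma tensor_mult: "tensor f A * tensor g B = tensor (f * g) (A * (B :: 'v::complex_normed_algebra))"
  by (rule c0_eqI) (simp add: tensor_apply c0_rep_eqs mult_scaleC_left mult_scaleC_right scaleC_scaleC mult.commute)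

text \<open>Locally compact Hausdorff spaces are completely regular. Cutting \<open>U\<close> down
  to an open set inside a compact \<open>C\<close> makes the function vanish outside
  \<open>C\<close>, hence at infinity.\<close>

lemma bump_exists:
  assumes lc: "locally_compact_space (euclidean :: 'x::t2_space topology)" and U: "open U" "x \<in> U"
  shows "\<exists>(f :: ('x, complex) c0) r. (\<forall>y. c0_apply f y = complex_of_real (r y) \<and> 0 \<le> r y \<and> r y \<le> 1 \<and>
    (y \<notin> U \<longrightarrow> r y = 0)) \<and> r x = 1"
proof -
  have "Hausdorff_space (euclidean :: 'x topology)"
    unfolding Hausdorff_space_def disjnt_def by (metis hausdorff open_openin)
  then have "completely_regular_space (euclidean :: 'x topology)"
    using lc locally_compact_regular_imp_completely_regular_space by blast
  moreover have "\<exists>V C. open V \<and> compact C \<and> x \<in> V \<and> V \<subseteq> C"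
    using lc unfolding locally_compact_space_def by simp
  then obtain V C where V: "open V" "compact C" "x \<in> V" "V \<subseteq> C"
    by blast
  moreover have "closed (- (U \<inter> V))"
    using open_Int[OF U(1) V(1)] by (rule closed_Compl)
  ultimately obtain h :: "'x \<Rightarrow> real" where h: "continuous_map euclidean (top_of_set {0..1}) h" "h x = 0"
    "h ` (- (U \<inter> V)) \<subseteq> {1}"
    using U unfolding completely_regular_space_def
    by (metis Compl_iff DiffI IntI UNIV_I closed_closedin topspace_euclidean)
  then have cont: "continuous_on UNIV h" and h01: "\<And>y. 0 \<le> h y \<and> h y \<le> 1"
    by (auto simp: continuous_map_in_subtopology)
  define f where "f = c0_of_fun (\<lambda>y. complex_of_real (1 - h y))"
  have h1: "h y = 1" if "y \<notin> U \<inter> V" for y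
    using h(3) that by auto
  have "vanishes_at_infinity (\<lambda>y. complex_of_real (1 - h y))"
    unfolding vanishes_at_infinity_def
  proof (intro allI impI exI[of _ C] conjI)
    show "norm (complex_of_real (1 - h y)) < e" if "e > 0" "y \<notin> C" for e :: real and y
    proof -
      have "h y = 1"
        using that(2) V(4) by (intro h1) blast
      with that(1) show ?thesis by simp
    qed
  qed (rule V(2))
  then have "c0_apply f = (\<lambda>y. complex_of_real (1 - h y))"
    unfolding f_def by (intro c0_apply_c0_of_fun) (intro continuous_intros cont)
  then show ?thesis
    using h01 h1 h(2) by (intro exI[of _ f] exI[of _ "\<lambda>y. 1 - h y"]) auto
qed

text \<open>Otherwise \<open>h = f / \<xi> f\<close> omits the value 1 and
  \<open>h / (1 - h)\<close> belongs to the algebra. It is a quasi-inverse of \<open>h\<close>, and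
  \<open>\<xi> h = 1\<close> admits none.\<close>

lemma character_value_attained:
  fixes \<xi> :: "('x::topological_space, complex) c0 \<Rightarrow> complex"
  assumes \<xi>: "clinear \<xi>" "\<And>f g. \<xi> (f * g) = \<xi> f * \<xi> g" and f: "\<xi> f \<noteq> 0"
  shows "\<exists>x. c0_apply f x = \<xi> f"
proof (rule ccontr)
  assume not: "\<not> ?thesis"
  define h where "h = inverse (\<xi> f) *\<^sub>C f"
  have \<xi>h: "\<xi> h = 1"
    using f by (simp add: h_def clinear_scaleC[OF \<xi>(1)])
  have ne: "1 - c0_apply h x \<noteq> 0" for x
    using not f by (auto simp: h_def scaleC_c0.rep_eq field_simps)
  define q where "q x = c0_apply h x / (1 - c0_apply h x)" for x
  have "continuous_on UNIV q"
    unfolding q_def using ne by (intro continuous_intros continuous_on_c0_apply) auto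
  moreover have "vanishes_at_infinity q"
    unfolding vanishes_at_infinity_def
  proof (intro allI impI)
    fix e :: real assume e: "e > 0"
    \<comment> \<open>The first bound keeps \<open>1 - h\<close> at norm at least
      \<open>1/2\<close>, so \<open>q\<close> is at most twice \<open>h\<close>; the second then
      puts it below \<open>e\<close>.\<close>
    then have "min (1/2) (e/2) > 0" by simp
    then obtain C where C: "compact C" "\<And>x. x \<notin> C \<Longrightarrow> norm (c0_apply h x) < min (1/2) (e/2)"
      using vanishes_c0_apply[of h] unfolding vanishes_at_infinity_def by blast
    have "norm (q x) < e" if "x \<notin> C" for x
    proof -
      have h: "norm (c0_apply h x) < 1/2" "norm (c0_apply h x) < e/2"
        using C(2)[OF that] by auto
      have "norm (1 - c0_apply h x) \<ge> 1/2"
        using norm_triangle_ineq2[of 1 "c0_apply h x"] h(1) by simp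
      moreover have "norm (q x) * norm (1 - c0_apply h x) = norm (c0_apply h x)"
        using ne[of x] by (simp add: q_def norm_divide)
      ultimately have "norm (q x) * (1/2) \<le> norm (c0_apply h x)"
        by (metis mult_left_mono norm_ge_zero)
      with h(2) show ?thesis by simp
    qed
    with C(1) show "\<exists>K. compact K \<and> (\<forall>x. x \<notin> K \<longrightarrow> norm (q x) < e)" by blast
  qed
  ultimately have Q: "c0_apply (c0_of_fun q) = q"
    by (rule c0_apply_c0_of_fun)
  have "q x * (1 - c0_apply h x) = c0_apply h x" for x
    using ne[of x] by (simp add: q_def)
  then have "c0_of_fun q - c0_of_fun q * h = h"
    by (intro c0_eqI) (simp add: c0_rep_eqs Q right_diff_distrib)
  then have "\<xi> (c0_of_fun q) - \<xi> (c0_of_fun q) * \<xi> h = \<xi> h"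
    by (metis \<xi> clinear_diff)
  with \<xi>h show False by simp
qed

text \<open>Automatic continuity: a nonzero \<open>\<xi> f\<close> is one of the values of
  \<open>f\<close>.\<close>

lemma character_contractive:
  fixes \<xi> :: "('x::topological_space, complex) c0 \<Rightarrow> complex"
  assumes "clinear \<xi>" "\<And>f g. \<xi> (f * g) = \<xi> f * \<xi> g"
  shows "norm (\<xi> f) \<le> norm f"
proof (cases "\<xi> f = 0")
  case False
  then obtain x where "c0_apply f x = \<xi> f"
    using character_value_attained[OF assms] by blast
  then show ?thesis
    using norm_c0_apply_le[of f x] by simp
qed simp

text \<open>Otherwise finitely many kernel elements have no common zero on a compact set off which
  \<open>h\<close> is small. The sum \<open>F\<close> of their squared moduli lies in the kernel, so
  \<open>p = h / (1 + s * F)\<close> has \<open>\<xi> p = 1\<close>, yet for suitable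
  \<open>s\<close> it never takes the value 1.\<close>

lemma character_kernel_common_zero:
  fixes \<xi> :: "('x::topological_space, complex) c0 \<Rightarrow> complex"
  assumes \<xi>: "clinear \<xi>" "\<And>f g. \<xi> (f * g) = \<xi> f * \<xi> g" and h: "\<xi> h = 1"
  shows "\<exists>x. \<forall>k. \<xi> k = 0 \<longrightarrow> c0_apply k x = 0"
proof (rule ccontr)
  assume "\<not> ?thesis"
  then obtain k where k: "\<And>x. \<xi> (k x) = 0" "\<And>x. c0_apply (k x) x \<noteq> 0"
    by metis
  have "(1/2 :: real) > 0" by simp
  then obtain C where C: "compact C" "\<And>x. x \<notin> C \<Longrightarrow> norm (c0_apply h x) < 1/2"
    using vanishes_c0_apply[of h] unfolding vanishes_at_infinity_def by blast
  have op: "open {y. c0_apply (k x) y \<noteq> 0}" for x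
    by (intro open_Collect_neq continuous_intros continuous_on_c0_apply)
  obtain D where D: "D \<subseteq> C" "finite D" "C \<subseteq> (\<Union>x\<in>D. {y. c0_apply (k x) y \<noteq> 0})"
    using compactE_image[OF C(1), of C "\<lambda>x. {y. c0_apply (k x) y \<noteq> 0}"] op k(2) by blast
  \<comment> \<open>The factor \<open>k x\<close> alone puts each summand into the kernel; nothing
    is known about \<open>\<xi>\<close> at the conjugate.\<close>
  define F where "F = (\<Sum>x\<in>D. c0_map cnj (k x) * k x)"
  define \<phi> where "\<phi> y = (\<Sum>x\<in>D. (cmod (c0_apply (k x) y))\<^sup>2)" for y
  have F: "c0_apply F y = complex_of_real (\<phi> y)" for y
    by (simp add: F_def \<phi>_def c0_apply_sum times_c0.rep_eq c0_map_apply[OF bounded_linear_cnj]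
        complex_norm_square mult.commute del: of_real_power)
  have "\<xi> (sum g S) = (\<Sum>x\<in>S. \<xi> (g x))" for g :: "'x \<Rightarrow> ('x, complex) c0" and S
    by (induction S rule: infinite_finite_induct) (simp_all add: clinear_zero[OF \<xi>(1)] clinear_add[OF \<xi>(1)])
  then have \<xi>F: "\<xi> F = 0"
    by (simp add: F_def \<xi>(2) k(1))
  have cont: "continuous_on UNIV \<phi>"
    unfolding \<phi>_def by (intro continuous_intros continuous_on_c0_apply)
  have pos: "\<phi> y \<ge> 0" for y
    by (simp add: \<phi>_def sum_nonneg)
  have "\<exists>\<delta>>0. \<forall>y\<in>C. \<phi> y \<ge> \<delta>"
  proof (cases "C = {}")
    case True
    then show ?thesis by (intro exI[of _ 1]) simp
  next
    case False
    then obtain y where y: "y \<in> C" "\<And>z. z \<in> C \<Longrightarrow> \<phi> y \<le> \<phi> z"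
      using continuous_attains_inf[OF C(1) False] cont continuous_on_subset by (metis subset_UNIV)
    then obtain x where x: "x \<in> D" "c0_apply (k x) y \<noteq> 0"
      using D(3) by blast
    have "\<phi> y > 0"
      unfolding \<phi>_def by (rule sum_pos2[OF D(2) x(1)]) (use x(2) in auto)
    with y show ?thesis by blast
  qed
  then obtain \<delta> where \<delta>: "\<delta> > 0" "\<And>y. y \<in> C \<Longrightarrow> \<phi> y \<ge> \<delta>"
    by blast
  \<comment> \<open>With this \<open>s\<close> the denominator \<open>1 + s * \<phi> y\<close>
    exceeds \<open>norm h\<close> on \<open>C\<close>; off \<open>C\<close> the bound
    \<open>1/2\<close> on \<open>h\<close> suffices.\<close>
  define s where "s = norm h / \<delta>"
  have s: "s \<ge> 0" "s * \<delta> = norm h"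
    using \<delta>(1) by (simp_all add: s_def)
  have denom: "1 + s * \<phi> y \<ge> 1" for y
    using s(1) pos[of y] by simp
  define q where "q y = complex_of_real (s / (1 + s * \<phi> y)) * c0_apply h y" for y
  have cont': "continuous_on UNIV (\<lambda>y. s / (1 + s * \<phi> y))"
    by (intro continuous_intros cont) (use denom in \<open>metis less_irrefl less_le_trans zero_less_one\<close>)
  have "continuous_on UNIV q"
    unfolding q_def
    by (rule continuous_on_mult[OF continuous_on_of_real[OF cont'] continuous_on_c0_apply])
  moreover have "vanishes_at_infinity q"
  proof (rule vanishes_at_infinity_dominated[OF vanishes_c0_apply[of h]])
    fix y
    have "s / (1 + s * \<phi> y) \<le> s / 1"
      using s(1) denom[of y] by (intro divide_left_mono) auto
    moreover have "s / (1 + s * \<phi> y) \<ge> 0"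
      using s(1) denom[of y] by simp
    ultimately have "\<bar>s / (1 + s * \<phi> y)\<bar> \<le> s"
      by linarith
    then show "norm (q y) \<le> s * norm (c0_apply h y)"
      unfolding q_def norm_mult norm_of_real by (rule mult_right_mono) simp
  qed
  ultimately have Q: "c0_apply (c0_of_fun q) = q"
    by (rule c0_apply_c0_of_fun)
  define p where "p = h - c0_of_fun q * F"
  have "\<xi> p = 1"
    by (simp add: p_def clinear_diff[OF \<xi>(1)] \<xi>(2) \<xi>F h)
  then obtain y where y: "c0_apply p y = 1"
    using character_value_attained[OF \<xi>, of p] by auto
  have "c0_apply p y = c0_apply h y * complex_of_real (1 - s / (1 + s * \<phi> y) * \<phi> y)"
    by (simp add: p_def c0_rep_eqs Q q_def F algebra_simps)
  also have "1 - s / (1 + s * \<phi> y) * \<phi> y = 1 / (1 + s * \<phi> y)"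
    using denom[of y] by (simp add: field_simps)
  finally have "norm (c0_apply h y) * (1 / (1 + s * \<phi> y)) = 1"
    using y denom[of y] by (metis abs_of_nonneg divide_nonneg_nonneg le_numeral_extra(1) norm_mult norm_of_real norm_one order_trans)
  then have hy: "norm (c0_apply h y) = 1 + s * \<phi> y"
    using denom[of y] by (simp add: field_simps)
  show False
  proof (cases "y \<in> C")
    case True
    have "norm h \<le> s * \<phi> y"
      using mult_left_mono[OF \<delta>(2)[OF True] s(1)] s(2) by simp
    with hy norm_c0_apply_le[of h y] show False by simp
  next
    case False
    with C(2)[of y] hy denom[of y] show False by simp
  qed
qed

text \<open>Evaluation at a common zero of the kernel is a multiple of \<open>\<xi>\<close>;
  multiplicativity makes the factor idempotent and a bump makes it nonzero.\<close>

lemma character_is_evaluation: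
  fixes \<xi> :: "('x::t2_space, complex) c0 \<Rightarrow> complex"
  assumes lc: "locally_compact_space (euclidean :: 'x topology)"
    and \<xi>: "clinear \<xi>" "\<And>f g. \<xi> (f * g) = \<xi> f * \<xi> g" and f: "\<xi> f \<noteq> 0"
  shows "\<exists>x. \<forall>g. \<xi> g = c0_apply g x"
proof -
  define h where "h = inverse (\<xi> f) *\<^sub>C f"
  have h: "\<xi> h = 1"
    using f by (simp add: h_def clinear_scaleC[OF \<xi>(1)])
  obtain x where x: "\<And>k. \<xi> k = 0 \<Longrightarrow> c0_apply k x = 0"
    using character_kernel_common_zero[OF \<xi> h] by blast
  have val: "c0_apply g x = \<xi> g * c0_apply h x" for g
  proof -
    have "\<xi> (g - \<xi> g *\<^sub>C h) = 0"
      by (simp add: clinear_diff[OF \<xi>(1)] clinear_scaleC[OF \<xi>(1)] h)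
    from x[OF this] show ?thesis
      by (simp add: c0_rep_eqs)
  qed
  obtain p :: "('x, complex) c0" and r where "\<forall>y. c0_apply p y = complex_of_real (r y)" "r x = 1"
    using bump_exists[OF lc open_UNIV UNIV_I, of x] by blast
  then have "c0_apply h x \<noteq> 0"
    using val[of p] by auto
  moreover have "c0_apply h x * c0_apply h x = c0_apply h x"
    using val[of "h * h"] by (simp add: \<xi>(2) h times_c0.rep_eq)
  ultimately have "c0_apply h x = 1" by simp
  then show ?thesis
    using val by (metis mult.right_neutral)
qed

text \<open>Evaluation after \<open>\<alpha>\<close> is a character, possibly zero.\<close>

lemma Aut_contractive:
  fixes \<alpha> :: "('x::topological_space, complex) c0 \<Rightarrow> ('x, complex) c0"
  assumes "\<alpha> \<in> Aut"
  shows "norm (\<alpha> f) \<le> norm f"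
proof (rule norm_c0_le)
  fix x
  show "norm (c0_apply (\<alpha> f) x) \<le> norm f"
    by (rule character_contractive[where \<xi> = "\<lambda>f. c0_apply (\<alpha> f) x"])
      (simp_all add: clinear_def clinear_add[OF Aut_clinear[OF assms]]
        clinear_scaleC[OF Aut_clinear[OF assms]] Aut_mult[OF assms] c0_rep_eqs)
qed

text \<open>A bump at \<open>x\<close> lies in the image of \<open>\<alpha>\<close>, so the
  character given by evaluation at \<open>x\<close> is nonzero.\<close>

lemma Aut_composition:
  fixes \<alpha> :: "('x::t2_space, complex) c0 \<Rightarrow> ('x, complex) c0"
  assumes lc: "locally_compact_space (euclidean :: 'x topology)" and "\<alpha> \<in> Aut"
  shows "\<exists>y. \<forall>f. c0_apply (\<alpha> f) x = c0_apply f y"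
proof -
  obtain p :: "('x, complex) c0" and r where p: "\<forall>y. c0_apply p y = complex_of_real (r y)" "r x = 1"
    using bump_exists[OF lc open_UNIV UNIV_I, of x] by blast
  obtain q where "p = \<alpha> q"
    using Aut_surjE[OF assms(2)] .
  then have "c0_apply (\<alpha> q) x \<noteq> 0"
    using p by auto
  then show ?thesis
    by (rule character_is_evaluation[OF lc, where \<xi> = "\<lambda>f. c0_apply (\<alpha> f) x", rotated 2])
      (simp_all add: clinear_def clinear_add[OF Aut_clinear[OF assms(2)]]
        clinear_scaleC[OF Aut_clinear[OF assms(2)]] Aut_mult[OF assms(2)] c0_rep_eqs)
qed

text \<open>Functions vanishing at \<open>y\<close> are limits of functions vanishing near \<open>y\<close>.\<close>

lemma vanishing_near_suffices:
  fixes l :: "('x::topological_space, 'v::real_normed_vector) c0 \<Rightarrow> 'w::real_normed_vector"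
  assumes l: "bounded_linear l"
    and near: "\<And>F U. open U \<Longrightarrow> y \<in> U \<Longrightarrow> (\<And>z. z \<in> U \<Longrightarrow> c0_apply F z = 0) \<Longrightarrow> l F = 0"
    and F: "c0_apply F y = 0"
  shows "l F = 0"
proof -
  obtain K where K: "K > 0" "\<And>G. norm (l G) \<le> norm G * K"
    using bounded_linear.pos_bounded[OF l] by blast
  have "norm (l F) \<le> e" if e: "e > 0" for e
  proof -
    define d where "d = e / K"
    have d: "d > 0"
      using e K(1) by (simp add: d_def)
    \<comment> \<open>A soft threshold: \<open>s t * t\<close> is 0 for \<open>t \<le> d\<close> and
      \<open>t - d\<close> beyond, so the rescaled \<open>F\<close> vanishes near \<open>y\<close>
      and differs from \<open>F\<close> by at most \<open>d\<close>. The maximum keeps the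
      denominator positive.\<close>
    define s where "s t = max 0 (t - d) / max t d" for t
    have s: "0 \<le> s t" "s t \<le> 1" "(1 - s t) * t \<le> d" if "t \<ge> 0" for t
      using d that by (auto simp: s_def max_def field_simps)
    define G where "G z = s (norm (c0_apply F z)) *\<^sub>R c0_apply F z" for z
    have "continuous_on UNIV G"
      unfolding G_def s_def using d
      by (intro continuous_intros continuous_on_c0_apply) (auto simp: max_def)
    moreover have "vanishes_at_infinity G"
    proof (rule vanishes_at_infinity_dominated[OF vanishes_c0_apply[of F]])
      show "norm (G z) \<le> 1 * norm (c0_apply F z)" for z
        using s(1,2)[of "norm (c0_apply F z)"] by (simp add: G_def mult_left_le_one_le)
    qed
    ultimately have G: "c0_apply (c0_of_fun G) = G"
      by (rule c0_apply_c0_of_fun)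
    have "l (c0_of_fun G) = 0"
    proof (rule near)
      show "open {z. norm (c0_apply F z) < d}"
        by (intro open_Collect_less continuous_intros continuous_on_c0_apply)
      show "y \<in> {z. norm (c0_apply F z) < d}"
        using F d by simp
      show "c0_apply (c0_of_fun G) z = 0" if "z \<in> {z. norm (c0_apply F z) < d}" for z
        using that by (simp add: G G_def s_def)
    qed
    then have "l F = l (F - c0_of_fun G)"
      by (simp add: linear_diff[OF bounded_linear.linear[OF l]])
    moreover have "norm (F - c0_of_fun G) \<le> d"
    proof (rule norm_c0_le)
      fix z
      have "c0_apply (F - c0_of_fun G) z = (1 - s (norm (c0_apply F z))) *\<^sub>R c0_apply F z"
        by (simp add: c0_rep_eqs G G_def algebra_simps)
      then show "norm (c0_apply (F - c0_of_fun G) z) \<le> d"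
        using s[of "norm (c0_apply F z)"] by simp
    qed
    then have "norm (F - c0_of_fun G) * K \<le> d * K"
      using K(1) by simp
    ultimately show ?thesis
      using K(2)[of "F - c0_of_fun G"] K(1) by (simp add: d_def)
  qed
  then show ?thesis
    by (metis field_le_epsilon add_0 norm_le_zero_iff)
qed

section \<open>Automorphisms of the algebra of operator valued functions\<close>

text \<open>Commuting with \<open>rk y e\<close>, evaluated at \<open>e\<close>, already determines
  \<open>Z \<cdot> y\<close>.\<close>

lemma commuting_with_all_is_scalar:
  fixes Z :: "'h::chilbert_space cblinop"
  assumes e: "norm e = 1" and comm: "\<And>A. Z * A = A * Z"
  shows "Z = cinner (Z \<cdot> e) e *\<^sub>C idop"
proof (rule cblinop_eqI)
  fix y
  have "(Z * rk y e) \<cdot> e = (rk y e * Z) \<cdot> e"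
    by (simp only: comm)
  then show "Z \<cdot> y = (cinner (Z \<cdot> e) e *\<^sub>C idop) \<cdot> y"
    by (simp add: cblinop_apply_scaleC_right cinner_self e scaleC_one)
qed

text \<open>A diagonal matrix entry, serving as left inverse of the embedding of scalar
  functions.\<close>

definition coefficient :: "'h::chilbert_space \<Rightarrow> ('x::topological_space, 'h cblinop) c0 \<Rightarrow> ('x, complex) c0"
  where "coefficient e F = c0_map (\<lambda>A. cinner (A \<cdot> e) e) F"

lemma coefficient_apply: "c0_apply (coefficient e F) x = cinner (c0_apply F x \<cdot> e) e"
  unfolding coefficient_def
  by (rule c0_map_apply) (rule bounded_linear_compose[OF bounded_linear_cinner_left bounded_linear_cblinop_eval])

lemma coefficient_tensor: "norm e = 1 \<Longrightarrow> coefficient e (tensor f idop) = f"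
  by (rule c0_eqI) (simp add: coefficient_apply tensor_apply cinner_scaleC_left cinner_self)

locale operator_valued =
  fixes e :: "'h::chilbert_space" and X :: "'x::t2_space itself"
  assumes lc: "locally_compact_space (euclidean :: 'x topology)"
    and e: "norm e = 1"
begin

lemma tensor_idop_inject: "tensor f (idop :: 'h cblinop) = tensor g idop \<longleftrightarrow> f = (g :: ('x, complex) c0)"
  using coefficient_tensor[OF e] by metis

lemma unit_bump:
  obtains f :: "('x, complex) c0" where "c0_apply f x = 1" "norm f \<le> 1"
proof -
  obtain f :: "('x, complex) c0" and r where f: "\<forall>y. c0_apply f y = complex_of_real (r y) \<and> 0 \<le> r y \<and> r y \<le> 1"
    "r x = 1"
    using bump_exists[OF lc open_UNIV UNIV_I, of x] by blast
  show thesis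
  proof (rule that)
    show "c0_apply f x = 1"
      using f by simp
    show "norm f \<le> 1"
      by (rule norm_c0_le) (simp add: f)
  qed
qed

text \<open>Scalar functions are central and \<open>\<Theta>\<close> is surjective, so their images
  are central too, and each value commutes with all operators.\<close>

lemma Aut_scalar_aux:
  fixes \<Theta> :: "('x, 'h cblinop) c0 \<Rightarrow> ('x, 'h cblinop) c0"
  assumes \<Theta>: "\<Theta> \<in> Aut"
  shows "\<Theta> (tensor f idop) = tensor (coefficient e (\<Theta> (tensor f idop))) idop"
proof (rule c0_eqI)
  fix x
  let ?Z = "c0_apply (\<Theta> (tensor f idop)) x"
  have "?Z * A = A * ?Z" for A
  proof -
    obtain r :: "('x, complex) c0" where r: "c0_apply r x = 1"
      using unit_bump .
    obtain G where G: "tensor r A = \<Theta> G"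
      using Aut_surjE[OF \<Theta>] .
    have "tensor f idop * G = G * tensor f idop"
      by (rule c0_eqI) (simp add: tensor_apply times_c0.rep_eq mult_scaleC_left mult_scaleC_right)
    then have "\<Theta> (tensor f idop) * tensor r A = tensor r A * \<Theta> (tensor f idop)"
      unfolding G Aut_mult[OF \<Theta>, symmetric] by simp
    then have "c0_apply (\<Theta> (tensor f idop) * tensor r A) x = c0_apply (tensor r A * \<Theta> (tensor f idop)) x"
      by simp
    then show ?thesis
      by (simp add: times_c0.rep_eq tensor_apply r scaleC_one)
  qed
  then have "?Z = cinner (?Z \<cdot> e) e *\<^sub>C idop"
    by (rule commuting_with_all_is_scalar[OF e])
  then show "?Z = c0_apply (tensor (coefficient e (\<Theta> (tensor f idop))) idop) x"
    by (simp add: tensor_apply coefficient_apply)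
qed

text \<open>The maps induced by \<open>\<Theta>\<close> and \<open>inv \<Theta>\<close> on scalar
  functions invert each other.\<close>

lemma Aut_scalar:
  fixes \<Theta> :: "('x, 'h cblinop) c0 \<Rightarrow> ('x, 'h cblinop) c0"
  assumes \<Theta>: "\<Theta> \<in> Aut"
  shows "\<exists>\<alpha>\<in>Aut. \<forall>f. \<Theta> (tensor f idop) = tensor (\<alpha> f) idop"
proof -
  define \<alpha> where "\<alpha> f = coefficient e (\<Theta> (tensor f idop))" for f
  define \<beta> where "\<beta> f = coefficient e (inv \<Theta> (tensor f idop))" for f
  have \<alpha>: "\<Theta> (tensor f idop) = tensor (\<alpha> f) idop" for f
    unfolding \<alpha>_def by (rule Aut_scalar_aux[OF \<Theta>])
  have \<beta>: "inv \<Theta> (tensor f idop) = tensor (\<beta> f) idop" for f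
    unfolding \<beta>_def by (rule Aut_scalar_aux[OF Aut_inv[OF \<Theta>]])
  have inv: "\<Theta> (inv \<Theta> F) = F" "inv \<Theta> (\<Theta> F) = F" for F
    using Aut_bij[OF \<Theta>] by (auto simp: bij_def surj_f_inv_f inv_f_f)
  have "tensor (\<alpha> (\<beta> f)) (idop :: 'h cblinop) = tensor f idop" for f
    by (simp only: \<alpha>[symmetric] \<beta>[symmetric] inv)
  then have \<alpha>\<beta>: "\<alpha> (\<beta> f) = f" for f
    by (simp only: tensor_idop_inject)
  have "tensor (\<beta> (\<alpha> f)) (idop :: 'h cblinop) = tensor f idop" for f
    by (simp only: \<alpha>[symmetric] \<beta>[symmetric] inv)
  then have \<beta>\<alpha>: "\<beta> (\<alpha> f) = f" for f
    by (simp only: tensor_idop_inject)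
  have "\<alpha> \<in> Aut"
  proof (rule AutI)
    have "tensor (\<alpha> (f + g)) (idop :: 'h cblinop) = tensor (\<alpha> f + \<alpha> g) idop"
      "tensor (\<alpha> (c *\<^sub>C f)) (idop :: 'h cblinop) = tensor (c *\<^sub>C \<alpha> f) idop" for f g c
      by (simp_all add: \<alpha>[symmetric] tensor_linear clinear_add[OF Aut_clinear[OF \<Theta>]]
          clinear_scaleC[OF Aut_clinear[OF \<Theta>]])
    then show "clinear \<alpha>"
      by (simp add: clinear_def tensor_idop_inject)
    have "tensor (\<alpha> (f * g)) (idop :: 'h cblinop) = tensor (\<alpha> f * \<alpha> g) idop" for f g
    proof -
      have "\<Theta> (tensor (f * g) idop) = \<Theta> (tensor f idop) * \<Theta> (tensor g idop)"
        by (simp add: Aut_mult[OF \<Theta>, symmetric] tensor_mult)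
      then show ?thesis
        by (simp add: \<alpha> tensor_mult)
    qed
    then show "\<alpha> (f * g) = \<alpha> f * \<alpha> g" for f g
      by (simp add: tensor_idop_inject)
    show "bij \<alpha>"
      by (rule o_bij[of \<beta>]) (auto simp: \<alpha>\<beta> \<beta>\<alpha>)
  qed
  with \<alpha> show ?thesis by blast
qed

lemma Aut_bounded:
  fixes \<Theta> :: "('x, 'h cblinop) c0 \<Rightarrow> ('x, 'h cblinop) c0"
  assumes \<Theta>: "\<Theta> \<in> Aut"
  shows "bounded_clinear \<Theta>"
proof -
  obtain \<alpha> where \<alpha>: "\<alpha> \<in> Aut" "\<And>f. \<Theta> (tensor f idop) = tensor (\<alpha> f) idop"
    using Aut_scalar[OF \<Theta>] by blast
  have "bounded_linear \<Theta>"
  proof (rule closed_graph)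
    show "linear \<Theta>"
      by (rule clinear_linear[OF Aut_clinear[OF \<Theta>]])
    fix Y M assume Y: "Y \<longlonglongrightarrow> 0" and M: "(\<lambda>n. \<Theta> (Y n)) \<longlonglongrightarrow> M"
    obtain N where N: "M = \<Theta> N"
      using Aut_surjE[OF \<Theta>] .
    have RNR: "tensor r (rk e b) * N * tensor r (rk c e) = 0" for r b c
    proof -
      let ?R = "tensor r (rk e b)" and ?R' = "tensor r (rk c e)"
      define l where "l A = cinner (A \<cdot> c) b" for A
      have l: "bounded_linear l"
        unfolding l_def by (rule bounded_linear_compose[OF bounded_linear_cinner_left bounded_linear_cblinop_eval])
      \<comment> \<open>On the scalar factor \<open>\<Theta>\<close> acts through the contractive
        \<open>\<alpha>\<close>; thus smallness of \<open>Y n\<close> reaches the image although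
        \<open>\<Theta>\<close> is not yet known to be continuous.\<close>
      have fac: "?R * F * ?R' = tensor (r * c0_map l F) idop * tensor r (rk e e)" for F
        by (rule c0_eqI) (simp add: times_c0.rep_eq tensor_apply mult_scaleC_left mult_scaleC_right mult_rk
            rk_scaleC_left scaleC_scaleC c0_map_apply[OF l] l_def mult_ac)
      have "(\<lambda>n. \<Theta> ?R * \<Theta> (Y n) * \<Theta> ?R') \<longlonglongrightarrow> \<Theta> ?R * M * \<Theta> ?R'"
        by (intro tendsto_intros M)
      moreover have "(\<lambda>n. \<Theta> ?R * \<Theta> (Y n) * \<Theta> ?R') \<longlonglongrightarrow> 0"
      proof (rule tendsto_norm_zero_cancel, rule tendsto_sandwich[where f = "\<lambda>_. 0"])
        let ?C = "norm r * norm c * norm b * norm (idop :: 'h cblinop) * norm (\<Theta> (tensor r (rk e e)))"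
        have "norm (\<Theta> ?R * \<Theta> (Y n) * \<Theta> ?R') \<le> ?C * norm (Y n)" for n
        proof -
          have "norm (c0_map l (Y n)) \<le> norm c * norm b * norm (Y n)"
          proof (rule norm_c0_le)
            fix x
            have "norm (c0_apply (c0_map l (Y n)) x) \<le> norm (c0_apply (Y n) x \<cdot> c) * norm b"
              unfolding c0_map_apply[OF l] l_def by (rule cinner_Cauchy_Schwarz)
            also have "\<dots> \<le> norm (c0_apply (Y n) x) * norm c * norm b"
              by (intro mult_right_mono norm_cblinop_apply_le) simp
            also have "\<dots> \<le> norm (Y n) * norm c * norm b"
              by (intro mult_right_mono norm_c0_apply_le) auto
            finally show "norm (c0_apply (c0_map l (Y n)) x) \<le> norm c * norm b * norm (Y n)"
              by (simp add: mult_ac)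
          qed
          then have "norm r * norm (c0_map l (Y n)) \<le> norm r * (norm c * norm b * norm (Y n))"
            by (rule mult_left_mono) simp
          then have "norm (r * c0_map l (Y n)) \<le> norm r * (norm c * norm b * norm (Y n))"
            using norm_mult_ineq[of r "c0_map l (Y n)"] by linarith
          then have h: "norm (\<alpha> (r * c0_map l (Y n))) \<le> norm r * (norm c * norm b * norm (Y n))"
            using Aut_contractive[OF \<alpha>(1), of "r * c0_map l (Y n)"] by linarith
          have "\<Theta> ?R * \<Theta> (Y n) * \<Theta> ?R' = \<Theta> (?R * Y n * ?R')"
            by (simp only: Aut_mult[OF \<Theta>])
          also have "\<dots> = tensor (\<alpha> (r * c0_map l (Y n))) idop * \<Theta> (tensor r (rk e e))"
            by (simp only: fac Aut_mult[OF \<Theta>] \<alpha>(2))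
          finally have "norm (\<Theta> ?R * \<Theta> (Y n) * \<Theta> ?R')
            \<le> norm (tensor (\<alpha> (r * c0_map l (Y n))) (idop :: 'h cblinop)) * norm (\<Theta> (tensor r (rk e e)))"
            by (simp add: norm_mult_ineq)
          also have "\<dots> \<le> norm (\<alpha> (r * c0_map l (Y n))) * norm (idop :: 'h cblinop) * norm (\<Theta> (tensor r (rk e e)))"
            by (intro mult_right_mono norm_tensor_le) simp
          also have "\<dots> \<le> norm r * (norm c * norm b * norm (Y n)) * norm (idop :: 'h cblinop) * norm (\<Theta> (tensor r (rk e e)))"
            by (intro mult_right_mono h) auto
          finally show ?thesis
            by (simp add: mult_ac)
        qed
        then show "\<forall>\<^sub>F n in sequentially. norm (\<Theta> ?R * \<Theta> (Y n) * \<Theta> ?R') \<le> ?C * norm (Y n)"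
          by simp
        show "(\<lambda>n. ?C * norm (Y n)) \<longlonglongrightarrow> 0"
          by (intro tendsto_mult_right_zero tendsto_norm_zero Y)
      qed simp_all
      ultimately have "\<Theta> ?R * M * \<Theta> ?R' = 0"
        by (rule LIMSEQ_unique)
      then have "\<Theta> (?R * N * ?R') = 0"
        by (simp only: N Aut_mult[OF \<Theta>])
      then show ?thesis
        by (simp add: Aut_eq_0_iff[OF \<Theta>])
    qed
    have "c0_apply N x \<cdot> c = 0" for x c
    proof -
      obtain r :: "('x, complex) c0" where r: "c0_apply r x = 1"
        using unit_bump .
      \<comment> \<open>With this \<open>b\<close> the sandwich at \<open>x\<close> is
        \<open>cinner ?b ?b *\<^sub>C rk e e\<close>.\<close>
      let ?b = "c0_apply N x \<cdot> c"
      have "c0_apply (tensor r (rk e ?b) * N * tensor r (rk c e)) x \<cdot> e = 0"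
        by (simp add: RNR zero_c0.rep_eq)
      then have "cinner ?b ?b *\<^sub>C e = 0"
        by (simp add: times_c0.rep_eq tensor_apply r scaleC_one cinner_self e)
      then show ?thesis
        using e by auto
    qed
    then have "N = 0"
      by (intro c0_eqI cblinop_eqI) (simp add: zero_c0.rep_eq)
    then show "M = 0"
      by (simp add: N Aut_eq_0_iff[OF \<Theta>])
  qed
  then show ?thesis
    using Aut_clinear[OF \<Theta>] by (simp add: bounded_clinear_iff clinear_def)
qed

text \<open>A bump at \<open>y\<close> annihilates a function vanishing near \<open>y\<close>; the
  image of the bump annihilates the image of that function and equals \<open>idop\<close> at
  \<open>x\<close>. Boundedness extends this to functions vanishing only at
  \<open>y\<close>.\<close>

lemma Aut_vanishing:
  fixes \<Theta> :: "('x, 'h cblinop) c0 \<Rightarrow> ('x, 'h cblinop) c0"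
  assumes \<Theta>: "\<Theta> \<in> Aut" and \<alpha>: "\<And>f. \<Theta> (tensor f idop) = tensor (\<alpha> f) idop"
    and y: "\<And>f. c0_apply (\<alpha> f) x = c0_apply f y" and F: "c0_apply F y = 0"
  shows "c0_apply (\<Theta> F) x = 0"
proof (rule vanishing_near_suffices[where l = "\<lambda>F. c0_apply (\<Theta> F) x", OF _ _ F])
  show "bounded_linear (\<lambda>F. c0_apply (\<Theta> F) x)"
    by (rule bounded_linear_compose[OF bounded_linear_c0_eval
          bounded_clinear_bounded_linear[OF Aut_bounded[OF \<Theta>]]])
  fix G :: "('x, 'h cblinop) c0" and U assume U: "open U" "y \<in> U" and G: "\<And>z. z \<in> U \<Longrightarrow> c0_apply G z = 0"
  obtain g :: "('x, complex) c0" and r where g: "\<forall>z. c0_apply g z = complex_of_real (r z) \<and> 0 \<le> r z \<and> r z \<le> 1 \<and>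
    (z \<notin> U \<longrightarrow> r z = 0)" "r y = 1"
    using bump_exists[OF lc U] by blast
  have "tensor g idop * G = 0"
  proof (rule c0_eqI)
    show "c0_apply (tensor g idop * G) z = c0_apply 0 z" for z
      using g G[of z] by (cases "z \<in> U") (simp_all add: c0_rep_eqs tensor_apply)
  qed
  then have "tensor (\<alpha> g) idop * \<Theta> G = 0"
    by (simp add: \<alpha>[symmetric] Aut_mult[OF \<Theta>, symmetric] Aut_eq_0_iff[OF \<Theta>])
  then have "c0_apply (tensor (\<alpha> g) idop * \<Theta> G) x = 0"
    by (simp add: zero_c0.rep_eq)
  then show "c0_apply (\<Theta> G) x = 0"
    by (simp add: times_c0.rep_eq tensor_apply y g scaleC_one)
qed

lemma Aut_pointwise:
  fixes \<Theta> :: "('x, 'h cblinop) c0 \<Rightarrow> ('x, 'h cblinop) c0"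
  assumes \<Theta>: "\<Theta> \<in> Aut"
  shows "\<exists>y. \<exists>\<tau>\<in>Aut. \<forall>F. c0_apply (\<Theta> F) x = \<tau> (c0_apply F y)"
proof -
  obtain \<alpha> where \<alpha>: "\<alpha> \<in> Aut" "\<And>f. \<Theta> (tensor f idop) = tensor (\<alpha> f) idop"
    using Aut_scalar[OF \<Theta>] by blast
  obtain y where y: "\<And>f. c0_apply (\<alpha> f) x = c0_apply f y"
    using Aut_composition[OF lc \<alpha>(1)] by blast
  obtain r :: "('x, complex) c0" where r: "c0_apply r y = 1"
    using unit_bump .
  obtain s :: "('x, complex) c0" where s: "c0_apply s x = 1"
    using unit_bump .
  define \<tau> where "\<tau> A = c0_apply (\<Theta> (tensor r A)) x" for A
  have \<tau>: "c0_apply (\<Theta> F) x = \<tau> (c0_apply F y)" for F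
  proof -
    have "c0_apply (\<Theta> (F - tensor r (c0_apply F y))) x = 0"
      by (rule Aut_vanishing[OF \<Theta> \<alpha>(2) y]) (simp add: minus_c0.rep_eq tensor_apply r scaleC_one)
    then show ?thesis
      by (simp add: clinear_diff[OF Aut_clinear[OF \<Theta>]] minus_c0.rep_eq \<tau>_def)
  qed
  have "\<tau> \<in> Aut"
  proof (rule AutI)
    show lin: "clinear \<tau>"
      by (simp add: clinear_def \<tau>_def tensor_linear clinear_add[OF Aut_clinear[OF \<Theta>]]
          clinear_scaleC[OF Aut_clinear[OF \<Theta>]] c0_rep_eqs)
    show "\<tau> (A * B) = \<tau> A * \<tau> B" for A B
    proof -
      have "\<tau> A * \<tau> B = c0_apply (\<Theta> (tensor r A * tensor r B)) x"
        by (simp add: \<tau>_def Aut_mult[OF \<Theta>] times_c0.rep_eq)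
      then show ?thesis
        unfolding \<tau> by (simp add: times_c0.rep_eq tensor_apply r scaleC_one)
    qed
    \<comment> \<open>Injectivity is \<open>Aut_vanishing\<close> for \<open>inv \<Theta>\<close>,
      with \<open>x\<close> and \<open>y\<close> exchanged.\<close>
    have "A = 0" if "\<tau> A = 0" for A
    proof -
      have inv: "inv \<Theta> (\<Theta> F) = F" "inv \<alpha> (\<alpha> f) = f" "\<alpha> (inv \<alpha> f) = f" for F f
        using Aut_bij[OF \<Theta>] Aut_bij[OF \<alpha>(1)] by (auto simp: bij_def surj_f_inv_f inv_f_f)
      have "inv \<Theta> (tensor f idop) = tensor (inv \<alpha> f) idop" for f
        using inv(1)[of "tensor (inv \<alpha> f) idop"] by (simp only: \<alpha>(2) inv)
      moreover have "c0_apply (inv \<alpha> f) y = c0_apply f x" for f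
        using y[of "inv \<alpha> f"] by (simp only: inv)
      moreover have "c0_apply (\<Theta> (tensor r A)) x = 0"
        using that by (simp add: \<tau>_def)
      ultimately have "c0_apply (inv \<Theta> (\<Theta> (tensor r A))) y = 0"
        by (rule Aut_vanishing[OF Aut_inv[OF \<Theta>]])
      then show ?thesis
        by (simp add: inv tensor_apply r scaleC_one)
    qed
    then have "inj \<tau>"
      by (metis (no_types, lifting) injI clinear_diff[OF lin] eq_iff_diff_eq_0)
    moreover have "surj \<tau>"
    proof (rule surjI)
      show "\<tau> (c0_apply (inv \<Theta> (tensor s B)) y) = B" for B
        using Aut_bij[OF \<Theta>]
        by (simp add: \<tau>[symmetric] bij_def surj_f_inv_f tensor_apply s scaleC_one)
    qed
    ultimately show "bij \<tau>"
      by (simp add: bij_def)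
  qed
  with \<tau> show ?thesis by blast
qed

end


section \<open>Maps that agree locally with automorphisms\<close>

lemma ref_alD:
  assumes "\<Phi> \<in> ref_al \<E>"
  shows "bounded_clinear \<Phi>" "\<exists>\<Theta>\<in>\<E>. \<Phi> F = \<Theta> F"
  using assms by (auto simp: ref_al_def)

text \<open>The preimage of the set where \<open>f\<close> is nonzero is the set where
  \<open>\<alpha> f\<close> is nonzero, and bumps make such sets a base.\<close>

lemma composition_continuous:
  fixes \<phi> :: "'x::t2_space \<Rightarrow> 'x" and \<alpha> :: "('x, complex) c0 \<Rightarrow> ('x, complex) c0"
  assumes lc: "locally_compact_space (euclidean :: 'x topology)"
    and \<phi>: "\<And>f x. c0_apply (\<alpha> f) x = c0_apply f (\<phi> x)"
  shows "continuous_on UNIV \<phi>"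
proof -
  have "open (\<phi> -` U)" if U: "open U" for U
  proof (subst open_subopen, rule ballI)
    fix x assume "x \<in> \<phi> -` U"
    then have "\<phi> x \<in> U" by simp
    then obtain f :: "('x, complex) c0" and r where f: "\<forall>y. c0_apply f y = complex_of_real (r y) \<and> 0 \<le> r y \<and> r y \<le> 1 \<and>
      (y \<notin> U \<longrightarrow> r y = 0)" "r (\<phi> x) = 1"
      using bump_exists[OF lc U] by blast
    have "open {z. c0_apply (\<alpha> f) z \<noteq> 0}"
      by (intro open_Collect_neq continuous_intros continuous_on_c0_apply)
    moreover have "{z. c0_apply (\<alpha> f) z \<noteq> 0} \<subseteq> \<phi> -` U"
      using f(1) by (auto simp: \<phi>)
    moreover have "x \<in> {z. c0_apply (\<alpha> f) z \<noteq> 0}"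
      using f by (simp add: \<phi>)
    ultimately show "\<exists>T. open T \<and> x \<in> T \<and> T \<subseteq> \<phi> -` U" by blast
  qed
  then show ?thesis
    by (simp add: continuous_on_open_vimage)
qed

lemma c0_separates_points:
  fixes x y :: "'x::t2_space"
  assumes lc: "locally_compact_space (euclidean :: 'x topology)"
    and eq: "\<And>f :: ('x, complex) c0. c0_apply f x = c0_apply f y"
  shows "x = y"
proof (rule ccontr)
  assume "x \<noteq> y"
  then have "open (- {y})" "x \<in> - {y}"
    by auto
  then obtain f :: "('x, complex) c0" and r where f: "\<forall>z. c0_apply f z = complex_of_real (r z) \<and> 0 \<le> r z \<and> r z \<le> 1 \<and>
    (z \<notin> - {y} \<longrightarrow> r z = 0)" "r x = 1"
    using bump_exists[OF lc] by blast
  then show False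
    using eq[of f] by auto
qed

locale local_automorphism_c0 = operator_valued e X for e :: "'h::chilbert_space" and X :: "'x::t2_space itself" +
  fixes \<Phi> :: "('x, 'h cblinop) c0 \<Rightarrow> ('x, 'h cblinop) c0"
  assumes inf: "\<not> (\<exists>B :: 'h set. finite B \<and> cspan B = UNIV)"
    and sep: "separable_space (euclidean :: 'h topology)"
    and reflexive: "algebraically_reflexive (Aut :: (('x, complex) c0 \<Rightarrow> ('x, complex) c0) set)"
    and \<Phi>: "\<Phi> \<in> ref_al Aut"
begin

lemma clin: "clinear \<Phi>"
  and bounded_linear_\<Phi>: "bounded_linear \<Phi>"
  using ref_alD(1)[OF \<Phi>] by (simp_all add: bounded_clinear_clinear bounded_clinear_bounded_linear)

lemma \<Phi>_scalar:
  "\<exists>\<alpha>\<in>Aut. \<forall>f. \<Phi> (tensor f idop) = tensor (\<alpha> f) idop"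
proof -
  define \<alpha> where "\<alpha> f = coefficient e (\<Phi> (tensor f idop))" for f
  have loc: "\<exists>\<beta>\<in>Aut. \<Phi> (tensor f idop) = tensor (\<beta> f) idop \<and> \<alpha> f = \<beta> f" for f
  proof -
    obtain \<Theta> where \<Theta>: "\<Theta> \<in> Aut" "\<Phi> (tensor f idop) = \<Theta> (tensor f idop)"
      using ref_alD(2)[OF \<Phi>] by blast
    obtain \<beta> where \<beta>: "\<beta> \<in> Aut" "\<And>f. \<Theta> (tensor f idop) = tensor (\<beta> f) idop"
      using Aut_scalar[OF \<Theta>(1)] by blast
    then have "\<Phi> (tensor f idop) = tensor (\<beta> f) idop"
      using \<Theta>(2) by simp
    moreover from this have "\<alpha> f = \<beta> f"
      by (simp add: \<alpha>_def coefficient_tensor[OF e])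
    ultimately show ?thesis
      using \<beta>(1) by blast
  qed
  have \<alpha>: "\<Phi> (tensor f idop) = tensor (\<alpha> f) idop" for f
    using loc[of f] by auto
  have "bounded_clinear \<alpha>"
  proof (rule bounded_clinearI)
    have "tensor (\<alpha> (f + g)) (idop :: 'h cblinop) = tensor (\<alpha> f + \<alpha> g) idop"
      "tensor (\<alpha> (c *\<^sub>C f)) (idop :: 'h cblinop) = tensor (c *\<^sub>C \<alpha> f) idop" for f g c
      by (simp_all add: \<alpha>[symmetric] tensor_linear clinear_add[OF clin] clinear_scaleC[OF clin])
    then show "clinear \<alpha>"
      by (simp add: clinear_def tensor_idop_inject)
    show "norm (\<alpha> f) \<le> norm f * 1" for f
      using loc[of f] Aut_contractive by auto
  qed
  then have "\<alpha> \<in> ref_al Aut"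
    unfolding ref_al_def using loc by blast
  then have "\<alpha> \<in> Aut"
    using reflexive by (simp add: algebraically_reflexive_def)
  then show ?thesis
    using \<alpha> by blast
qed

text \<open>Adding a large multiple of a scalar function \<open>g\<close> supported where \<open>F\<close> vanishes makes the
  value at \<open>x\<close> injective; as \<open>F\<close> has no injective values, that value must come from a scalar value
  of the sum.\<close>

lemma vanishing_noninjective:
  assumes \<alpha>: "\<And>f. \<Phi> (tensor f idop) = tensor (\<alpha> f) idop"
    and y: "\<And>f. c0_apply (\<alpha> f) x = c0_apply f y" and U: "open U" "y \<in> U"
    and F: "\<And>z. z \<in> U \<Longrightarrow> c0_apply F z = 0" and nonin: "\<And>z. noninjective (c0_apply F z)"
  shows "c0_apply (\<Phi> F) x = 0"
proof -
  obtain g :: "('x, complex) c0" and r where g: "\<And>z. c0_apply g z = complex_of_real (r z)"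
    "\<And>z. 0 \<le> r z \<and> r z \<le> 1" "\<And>z. z \<notin> U \<Longrightarrow> r z = 0" "r y = 1"
    using bump_exists[OF lc U] by blast
  define A where "A = c0_apply (\<Phi> F) x"
  have key: "\<exists>z. A + c *\<^sub>C idop = (c * complex_of_real (r z)) *\<^sub>C idop"
    if inj: "\<not> noninjective (A + c *\<^sub>C idop)" for c
  proof -
    let ?G = "F + c *\<^sub>C tensor g idop"
    have val: "c0_apply (\<Phi> ?G) x = A + c *\<^sub>C idop"
      by (simp add: A_def clinear_add[OF clin] clinear_scaleC[OF clin] c0_rep_eqs \<alpha> tensor_apply y g scaleC_one)
    obtain \<Theta> where \<Theta>: "\<Theta> \<in> Aut" "\<Phi> ?G = \<Theta> ?G"
      using ref_alD(2)[OF \<Phi>] by blast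
    obtain z \<tau> where \<tau>: "\<tau> \<in> Aut" "\<And>F. c0_apply (\<Theta> F) x = \<tau> (c0_apply F z)"
      using Aut_pointwise[OF \<Theta>(1)] by blast
    have eq: "A + c *\<^sub>C idop = \<tau> (c0_apply ?G z)"
      using val \<Theta>(2) \<tau>(2) by metis
    have "z \<in> U"
    proof (rule ccontr)
      assume "z \<notin> U"
      then have "c0_apply ?G z = c0_apply F z"
        by (simp add: c0_rep_eqs tensor_apply g)
      then have "noninjective (A + c *\<^sub>C idop)"
        unfolding eq Aut_noninjective_iff[OF \<tau>(1)] using nonin[of z] by simp
      with inj show False by blast
    qed
    then have "c0_apply ?G z = (c * complex_of_real (r z)) *\<^sub>C idop"
      by (simp add: c0_rep_eqs tensor_apply g F scaleC_scaleC)
    then show ?thesis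
      using eq by (intro exI[of _ z]) (simp add: clinear_scaleC[OF Aut_clinear[OF \<tau>(1)]] Aut_idop[OF \<tau>(1)])
  qed
  have scalar_inj: "\<not> noninjective (c *\<^sub>C (idop :: 'h cblinop))" if "c \<noteq> 0" for c
    using that by (auto simp: noninjective_def)
  define c where "c = complex_of_real (norm A + 1)"
  have "\<not> noninjective (A + c *\<^sub>C idop)"
  proof
    assume "noninjective (A + c *\<^sub>C idop)"
    then obtain z where z: "z \<noteq> 0" "(A \<cdot> z) + c *\<^sub>C z = 0"
      by (auto simp: noninjective_def)
    then have "norm (A \<cdot> z) = norm (c *\<^sub>C z)"
      by (metis add_eq_0_iff norm_minus_cancel)
    also have "\<dots> = (norm A + 1) * norm z"
      unfolding norm_scaleC c_def norm_of_real by simp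
    finally show False
      using norm_cblinop_apply_le[of A z] z(1) by (simp add: algebra_simps)
  qed
  then obtain z where "A + c *\<^sub>C idop = (c * complex_of_real (r z)) *\<^sub>C idop"
    using key by blast
  then have A: "A = (c * complex_of_real (r z) - c) *\<^sub>C idop"
    by (simp add: complex_vector.scale_left_diff_distrib eq_diff_eq)
  define m where "m = c * complex_of_real (r z) - c"
  \<comment> \<open>Now \<open>A = m *\<^sub>C idop\<close>. Taking \<open>c = m\<close> in
    \<open>key\<close> would give \<open>2 * m = m * r w\<close>, while \<open>r\<close> is at most
    1.\<close>
  have "m = 0"
  proof (rule ccontr)
    assume m: "m \<noteq> 0"
    have Am: "A + m *\<^sub>C idop = (2 * m) *\<^sub>C idop"
      using scaleC_add_left[of m m "idop :: 'h cblinop"] by (simp add: A m_def[symmetric])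
    then have "\<not> noninjective (A + m *\<^sub>C idop)"
      using scalar_inj[of "2 * m"] m by simp
    then obtain w where "A + m *\<^sub>C idop = (m * complex_of_real (r w)) *\<^sub>C idop"
      using key by blast
    then have "((2 * m) *\<^sub>C idop) \<cdot> e = ((m * complex_of_real (r w)) *\<^sub>C idop) \<cdot> e"
      by (simp only: Am)
    then have "(2 * m) *\<^sub>C e = (m * complex_of_real (r w)) *\<^sub>C e"
      by (simp only: cblinop_apply_scaleC idop_apply)
    moreover have "e \<noteq> 0"
      using e by auto
    ultimately have "2 * m = m * complex_of_real (r w)"
      by simp
    then have "complex_of_real (r w) = complex_of_real 2"
      using m by simp
    then have "r w = 2"
      by (simp only: of_real_eq_iff)
    with g(2)[of w] show False by simp
  qed
  then show ?thesis
    using A by (simp add: A_def m_def)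
qed

text \<open>\<open>vanishing_noninjective\<close> requires functions without injective values. A
  rank one projection \<open>P\<close> splits \<open>G\<close> into two of these: one kills a vector
  orthogonal to \<open>e\<close>, the other kills \<open>e\<close>.\<close>

lemma \<Phi>_vanishing:
  assumes \<alpha>: "\<And>f. \<Phi> (tensor f idop) = tensor (\<alpha> f) idop"
    and y: "\<And>f. c0_apply (\<alpha> f) x = c0_apply f y" and F: "c0_apply F y = 0"
  shows "c0_apply (\<Phi> F) x = 0"
proof (rule vanishing_near_suffices[where l = "\<lambda>F. c0_apply (\<Phi> F) x", OF _ _ F])
  show "bounded_linear (\<lambda>F. c0_apply (\<Phi> F) x)"
    by (rule bounded_linear_compose[OF bounded_linear_c0_eval bounded_linear_\<Phi>])
  fix G :: "('x, 'h cblinop) c0" and U assume U: "open U" "y \<in> U" and G: "\<And>z. z \<in> U \<Longrightarrow> c0_apply G z = 0"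
  define P where "P = rk e e"
  define G1 where "G1 = c0_map (\<lambda>A. A * P) G"
  define G2 where "G2 = c0_map (\<lambda>A. A * (idop - P)) G"
  have G1: "c0_apply G1 z = c0_apply G z * P" and G2: "c0_apply G2 z = c0_apply G z * (idop - P)" for z
    unfolding G1_def G2_def by (rule c0_map_apply[OF bounded_linear_mult_left])+
  obtain v where v: "norm v = 1" "\<forall>f\<in>{e}. cinner v f = 0"
    using orthogonal_to_finite_exists[OF inf, of "{e}"] by blast
  have "noninjective (c0_apply G1 z)" for z
  proof (rule noninjectiveI)
    show "c0_apply G1 z \<cdot> v = 0"
      using v(2) by (simp add: G1 P_def)
    show "v \<noteq> 0"
      using v(1) by auto
  qed
  then have \<Phi>1: "c0_apply (\<Phi> G1) x = 0"
    by (rule vanishing_noninjective[OF \<alpha> y U, rotated]) (simp add: G1 G)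
  have "noninjective (c0_apply G2 z)" for z
  proof (rule noninjectiveI)
    show "c0_apply G2 z \<cdot> e = 0"
      by (simp add: G2 P_def cinner_self e scaleC_one)
    show "e \<noteq> 0"
      using e by auto
  qed
  then have \<Phi>2: "c0_apply (\<Phi> G2) x = 0"
    by (rule vanishing_noninjective[OF \<alpha> y U, rotated]) (simp add: G2 G)
  have "G = G1 + G2"
    by (rule c0_eqI) (simp add: plus_c0.rep_eq G1 G2 right_diff_distrib)
  then show "c0_apply (\<Phi> G) x = 0"
    by (simp add: clinear_add[OF clin] plus_c0.rep_eq \<Phi>1 \<Phi>2)
qed

text \<open>A cut-off of norm at most 1 hands the bound \<open>K\<close> of \<open>\<Phi>\<close> on
  to \<open>\<Psi>\<close>, so the same \<open>K\<close> serves every \<open>x\<close>.\<close>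

lemma \<Phi>_spatial:
  assumes K: "\<And>F. norm (\<Phi> F) \<le> K * norm F" and K0: "K \<ge> 0"
    and \<alpha>: "\<And>f. \<Phi> (tensor f idop) = tensor (\<alpha> f) idop"
    and y: "\<And>f. c0_apply (\<alpha> f) x = c0_apply f y"
  shows "\<exists>T T'. T * T' = idop \<and> T' * T = idop \<and> norm T \<le> K \<and> norm T' \<le> K \<and>
    (\<forall>F. c0_apply (\<Phi> F) x = T * c0_apply F y * T')"
proof -
  obtain g :: "('x, complex) c0" where g: "c0_apply g y = 1" "norm g \<le> 1"
    using unit_bump .
  define \<Psi> where "\<Psi> A = c0_apply (\<Phi> (tensor g A)) x" for A
  have val: "c0_apply (\<Phi> F) x = \<Psi> (c0_apply F y)" for F
  proof -
    have "c0_apply (\<Phi> (F - tensor g (c0_apply F y))) x = 0"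
      by (rule \<Phi>_vanishing[OF \<alpha> y]) (simp add: minus_c0.rep_eq tensor_apply g scaleC_one)
    then show ?thesis
      by (simp add: clinear_diff[OF clin] minus_c0.rep_eq \<Psi>_def)
  qed
  interpret \<Psi>: local_automorphism \<Psi> K e
  proof
    show "clinear \<Psi>"
      by (simp add: clinear_def \<Psi>_def tensor_linear clinear_add[OF clin] clinear_scaleC[OF clin] c0_rep_eqs)
    show "norm (\<Psi> A) \<le> K * norm A" for A
    proof -
      have "norm (\<Psi> A) \<le> norm (\<Phi> (tensor g A))"
        unfolding \<Psi>_def by (rule norm_c0_apply_le)
      also have "\<dots> \<le> K * norm (tensor g A)"
        by (rule K)
      also have "\<dots> \<le> K * (1 * norm A)"
        by (intro mult_left_mono K0 order_trans[OF norm_tensor_le] mult_right_mono g(2)) simp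
      finally show ?thesis by simp
    qed
    show "\<Psi> idop = idop"
      by (simp add: \<Psi>_def \<alpha> tensor_apply y g scaleC_one)
    show "\<exists>c. \<exists>\<tau>\<in>Aut. \<Psi> A = c *\<^sub>C \<tau> A" for A
    proof -
      obtain \<Theta> where \<Theta>: "\<Theta> \<in> Aut" "\<Phi> (tensor g A) = \<Theta> (tensor g A)"
        using ref_alD(2)[OF \<Phi>] by blast
      obtain z \<tau> where \<tau>: "\<tau> \<in> Aut" "\<And>F. c0_apply (\<Theta> F) x = \<tau> (c0_apply F z)"
        using Aut_pointwise[OF \<Theta>(1)] by blast
      have "\<Psi> A = c0_apply g z *\<^sub>C \<tau> A"
        by (simp add: \<Psi>_def \<Theta>(2) \<tau>(2) tensor_apply clinear_scaleC[OF Aut_clinear[OF \<tau>(1)]])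
      with \<tau>(1) show ?thesis by blast
    qed
  qed (fact inf sep e)+
  show ?thesis
  proof (rule \<Psi>.spatial)
    fix T T' assume "T * T' = idop" "T' * T = idop" "norm T \<le> K" "norm T' \<le> K" "\<And>A. \<Psi> A = T * A * T'"
    then show ?thesis
      using val by metis
  qed
qed

lemma \<Phi>_Aut: "\<Phi> \<in> Aut"
proof -
  obtain K where K: "K > 0" "\<And>F. norm (\<Phi> F) \<le> norm F * K"
    using bounded_linear.pos_bounded[OF bounded_linear_\<Phi>] by blast
  obtain \<alpha> where \<alpha>: "\<alpha> \<in> Aut" "\<And>f. \<Phi> (tensor f idop) = tensor (\<alpha> f) idop"
    using \<Phi>_scalar by blast
  obtain \<phi> where \<phi>: "\<And>f x. c0_apply (\<alpha> f) x = c0_apply f (\<phi> x)"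
    using Aut_composition[OF lc \<alpha>(1)] by metis
  obtain \<psi> where \<psi>: "\<And>f x. c0_apply (inv \<alpha> f) x = c0_apply f (\<psi> x)"
    using Aut_composition[OF lc Aut_inv[OF \<alpha>(1)]] by metis
  have inv: "inv \<alpha> (\<alpha> f) = f" "\<alpha> (inv \<alpha> f) = f" for f
    using Aut_bij[OF \<alpha>(1)] by (auto simp: bij_def surj_f_inv_f inv_f_f)
  have \<phi>\<psi>: "\<phi> (\<psi> x) = x" and \<psi>\<phi>: "\<psi> (\<phi> x) = x" for x
    by (rule c0_separates_points[OF lc], simp add: inv flip: \<phi> \<psi>)+
  have cont\<phi>: "continuous_on UNIV \<phi>" and cont\<psi>: "continuous_on UNIV \<psi>"
    using composition_continuous[OF lc \<phi>] composition_continuous[OF lc \<psi>] .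
  have "\<forall>x. \<exists>T T'. T * T' = idop \<and> T' * T = idop \<and> norm T \<le> K \<and> norm T' \<le> K \<and>
    (\<forall>F. c0_apply (\<Phi> F) x = T * c0_apply F (\<phi> x) * T')"
    using K by (intro allI \<Phi>_spatial[OF _ _ \<alpha>(2) \<phi>]) (simp_all add: mult.commute)
  then obtain T T' where T: "\<And>x. T x * T' x = idop" "\<And>x. T' x * T x = idop"
    "\<And>x. norm (T x) \<le> K" "\<And>x. norm (T' x) \<le> K"
    "\<And>x F. c0_apply (\<Phi> F) x = T x * c0_apply F (\<phi> x) * T' x"
    by metis
  have TT': "T x * (T' x * A) = A" "T' x * (T x * A) = A" for x A
    by (simp_all add: mult.assoc[symmetric] T)
  show ?thesis
  proof (rule AutI[OF clin])
    show "\<Phi> (F * G) = \<Phi> F * \<Phi> G" for F G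
      by (rule c0_eqI) (simp add: times_c0.rep_eq T mult.assoc TT')
    have "F = 0" if "\<Phi> F = 0" for F
    proof (rule c0_eqI)
      fix y
      have "c0_apply (\<Phi> F) (\<psi> y) = 0"
        using that by (simp add: zero_c0.rep_eq)
      then have "T (\<psi> y) * c0_apply F y * T' (\<psi> y) = 0"
        by (simp add: T \<phi>\<psi>)
      then have "T' (\<psi> y) * (T (\<psi> y) * c0_apply F y * T' (\<psi> y)) * T (\<psi> y) = 0"
        by simp
      then show "c0_apply F y = c0_apply 0 y"
        by (simp add: zero_c0.rep_eq mult.assoc TT' T)
    qed
    then have "inj \<Phi>"
      by (metis (no_types, lifting) injI clinear_diff[OF clin] eq_iff_diff_eq_0)
    moreover have "surj \<Phi>"
    proof (unfold surj_def, intro allI)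
      fix G
      define F where "F y = T' (\<psi> y) * c0_apply G (\<psi> y) * T (\<psi> y)" for y
      have bound: "norm (T' x * A * T x) \<le> K * K * norm A" for x A
      proof -
        have "norm (T' x * A * T x) \<le> norm (T' x * A) * norm (T x)"
          by (rule norm_mult_ineq)
        also have "\<dots> \<le> (norm (T' x) * norm A) * norm (T x)"
          by (intro mult_right_mono norm_mult_ineq) simp
        also have "\<dots> \<le> (K * norm A) * K"
          using T(3,4) K(1) by (intro mult_mono) auto
        finally show ?thesis
          by (simp add: mult_ac)
      qed
      have "isCont F y0" for y0
      proof -
        obtain g :: "('x, complex) c0" where g: "c0_apply g y0 = 1"
          using unit_bump .
        \<comment> \<open>\<open>F1\<close> is continuous and agrees with \<open>F\<close> at
          \<open>y0\<close>. Their difference is the conjugate of \<open>D\<close>, which vanishes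
          at \<open>\<psi> y0\<close>; the uniform bound makes it tend to 0 even if \<open>T\<close>
          and \<open>T'\<close> jump.\<close>
        define F1 where "F1 = tensor g (F y0)"
        define D where "D = G - \<Phi> F1"
        have F1: "c0_apply F1 y0 = F y0"
          by (simp add: F1_def tensor_apply g scaleC_one)
        have D0: "c0_apply D (\<psi> y0) = 0"
          by (simp add: D_def minus_c0.rep_eq T \<phi>\<psi> F1 F_def mult.assoc TT')
        have diff: "F y - c0_apply F1 y = T' (\<psi> y) * c0_apply D (\<psi> y) * T (\<psi> y)" for y
          by (simp add: D_def minus_c0.rep_eq T \<phi>\<psi> F_def right_diff_distrib left_diff_distrib mult.assoc TT')
        have "continuous_on UNIV (\<lambda>y. c0_apply D (\<psi> y))"
          by (rule continuous_on_compose2[OF continuous_on_c0_apply cont\<psi>]) simp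
        then have "((\<lambda>y. c0_apply D (\<psi> y)) \<longlongrightarrow> c0_apply D (\<psi> y0)) (at y0)"
          by (simp add: continuous_on_def)
        then have "((\<lambda>y. c0_apply D (\<psi> y)) \<longlongrightarrow> 0) (at y0)"
          by (simp only: D0)
        then have "((\<lambda>y. K * K * norm (c0_apply D (\<psi> y))) \<longlongrightarrow> 0) (at y0)"
          by (intro tendsto_mult_right_zero tendsto_norm_zero)
        then have "((\<lambda>y. F y - c0_apply F1 y) \<longlongrightarrow> 0) (at y0)"
          by (rule Lim_null_comparison[rotated]) (simp add: diff bound)
        moreover have "(c0_apply F1 \<longlongrightarrow> c0_apply F1 y0) (at y0)"
          using continuous_on_c0_apply[of F1] by (auto simp: continuous_on_def)
        ultimately have "((\<lambda>y. (F y - c0_apply F1 y) + c0_apply F1 y) \<longlongrightarrow> 0 + c0_apply F1 y0) (at y0)"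
          by (rule tendsto_add)
        then show ?thesis
          by (simp add: isCont_def F1)
      qed
      then have "continuous_on UNIV F"
        by (simp add: continuous_on_eq_continuous_at)
      moreover have "vanishes_at_infinity F"
      proof (rule vanishes_at_infinity_dominated)
        show "vanishes_at_infinity (\<lambda>y. c0_apply G (\<psi> y))"
          unfolding vanishes_at_infinity_def
        proof (intro allI impI)
          fix \<epsilon> :: real assume "\<epsilon> > 0"
          then obtain C where C: "compact C" "\<And>x. x \<notin> C \<Longrightarrow> norm (c0_apply G x) < \<epsilon>"
            using vanishes_c0_apply[of G] unfolding vanishes_at_infinity_def by blast
          have "compact (\<phi> ` C)"
            by (rule compact_continuous_image[OF continuous_on_subset[OF cont\<phi>] C(1)]) simp
          moreover have "norm (c0_apply G (\<psi> y)) < \<epsilon>" if "y \<notin> \<phi> ` C" for y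
            using that \<phi>\<psi>[of y] by (intro C(2)) (metis imageI)
          ultimately show "\<exists>K. compact K \<and> (\<forall>y. y \<notin> K \<longrightarrow> norm (c0_apply G (\<psi> y)) < \<epsilon>)"
            by blast
        qed
        show "norm (F y) \<le> K * K * norm (c0_apply G (\<psi> y))" for y
          unfolding F_def by (rule bound)
      qed
      ultimately have F: "c0_apply (c0_of_fun F) = F"
        by (rule c0_apply_c0_of_fun)
      have "G = \<Phi> (c0_of_fun F)"
        by (rule c0_eqI) (simp add: T F F_def \<psi>\<phi> mult.assoc TT')
      then show "\<exists>F. G = \<Phi> F" ..
    qed
    ultimately show "bij \<Phi>"
      by (simp add: bij_def)
  qed
qed

end

theorem theorem2:
  assumes separable: "separable_space (euclidean :: 'h::chilbert_space topology)"
    and infinite_dimensional: "\<not> (\<exists>B :: 'h set. finite B \<and> cspan B = UNIV)"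
    and locally_compact: "locally_compact_space (euclidean :: 'x::t2_space topology)"
    and reflexive: "algebraically_reflexive (Aut :: (('x, complex) c0 \<Rightarrow> ('x, complex) c0) set)"
  shows "algebraically_reflexive (Aut :: (('x, 'h cblinop) c0 \<Rightarrow> ('x, 'h cblinop) c0) set)"
proof -
  \<comment> \<open>Orthogonality to the empty set: this merely provides a unit vector.\<close>
  obtain e :: 'h where e: "norm e = 1"
    using orthogonal_to_finite_exists[OF infinite_dimensional, of "{}"] by blast
  interpret operator_valued e "TYPE('x)"
    by standard (fact locally_compact, fact e)
  show ?thesis
    unfolding algebraically_reflexive_def
  proof
    show "ref_al Aut \<subseteq> (Aut :: (('x, 'h cblinop) c0 \<Rightarrow> ('x, 'h cblinop) c0) set)"
    proof
      fix \<Phi> :: "('x, 'h cblinop) c0 \<Rightarrow> ('x, 'h cblinop) c0"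
      assume \<Phi>: "\<Phi> \<in> ref_al Aut"
      interpret local_automorphism_c0 e "TYPE('x)" \<Phi>
        by unfold_locales (fact infinite_dimensional separable reflexive \<Phi>)+
      show "\<Phi> \<in> Aut"
        by (rule \<Phi>_Aut)
    qed
    \<comment> \<open>Members of \<open>ref_al\<close> are bounded, so this inclusion is the
      automatic continuity of automorphisms.\<close>
    show "(Aut :: (('x, 'h cblinop) c0 \<Rightarrow> ('x, 'h cblinop) c0) set) \<subseteq> ref_al Aut"
      using Aut_bounded by (auto simp: ref_al_def)
  qed
qed

end
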